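(* Let $N\geq 2$, let $(X,\mathcal{B},\mu)$, $T\colon X\to X$ and $\sigma_1,\dots,\sigma_N\colon X\to X$ be as in the context, and let $g\colon X\to[0,1]$ be a measurable function with $\sum_{i=1}^N g(\sigma_i(x))=1$ for a.a. $x\in X$. Let $R$ be the transfer operator $$(Rf)(x)=\sum_{Ty=x}g(y)f(y).$$ Then there is a one-to-one correspondence between (a) and (b) below: (a) functions $h\in L^1(X,\mu)$ with $h\ge 0$ and $R(h)=h$; (b) positive linear functionals $\omega_h$ on $\mathfrak{A}(X,T)$ (with $h\in L^1(X,\mu)$) such that, for all $f\in L^\infty(X)$, $$\omega_h(fU^n)=N^{\frac n2}\int_X f\sqrt{g^{(n)}}\,h\,d\mu,\qquad n\ge 0,$$ and $$\omega_h(U^{-1}fU^n)=N^{\frac{n-1}2}\int_X\sqrt{g^{(n-1)}}\,R(fh)\,d\mu,\qquad n\ge 1.$$ If $g$ is non-singular (i.e., $g$ does not vanish on a subset $E\subset X$ with $\mu(E)>0$) and if $\mu$ is $T$-ergodic, then the isometry $U$ induced from the Gelfand--Naimark--Segal construction applied to $\omega_h$ is unitary as an operator in the Hilbert space $\mathcal{H}_h$ of the GNS representation. The representation is unique up to unitary equivalence.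
   Context: $(X,\mathcal{B},\mu)$ is a measure space with $\mu$ a finite positive measure normalized by $\mu(X)=1$. $T\colon X\to X$ is measurable, onto, and $N$-to-one (for $\mu$-a.a. $x$, $T^{-1}(x)$ has cardinality $N$), and $\mu(T^{-1}(E))=\mu(E)$ for $E\in\mathcal{B}$. The maps $\sigma_i\colon X\to X$, $i=1,\dots,N$, are measurable with $T(\sigma_i(x))=x$ for $\mu$-a.a. $x$, and $\mu(\sigma_i(X)\cap\sigma_j(X))=0$ for $i\ne j$. Moreover $\mu=\frac1N\sum_{i=1}^N\mu\circ\sigma_i^{-1}$, equivalently $\int_Xf\,d\mu=\frac1N\sum_{i=1}^N\int_Xf\circ\sigma_i\,d\mu$ for all $\mathcal{B}$-measurable $f$. $\mathfrak{A}(X,T)$ is the $C^*$-algebra generated by $L^\infty(X)$ and a single unitary element $U$ subject to $UfU^{-1}=f\circ T$; it is the norm-closed linear span of the elements $U^{-n}fU^k$, $n,k\in\{0,1,2,\dots\}$, $f\in L^\infty(X)$. For $n\ge 1$, $g^{(n)}(x)=g(x)g(Tx)\cdots g(T^{n-1}x)$, and $g^{(0)}=1$. *)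

theory Defs
  imports "HOL-Probability.Probability"
begin

section \<open>Unital C*-algebras and complex Hilbert spaces\<close>

class scaleC = scaleR +
  fixes scaleC :: "complex \<Rightarrow> 'a \<Rightarrow> 'a" (infixr "*\<^sub>C" 75)

class complex_vector = real_vector + scaleC +
  assumes scaleC_add_right: "c *\<^sub>C (x + y) = c *\<^sub>C x + c *\<^sub>C y"
    and scaleC_add_left: "(c + d) *\<^sub>C x = c *\<^sub>C x + d *\<^sub>C x"
    and scaleC_scaleC: "c *\<^sub>C d *\<^sub>C x = (c * d) *\<^sub>C x"
    and scaleC_of_real: "complex_of_real r *\<^sub>C x = r *\<^sub>R x"

class cstar_algebra = real_normed_algebra_1 + banach + complex_vector +
  fixes adj :: "'a \<Rightarrow> 'a"
  assumes mult_scaleC_left: "(c *\<^sub>C x) * y = c *\<^sub>C (x * y)"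
    and mult_scaleC_right: "x * (c *\<^sub>C y) = c *\<^sub>C (x * y)"
    and norm_scaleC: "norm (c *\<^sub>C x) = cmod c * norm x"
    and adj_adj: "adj (adj x) = x"
    and adj_add: "adj (x + y) = adj x + adj y"
    and adj_scaleC: "adj (c *\<^sub>C x) = cnj c *\<^sub>C adj x"
    and adj_mult: "adj (x * y) = adj y * adj x"
    and cstar_identity: "norm (adj x * x) = (norm x)\<^sup>2"

text \<open>The inner product is linear in the second variable.\<close>

class chilbert_space = banach + complex_vector +
  fixes cinner :: "'a \<Rightarrow> 'a \<Rightarrow> complex"
  assumes cinner_commute: "cinner x y = cnj (cinner y x)"
    and cinner_add_right: "cinner x (y + z) = cinner x y + cinner x z"
    and cinner_scaleC_right: "cinner x (c *\<^sub>C y) = c * cinner x y"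
    and cinner_ge_zero: "cinner x x \<in> \<real>\<^sub>\<ge>\<^sub>0"
    and norm_eq_sqrt_cinner: "norm x = sqrt (Re (cinner x x))"

definition bounded_clinear :: "('h::chilbert_space \<Rightarrow> 'k::chilbert_space) \<Rightarrow> bool" where
  "bounded_clinear V \<longleftrightarrow> bounded_linear V \<and> (\<forall>c x. V (c *\<^sub>C x) = c *\<^sub>C V x)"

definition unitary_map :: "('h::chilbert_space \<Rightarrow> 'k::chilbert_space) \<Rightarrow> bool" where
  "unitary_map V \<longleftrightarrow>
     bounded_clinear V \<and> (\<forall>x y. cinner (V x) (V y) = cinner x y) \<and> surj V"

definition positive_functional :: "('a::cstar_algebra \<Rightarrow> complex) \<Rightarrow> bool" where
  "positive_functional \<omega> \<longleftrightarrow>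
     (\<forall>a b. \<omega> (a + b) = \<omega> a + \<omega> b) \<and> (\<forall>c a. \<omega> (c *\<^sub>C a) = c * \<omega> a) \<and>
     (\<forall>a. \<omega> (adj a * a) \<in> \<real>\<^sub>\<ge>\<^sub>0)"

definition star_rep :: "('a::cstar_algebra \<Rightarrow> 'h::chilbert_space \<Rightarrow> 'h) \<Rightarrow> bool" where
  "star_rep \<pi> \<longleftrightarrow>
     (\<forall>a. bounded_clinear (\<pi> a)) \<and>
     (\<forall>a b x. \<pi> (a + b) x = \<pi> a x + \<pi> b x) \<and> (\<forall>c a x. \<pi> (c *\<^sub>C a) x = c *\<^sub>C \<pi> a x) \<and>
     (\<forall>a b x. \<pi> (a * b) x = \<pi> a (\<pi> b x)) \<and> (\<forall>x. \<pi> 1 x = x) \<and>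
     (\<forall>a x y. cinner (\<pi> (adj a) x) y = cinner x (\<pi> a y))"

text \<open>\<open>\<pi>\<close> on the Hilbert space \<open>'h\<close>, with cyclic vector \<open>\<Omega>\<close>, is a GNS representation
  of \<open>\<omega>\<close>: the map \<open>a \<mapsto> \<pi> a \<Omega>\<close> identifies \<open>'h\<close> with the completion of the algebra modulo
  \<open>{a. \<omega> (adj a * a) = 0}\<close> for the inner product \<open>\<omega> (adj a * b)\<close>.\<close>

definition gns_rep ::
  "('a::cstar_algebra \<Rightarrow> complex) \<Rightarrow> ('a \<Rightarrow> 'h::chilbert_space \<Rightarrow> 'h) \<Rightarrow> 'h \<Rightarrow> bool" where
  "gns_rep \<omega> \<pi> \<Omega> \<longleftrightarrow>
     star_rep \<pi> \<and> closure (range (\<lambda>a. \<pi> a \<Omega>)) = UNIV \<and> (\<forall>a. \<omega> a = cinner \<Omega> (\<pi> a \<Omega>))"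


section \<open>The dynamical system\<close>

text \<open>Images \<open>\<sigma> i ` space M\<close> need not be measurable, so their overlaps are required to be null
  for the completed measure.\<close>

definition branched_system :: "'x measure \<Rightarrow> ('x \<Rightarrow> 'x) \<Rightarrow> nat \<Rightarrow> (nat \<Rightarrow> 'x \<Rightarrow> 'x) \<Rightarrow> bool" where
  "branched_system M T N \<sigma> \<longleftrightarrow>
     prob_space M \<and>
     T \<in> measurable M M \<and> T ` space M = space M \<and>
     (AE x in M. card {y \<in> space M. T y = x} = N) \<and>
     (\<forall>E\<in>sets M. measure M (T -` E \<inter> space M) = measure M E) \<and>
     (\<forall>i\<in>{1..N}. \<sigma> i \<in> measurable M M \<and> (AE x in M. T (\<sigma> i x) = x)) \<and>
     (\<forall>i\<in>{1..N}. \<forall>j\<in>{1..N}. i \<noteq> j \<longrightarrow>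
        \<sigma> i ` space M \<inter> \<sigma> j ` space M \<in> null_sets (completion M)) \<and>
     (\<forall>E\<in>sets M. measure M E = (\<Sum>i=1..N. measure M (\<sigma> i -` E \<inter> space M)) / real N)"

definition ergodic :: "'x measure \<Rightarrow> ('x \<Rightarrow> 'x) \<Rightarrow> bool" where
  "ergodic M T \<longleftrightarrow>
     (\<forall>E\<in>sets M. T -` E \<inter> space M = E \<longrightarrow> measure M E = 0 \<or> measure M E = 1)"

definition nonsingular :: "'x measure \<Rightarrow> ('x \<Rightarrow> real) \<Rightarrow> bool" where
  "nonsingular M g \<longleftrightarrow> \<not> (\<exists>E\<in>sets M. measure M E > 0 \<and> (\<forall>x\<in>E. g x = 0))"

definition cocycle :: "('x \<Rightarrow> 'x) \<Rightarrow> ('x \<Rightarrow> real) \<Rightarrow> nat \<Rightarrow> 'x \<Rightarrow> real" where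
  "cocycle T g n x = (\<Prod>j<n. g ((T ^^ j) x))"

text \<open>Almost every fibre of \<open>T\<close> is finite; on the remaining null set the value is irrelevant.\<close>

definition transfer_op ::
  "'x measure \<Rightarrow> ('x \<Rightarrow> 'x) \<Rightarrow> ('x \<Rightarrow> real) \<Rightarrow> ('x \<Rightarrow> complex) \<Rightarrow> 'x \<Rightarrow> complex" where
  "transfer_op M T g f x = (\<Sum>y | y \<in> space M \<and> T y = x. complex_of_real (g y) * f y)"

definition Linf :: "'x measure \<Rightarrow> ('x \<Rightarrow> complex) set" where
  "Linf M = {f \<in> borel_measurable M. \<exists>C. AE x in M. cmod (f x) \<le> C}"

definition L1_eq :: "'x measure \<Rightarrow> (('x \<Rightarrow> complex) \<times> ('x \<Rightarrow> complex)) set" where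
  "L1_eq M = {(h, k). integrable M h \<and> integrable M k \<and> (AE x in M. h x = k x)}"

definition harmonic ::
  "'x measure \<Rightarrow> ('x \<Rightarrow> 'x) \<Rightarrow> ('x \<Rightarrow> real) \<Rightarrow> ('x \<Rightarrow> complex) set" where
  "harmonic M T g =
     {h. integrable M h \<and> (AE x in M. h x \<in> \<real>\<^sub>\<ge>\<^sub>0) \<and> (AE x in M. transfer_op M T g h x = h x)}"


section \<open>The universal C*-algebra generated by L-infinity and a unitary\<close>

text \<open>The free unital *-algebra on the symbols \<open>Fn f\<close>, \<open>GU\<close>, \<open>GUi\<close>, with involution
  determined by \<open>Fn f \<mapsto> Fn (cnj \<circ> f)\<close> and \<open>GU \<mapsto> GUi\<close>: finitely supported complex functions on
  words, multiplied by convolution along concatenation of words.\<close>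

datatype 'x letter = Fn "'x \<Rightarrow> complex" | GU | GUi

type_synonym 'x ncpoly = "'x letter list \<Rightarrow> complex"

fun letter_star :: "'x letter \<Rightarrow> 'x letter" where
  "letter_star (Fn f) = Fn (\<lambda>x. cnj (f x))"
| "letter_star GU = GUi"
| "letter_star GUi = GU"

definition free_alg :: "'x measure \<Rightarrow> 'x ncpoly set" where
  "free_alg M = {a. finite {w. a w \<noteq> 0} \<and>
     (\<forall>w. a w \<noteq> 0 \<longrightarrow> (\<forall>f. Fn f \<in> set w \<longrightarrow> f \<in> Linf M))}"

definition nc_word :: "'x letter list \<Rightarrow> 'x ncpoly" where
  "nc_word w = (\<lambda>v. if v = w then 1 else 0)"

definition nc_mult :: "'x ncpoly \<Rightarrow> 'x ncpoly \<Rightarrow> 'x ncpoly" where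
  "nc_mult a b = (\<lambda>w. \<Sum>i\<le>length w. a (take i w) * b (drop i w))"

definition nc_star :: "'x ncpoly \<Rightarrow> 'x ncpoly" where
  "nc_star a = (\<lambda>w. cnj (a (rev (map letter_star w))))"

definition cstar_seminorm :: "'x measure \<Rightarrow> ('x ncpoly \<Rightarrow> real) \<Rightarrow> bool" where
  "cstar_seminorm M p \<longleftrightarrow>
     (\<forall>a\<in>free_alg M. \<forall>b\<in>free_alg M. p (\<lambda>w. a w + b w) \<le> p a + p b) \<and>
     (\<forall>a\<in>free_alg M. \<forall>c. p (\<lambda>w. c * a w) = cmod c * p a) \<and>
     (\<forall>a\<in>free_alg M. \<forall>b\<in>free_alg M. p (nc_mult a b) \<le> p a * p b) \<and>
     (\<forall>a\<in>free_alg M. p (nc_mult (nc_star a) a) = (p a)\<^sup>2)"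

inductive nc_relation :: "'x measure \<Rightarrow> ('x \<Rightarrow> 'x) \<Rightarrow> 'x ncpoly \<Rightarrow> 'x ncpoly \<Rightarrow> bool"
  for M :: "'x measure" and T :: "'x \<Rightarrow> 'x" where
  AE_eq: "f \<in> Linf M \<Longrightarrow> k \<in> Linf M \<Longrightarrow> (AE x in M. f x = k x) \<Longrightarrow>
     nc_relation M T (nc_word [Fn f]) (nc_word [Fn k])"
| add: "f \<in> Linf M \<Longrightarrow> k \<in> Linf M \<Longrightarrow>
     nc_relation M T (nc_word [Fn (\<lambda>x. f x + k x)]) (\<lambda>w. nc_word [Fn f] w + nc_word [Fn k] w)"
| scale: "f \<in> Linf M \<Longrightarrow>
     nc_relation M T (nc_word [Fn (\<lambda>x. c * f x)]) (\<lambda>w. c * nc_word [Fn f] w)"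
| mult: "f \<in> Linf M \<Longrightarrow> k \<in> Linf M \<Longrightarrow>
     nc_relation M T (nc_word [Fn (\<lambda>x. f x * k x)]) (nc_word [Fn f, Fn k])"
| one: "nc_relation M T (nc_word [Fn (\<lambda>x. 1)]) (nc_word [])"
| unitary_left: "nc_relation M T (nc_word [GUi, GU]) (nc_word [])"
| unitary_right: "nc_relation M T (nc_word [GU, GUi]) (nc_word [])"
| covariance: "f \<in> Linf M \<Longrightarrow> nc_relation M T (nc_word [GU, Fn f, GUi]) (nc_word [Fn (f \<circ> T)])"

fun letter_val :: "(('x \<Rightarrow> complex) \<Rightarrow> 'a::cstar_algebra) \<Rightarrow> 'a \<Rightarrow> 'x letter \<Rightarrow> 'a" where
  "letter_val \<iota> u (Fn f) = \<iota> f"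
| "letter_val \<iota> u GU = u"
| "letter_val \<iota> u GUi = adj u"

definition nc_eval :: "(('x \<Rightarrow> complex) \<Rightarrow> 'a::cstar_algebra) \<Rightarrow> 'a \<Rightarrow> 'x ncpoly \<Rightarrow> 'a" where
  "nc_eval \<iota> u a = (\<Sum>w | a w \<noteq> 0. a w *\<^sub>C prod_list (map (letter_val \<iota> u) w))"

definition covariant_pair ::
  "'x measure \<Rightarrow> ('x \<Rightarrow> 'x) \<Rightarrow> (('x \<Rightarrow> complex) \<Rightarrow> 'a::cstar_algebra) \<Rightarrow> 'a \<Rightarrow> bool" where
  "covariant_pair M T \<iota> u \<longleftrightarrow>
     (\<forall>f\<in>Linf M. \<forall>k\<in>Linf M. (AE x in M. f x = k x) \<longrightarrow> \<iota> f = \<iota> k) \<and>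
     (\<forall>f\<in>Linf M. \<forall>k\<in>Linf M. \<iota> (\<lambda>x. f x + k x) = \<iota> f + \<iota> k) \<and>
     (\<forall>f\<in>Linf M. \<forall>c. \<iota> (\<lambda>x. c * f x) = c *\<^sub>C \<iota> f) \<and>
     (\<forall>f\<in>Linf M. \<forall>k\<in>Linf M. \<iota> (\<lambda>x. f x * k x) = \<iota> f * \<iota> k) \<and>
     \<iota> (\<lambda>x. 1) = 1 \<and>
     (\<forall>f\<in>Linf M. \<iota> (\<lambda>x. cnj (f x)) = adj (\<iota> f)) \<and>
     adj u * u = 1 \<and> u * adj u = 1 \<and>
     (\<forall>f\<in>Linf M. u * \<iota> f * adj u = \<iota> (f \<circ> T))"

text \<open>The type \<open>'a\<close>, with the canonical map \<open>\<iota>\<close> of L-infinity and the unitary \<open>u\<close>, is the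
  C*-algebra \<open>\<AA>(X,T)\<close>. The second conjunct says that it is the closed linear span of the
  elements \<open>u\<^sup>-\<^sup>n f u\<^sup>k\<close>; the real span is already complex, as \<open>f\<close> absorbs complex scalars.
  The last conjunct is the universal property: the norm dominates every C*-seminorm on the free
  *-algebra that respects the relations. Since such seminorms are exactly the maps
  \<open>a \<mapsto> norm (nc_eval \<rho> v a)\<close> for covariant pairs \<open>(\<rho>, v)\<close> in arbitrary C*-algebras \<open>B\<close> (together
  with 0), this means that every such pair is the image of \<open>(\<iota>, u)\<close> under a *-homomorphism
  into \<open>B\<close>, without quantifying over types.\<close>

definition is_covariance_algebra ::
  "'x measure \<Rightarrow> ('x \<Rightarrow> 'x) \<Rightarrow> (('x \<Rightarrow> complex) \<Rightarrow> 'a::cstar_algebra) \<Rightarrow> 'a \<Rightarrow> bool" where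
  "is_covariance_algebra M T \<iota> u \<longleftrightarrow>
     covariant_pair M T \<iota> u \<and>
     closure (span {adj u ^ n * \<iota> f * u ^ k | n f k. f \<in> Linf M}) = UNIV \<and>
     (\<forall>p. cstar_seminorm M p \<and> (\<forall>a b. nc_relation M T a b \<longrightarrow> p (\<lambda>w. a w - b w) = 0) \<longrightarrow>
        (\<forall>a\<in>free_alg M. p a \<le> norm (nc_eval \<iota> u a)))"


section \<open>The functionals attached to harmonic functions\<close>

text \<open>The transfer operator produces functions that are measurable only up to null sets, hence
  the integral over the completed measure space in the second formula.\<close>

definition represents ::
  "'x measure \<Rightarrow> ('x \<Rightarrow> 'x) \<Rightarrow> nat \<Rightarrow> ('x \<Rightarrow> real) \<Rightarrow> (('x \<Rightarrow> complex) \<Rightarrow> 'a::cstar_algebra) \<Rightarrow> 'a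
    \<Rightarrow> ('x \<Rightarrow> complex) \<Rightarrow> ('a \<Rightarrow> complex) \<Rightarrow> bool" where
  "represents M T N g \<iota> u h \<omega> \<longleftrightarrow>
     (\<forall>f\<in>Linf M. \<forall>n. \<omega> (\<iota> f * u ^ n) =
        complex_of_real (real N powr (real n / 2)) *
        (LINT x|M. f x * complex_of_real (sqrt (cocycle T g n x)) * h x)) \<and>
     (\<forall>f\<in>Linf M. \<forall>n\<ge>1. \<omega> (adj u * \<iota> f * u ^ n) =
        complex_of_real (real N powr ((real n - 1) / 2)) *
        (LINT x|completion M. complex_of_real (sqrt (cocycle T g (n - 1) x)) *
           transfer_op M T g (\<lambda>y. f y * h y) x))"

end

theory Submission
  imports Defs
begin

text \<open>
  The idea is that the functional \<open>\<omega>\<close> attached to a harmonic \<open>h\<close> is the vector state of a cyclic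
  vector \<open>\<Omega>\<close> that satisfies the refinement equation \<open>U \<Omega> = m \<Omega>\<close> with \<open>m = sqrt (N g)\<close>. The algebra
  acts by the minimal unitary dilation of the isometry \<open>\<xi> \<mapsto> m (\<xi> \<circ> T)\<close> of \<open>L\<^sup>2(h d\<mu>)\<close>; that this
  map is isometric is just the equation \<open>R h = h\<close>, because \<open>R\<close> is dual to composition with \<open>T\<close>.

  \<^emph>\<open>From \<open>\<omega>\<close> to \<open>h\<close>.\<close> The first formula determines \<open>h\<close> and positivity of \<open>\<omega>\<close> gives \<open>h \<ge> 0\<close>.
  Comparing both formulas on the relation \<open>U\<^sup>-\<^sup>1 (f \<circ> T) U = f\<close> gives \<open>R h = h\<close>
  (\<open>represents_imp_harmonic\<close>).

  \<^emph>\<open>Uniqueness of \<open>\<omega>\<close>.\<close> Together with \<open>R h = h\<close>, the formula for \<open>\<omega> (f U\<^sup>n)\<close> implies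
  \<open>\<omega> ((U - m)\<^sup>* (U - m)) = 0\<close> (\<open>refinement\<close>), so by Cauchy--Schwarz every power of \<open>U\<close> on the right, and hence every power of \<open>U\<^sup>-\<^sup>1\<close> on the left, may be
  replaced by a function under \<open>\<omega>\<close> (\<open>value_monomial\<close>). The values on the spanning monomials
  \<open>U\<^sup>-\<^sup>n f U\<^sup>k\<close> are therefore integrals against \<open>h\<close>, and a positive functional is continuous
  (\<open>pf_norm_le\<close>).

  \<^emph>\<open>Existence of \<open>\<omega>\<close>.\<close> The dilation is realized on a semi-inner product space of functions
  \<open>F (L, x)\<close>, where \<open>L\<close> counts negative powers of \<open>U\<close>. Its operator norm is a C*-seminorm on the free
  *-algebra (\<open>cstar_seminorm_opnorm\<close>) that respects the relations, so the universal property bounds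
  it by the norm of the C*-algebra. The vector state of \<open>\<Omega>\<close> is then bounded on a dense *-subalgebra, and
  it extends to a positive functional (\<open>functional_exists\<close>).

  In the GNS representation \<open>U\<close> is unitary because it is so in the algebra, and two GNS
  representations are intertwined by the map that matches the orbits of the cyclic vectors, since
  \<open>\<omega>\<close> determines all inner products (\<open>gns_unique\<close>).
\<close>

section \<open>Positive functionals on C*-algebras\<close>

lemma scaleC_zero_left [simp]: "0 *\<^sub>C x = (0 :: 'a::complex_vector)"
  using scaleC_of_real[of 0 x] by simp

lemma scaleC_zero_right [simp]: "c *\<^sub>C 0 = (0 :: 'a::complex_vector)"
  using scaleC_add_right[of c 0 "0::'a"] by simp

lemma scaleC_one [simp]: "1 *\<^sub>C x = (x :: 'a::complex_vector)"
  using scaleC_of_real[of 1 x] by simp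

lemma scaleR_conv_scaleC: "r *\<^sub>R x = complex_of_real r *\<^sub>C (x :: 'a::complex_vector)"
  by (simp add: scaleC_of_real)

lemma scaleC_sum_right: "c *\<^sub>C (\<Sum>i\<in>A. f i) = (\<Sum>i\<in>A. c *\<^sub>C (f i :: 'a::complex_vector))"
  by (induction A rule: infinite_finite_induct) (simp_all add: scaleC_add_right)

lemma adj_zero [simp]: "adj 0 = (0 :: 'a::cstar_algebra)"
  using adj_add[of 0 "0::'a"] by simp

lemma adj_minus: "adj (- x) = - adj (x :: 'a::cstar_algebra)"
  using adj_add[of x "- x"] by (simp add: eq_neg_iff_add_eq_0 add.commute)

lemma adj_diff: "adj (x - y) = adj x - adj (y :: 'a::cstar_algebra)"
  using adj_add[of x "- y"] by (simp add: adj_minus)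

lemma adj_one [simp]: "adj 1 = (1 :: 'a::cstar_algebra)"
  by (metis adj_adj adj_mult mult.right_neutral mult.left_neutral)

lemma adj_scaleR: "adj (r *\<^sub>R x) = r *\<^sub>R adj (x :: 'a::cstar_algebra)"
  by (simp add: scaleR_conv_scaleC adj_scaleC)

lemma adj_sum: "adj (\<Sum>i\<in>A. f i) = (\<Sum>i\<in>A. adj (f i :: 'a::cstar_algebra))"
  by (induction A rule: infinite_finite_induct) (simp_all add: adj_add)

lemma norm_adj [simp]: "norm (adj x) = norm (x :: 'a::cstar_algebra)"
proof -
  have le: "norm y \<le> norm (adj y)" for y :: 'a
  proof (cases "y = 0")
    case False
    have "norm y * norm y \<le> norm (adj y) * norm y"
      using cstar_identity[of y] norm_mult_ineq[of "adj y" y] by (simp add: power2_eq_square)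
    with False show ?thesis by simp
  qed simp
  show ?thesis using le[of x] le[of "adj x"] by (simp add: adj_adj)
qed

lemma bounded_linear_adj: "bounded_linear (adj :: 'a::cstar_algebra \<Rightarrow> 'a)"
  by (rule bounded_linear_intro[where K = 1]) (simp_all add: adj_add adj_scaleR)

text \<open>A self-adjoint \<open>x\<close> of norm less than 1 makes \<open>1 - x\<close> a square: \<open>(1 - y)\<^sup>2 = 1 - x\<close> says that
  \<open>y\<close> is a fixed point of \<open>y \<mapsto> (x + y\<^sup>2) / 2\<close>, which is a contraction of the self-adjoint part of
  the ball of radius \<open>norm x\<close>. This replaces the continuous functional calculus.\<close>

lemma one_minus_selfadjoint_eq_square:
  fixes x :: "'a::cstar_algebra"
  assumes sa: "adj x = x" and less: "norm x < 1"
  obtains y where "adj y = y" "y * y = 1 - x"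
proof -
  define r where "r = norm x"
  define S where "S = {y::'a. adj y = y \<and> norm y \<le> r}"
  define f where "f y = (1/2) *\<^sub>R (x + y * y)" for y :: 'a
  have r: "0 \<le> r" "r < 1" using less by (auto simp: r_def)
  have cont: "continuous_on UNIV (adj :: 'a \<Rightarrow> 'a)"
    by (rule linear_continuous_on[OF bounded_linear_adj])
  have "S = {y. adj y = y} \<inter> cball 0 r" by (auto simp: S_def)
  moreover have "closed {y::'a. adj y = y}"
    using cont by (intro closed_Collect_eq continuous_intros) auto
  ultimately have "closed S" by (metis closed_Int closed_cball)
  then have "uniform_space_class.complete S" by (simp add: complete_eq_closed)
  moreover have "S \<noteq> {}" using sa by (auto simp: S_def r_def)
  moreover have "f ` S \<subseteq> S"
  proof (rule image_subsetI)
    fix y assume y: "y \<in> S"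
    have "norm (x + y * y) \<le> r + norm y * norm y"
      using norm_triangle_ineq[of x "y * y"] norm_mult_ineq[of y y] by (simp add: r_def)
    also have "\<dots> \<le> r + r * 1"
      using y r by (intro add_left_mono mult_mono) (auto simp: S_def)
    finally show "f y \<in> S"
      using y sa by (auto simp: S_def f_def adj_scaleR adj_add adj_mult)
  qed
  moreover have "\<forall>y\<in>S. \<forall>z\<in>S. dist (f y) (f z) \<le> r * dist y z"
  proof (intro ballI)
    fix y z assume yz: "y \<in> S" "z \<in> S"
    have eq: "f y - f z = (1/2) *\<^sub>R (y * (y - z) + (y - z) * z)"
      by (simp add: f_def algebra_simps)
    have "norm (y * (y - z) + (y - z) * z) \<le> norm y * norm (y - z) + norm (y - z) * norm z"
      by (intro norm_triangle_le add_mono norm_mult_ineq)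
    also have "\<dots> \<le> r * norm (y - z) + norm (y - z) * r"
      using yz r by (intro add_mono mult_mono) (auto simp: S_def)
    finally show "dist (f y) (f z) \<le> r * dist y z"
      unfolding dist_norm eq by (simp add: mult.commute)
  qed
  ultimately obtain y where y: "y \<in> S" "f y = y"
    using Banach_fix[of S r f] r by blast
  have "2 *\<^sub>R y = x + y * y"
    using arg_cong[OF y(2), of "\<lambda>v. 2 *\<^sub>R v"] by (simp add: f_def)
  then have "(1 - y) * (1 - y) = 1 - x"
    by (simp add: algebra_simps scaleR_2)
  moreover have "adj (1 - y) = 1 - y" using y by (simp add: S_def adj_diff)
  ultimately show thesis using that by blast
qed

text \<open>The discriminant argument behind every Cauchy--Schwarz inequality for a semi-inner product.\<close>

lemma Cauchy_Schwarz_of_quadratic: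
  fixes P R :: real and Q :: complex
  assumes nonneg: "\<And>t. 0 \<le> P + 2 * Re (t * Q) + (cmod t)\<^sup>2 * R"
  shows "(cmod Q)\<^sup>2 \<le> P * R"
proof -
  have quad: "0 \<le> P - 2 * s * (cmod Q)\<^sup>2 + s\<^sup>2 * (cmod Q)\<^sup>2 * R" for s :: real
  proof -
    have "cnj Q * Q = complex_of_real ((cmod Q)\<^sup>2)"
      using complex_norm_square[of Q] by (simp add: mult.commute)
    then have "Re (- s * cnj Q * Q) = - s * (cmod Q)\<^sup>2"
      by (metis (no_types, lifting) Re_complex_of_real mult.assoc mult_minus_left of_real_minus of_real_mult)
    then show ?thesis
      using nonneg[of "- s * cnj Q"] by (simp add: norm_mult power_mult_distrib)
  qed
  have P: "0 \<le> P" using quad[of 0] by simp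
  show ?thesis
  proof (cases "R \<le> 0")
    case True
    have Q0: "cmod Q = 0"
    proof (rule ccontr)
      assume "cmod Q \<noteq> 0"
      then have pos: "(cmod Q)\<^sup>2 > 0" by simp
      have "(P + 1) / (cmod Q)\<^sup>2 * (cmod Q)\<^sup>2 = P + 1" using pos by simp
      moreover have "((P + 1) / (cmod Q)\<^sup>2)\<^sup>2 * (cmod Q)\<^sup>2 * R \<le> 0"
        using True by (intro mult_nonneg_nonpos) auto
      ultimately show False
        using quad[of "(P + 1) / (cmod Q)\<^sup>2"] P by linarith
    qed
    have "0 \<le> R"
    proof (rule ccontr)
      assume R: "\<not> 0 \<le> R"
      define t where "t = sqrt ((P + 1) / - R)"
      have "t\<^sup>2 = (P + 1) / - R" using R P by (simp add: t_def divide_nonneg_neg)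
      then have "t\<^sup>2 * R = - (P + 1)" using R by (simp add: field_simps)
      then show False using nonneg[of "of_real t"] Q0 by simp
    qed
    with True Q0 show ?thesis by simp
  next
    case False
    then show ?thesis
      using quad[of "1 / R"] by (simp add: field_simps power2_eq_square)
  qed
qed

context
  fixes \<omega> :: "'a::cstar_algebra \<Rightarrow> complex"
  assumes pos: "positive_functional \<omega>"
begin

lemma pf_add: "\<omega> (a + b) = \<omega> a + \<omega> b"
  and pf_scaleC: "\<omega> (c *\<^sub>C a) = c * \<omega> a"
  and pf_square: "\<omega> (adj a * a) \<in> \<real>\<^sub>\<ge>\<^sub>0"
  using pos unfolding positive_functional_def by blast+

lemma pf_minus: "\<omega> (- a) = - \<omega> a"
  using pf_add[of a "- a"] pf_scaleC[of 0 a] by (simp add: eq_neg_iff_add_eq_0 add.commute)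

lemma pf_diff: "\<omega> (a - b) = \<omega> a - \<omega> b"
  using pf_add[of a "- b"] by (simp add: pf_minus)

lemma pf_scaleR: "\<omega> (r *\<^sub>R a) = complex_of_real r * \<omega> a"
  by (simp add: scaleR_conv_scaleC pf_scaleC)

lemma pf_quadratic:
  "\<omega> (adj (a + t *\<^sub>C b) * (a + t *\<^sub>C b)) =
    \<omega> (adj a * a) + t * \<omega> (adj a * b) + cnj t * \<omega> (adj b * a) + complex_of_real ((cmod t)\<^sup>2) * \<omega> (adj b * b)"
proof -
  have "adj (a + t *\<^sub>C b) * (a + t *\<^sub>C b)
      = adj a * a + t *\<^sub>C (adj a * b) + cnj t *\<^sub>C (adj b * a) + (cnj t * t) *\<^sub>C (adj b * b)"
    by (simp add: adj_add adj_scaleC distrib_left distrib_right mult_scaleC_left mult_scaleC_right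
        scaleC_scaleC scaleC_add_right mult.commute add_ac)
  then show ?thesis
    by (simp add: pf_add pf_scaleC complex_norm_square[unfolded of_real_power[symmetric]] mult.commute del: of_real_power)
qed

lemma pf_hermitian: "\<omega> (adj b * a) = cnj (\<omega> (adj a * b))"
proof -
  have real: "Im (\<omega> (adj c * c)) = 0" for c
    using pf_square[of c] by (auto simp: complex_nonneg_Reals_iff)
  have *: "Im (t * \<omega> (adj a * b) + cnj t * \<omega> (adj b * a)) = 0" for t
    using real[of "a + t *\<^sub>C b"] real[of a] real[of b] unfolding pf_quadratic by simp
  from *[of 1] *[of \<i>] show ?thesis by (simp add: complex_eq_iff)
qed

lemma pf_adj: "\<omega> (adj a) = cnj (\<omega> a)"
  using pf_hermitian[of a 1] by simp

lemma pf_Cauchy_Schwarz: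
  "(cmod (\<omega> (adj a * b)))\<^sup>2 \<le> Re (\<omega> (adj a * a)) * Re (\<omega> (adj b * b))"
proof (rule Cauchy_Schwarz_of_quadratic)
  fix t
  have "0 \<le> Re (\<omega> (adj (a + t *\<^sub>C b) * (a + t *\<^sub>C b)))"
    using pf_square by (simp add: complex_nonneg_Reals_iff)
  also have "\<dots> = Re (\<omega> (adj a * a)) + 2 * Re (t * \<omega> (adj a * b)) + (cmod t)\<^sup>2 * Re (\<omega> (adj b * b))"
    unfolding pf_quadratic pf_hermitian[of b a] by simp
  finally show "0 \<le> \<dots>" .
qed

text \<open>An element on which the form \<open>\<omega> (adj a * a)\<close> vanishes represents the zero vector in the GNS
  space, and so do its left multiples.\<close>

lemma pf_left_kernel:
  assumes "\<omega> (adj d * d) = 0"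
  shows "\<omega> (b * d) = 0"
  using pf_Cauchy_Schwarz[of "adj b" d] assms by (simp add: adj_adj)

text \<open>For \<open>s > norm x\<close> the element \<open>1 - x / s\<close> is a square \<open>y\<^sup>* y\<close>, so \<open>\<omega>\<close> is nonnegative on it; then let
  \<open>s\<close> tend to \<open>norm x\<close>.\<close>

lemma pf_selfadjoint_le:
  assumes sa: "adj x = x"
  shows "Re (\<omega> x) \<le> Re (\<omega> 1) * norm x"
proof (rule field_le_epsilon)
  fix e :: real assume e: "e > 0"
  have one: "0 \<le> Re (\<omega> 1)" using pf_square[of 1] by (simp add: complex_nonneg_Reals_iff)
  \<comment> \<open>The summand 1 keeps the denominator positive even for \<open>\<omega> = 0\<close>.\<close>
  define s where "s = norm x + e / (Re (\<omega> 1) + 1)"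
  have s: "s > norm x" "s > 0" using e one by (auto simp: s_def intro: add_nonneg_pos)
  have "norm ((1/s) *\<^sub>R x) < 1" using s by simp
  then obtain y where y: "adj y = y" "y * y = 1 - (1/s) *\<^sub>R x"
    using one_minus_selfadjoint_eq_square[of "(1/s) *\<^sub>R x"] sa by (auto simp: adj_scaleR)
  have "0 \<le> Re (\<omega> (1 - (1/s) *\<^sub>R x))"
    using pf_square[of y] y by (simp add: complex_nonneg_Reals_iff)
  also have "\<dots> = Re (\<omega> 1) - Re (\<omega> x) / s" by (simp add: pf_diff pf_scaleR)
  finally have "Re (\<omega> x) \<le> Re (\<omega> 1) * s" using s by (simp add: field_simps)
  also have "\<dots> = Re (\<omega> 1) * norm x + e * (Re (\<omega> 1) / (Re (\<omega> 1) + 1))"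
    by (simp add: s_def algebra_simps)
  also have "\<dots> \<le> Re (\<omega> 1) * norm x + e * 1"
    using e one by (intro add_left_mono mult_left_mono) auto
  finally show "Re (\<omega> x) \<le> Re (\<omega> 1) * norm x + e" by simp
qed

lemma pf_norm_le: "cmod (\<omega> a) \<le> Re (\<omega> 1) * norm a"
proof -
  have one: "0 \<le> Re (\<omega> 1)" using pf_square[of 1] by (simp add: complex_nonneg_Reals_iff)
  have "(cmod (\<omega> a))\<^sup>2 \<le> Re (\<omega> 1) * Re (\<omega> (adj a * a))"
    using pf_Cauchy_Schwarz[of 1 a] by simp
  also have "\<dots> \<le> Re (\<omega> 1) * (Re (\<omega> 1) * norm (adj a * a))"
    using one by (intro mult_left_mono pf_selfadjoint_le) (simp_all add: adj_mult adj_adj)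
  also have "\<dots> = (Re (\<omega> 1) * norm a)\<^sup>2"
    by (simp add: cstar_identity power2_eq_square)
  finally show ?thesis by (rule power2_le_imp_le) (use one in simp)
qed

lemma bounded_linear_pf: "bounded_linear \<omega>"
proof (rule bounded_linear_intro)
  show "\<omega> (a + b) = \<omega> a + \<omega> b" for a b by (rule pf_add)
  show "\<omega> (r *\<^sub>R a) = r *\<^sub>R \<omega> a" for r a by (simp add: pf_scaleR scaleR_conv_of_real[of r "\<omega> a"])
  show "cmod (\<omega> a) \<le> norm a * Re (\<omega> 1)" for a using pf_norm_le[of a] by (simp add: mult.commute)
qed

end


section \<open>GNS representations\<close>

text \<open>A linear map known only through its graph \<open>{(J i, K i) | i \<in> I}\<close> is well defined as soon as it
  is bounded, since \<open>J i = J j\<close> forces \<open>K i = K j\<close>; over a dense domain it then extends by uniform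
  continuity.\<close>

lemma bounded_linear_extension_of_graph:
  fixes J :: "'i \<Rightarrow> 'a::real_normed_vector" and K :: "'i \<Rightarrow> 'b::banach"
  assumes comb: "\<And>i j r. i \<in> I \<Longrightarrow> j \<in> I \<Longrightarrow> \<exists>k\<in>I. J k = J i + r *\<^sub>R J j \<and> K k = K i + r *\<^sub>R K j"
    and bound: "\<And>i. i \<in> I \<Longrightarrow> norm (K i) \<le> C * norm (J i)"
    and dense: "closure (J ` I) = UNIV"
  obtains F where "bounded_linear F" "\<And>i. i \<in> I \<Longrightarrow> F (J i) = K i"
proof -
  have I: "I \<noteq> {}" using dense by auto
  have diff: "norm (K i - K j) \<le> C * norm (J i - J j)" if ij: "i \<in> I" "j \<in> I" for i j
    using comb[OF ij, of "-1"] bound by force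
  define f where "f x = K (SOME i. i \<in> I \<and> J i = x)" for x
  have f: "f (J i) = K i" if "i \<in> I" for i
  proof -
    have "\<exists>j. j \<in> I \<and> J j = J i" using that by auto
    then have "(SOME j. j \<in> I \<and> J j = J i) \<in> I" "J (SOME j. j \<in> I \<and> J j = J i) = J i"
      using someI_ex[of "\<lambda>j. j \<in> I \<and> J j = J i"] by blast+
    with diff[OF this(1) that] show ?thesis by (simp add: f_def)
  qed
  have lip: "dist (f x) (f y) \<le> \<bar>C\<bar> * dist x y" if xy: "x \<in> J ` I" "y \<in> J ` I" for x y
  proof -
    obtain i j where ij: "i \<in> I" "j \<in> I" "x = J i" "y = J j" using xy by auto
    have "norm (K i - K j) \<le> C * norm (J i - J j)" using diff ij by blast
    also have "\<dots> \<le> \<bar>C\<bar> * norm (J i - J j)" by (intro mult_right_mono) auto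
    finally show ?thesis using ij by (simp add: f dist_norm)
  qed
  have "lipschitz_on \<bar>C\<bar> (J ` I) f"
    using lip by (intro lipschitz_onI) auto
  then have "uniformly_continuous_on (J ` I) f"
    by (rule lipschitz_on_uniformly_continuous)
  then obtain F where F: "uniformly_continuous_on (closure (J ` I)) F"
      and Ff: "\<And>x. x \<in> J ` I \<Longrightarrow> F x = f x"
    using uniformly_continuous_on_extension_on_closure by (metis (no_types, lifting))
  have cont: "continuous_on UNIV F"
    using F dense by (simp add: uniformly_continuous_imp_continuous)
  have cont': "continuous_on A (\<lambda>x. F (p x))" if "continuous_on A p" for A and p :: "'c::topological_space \<Rightarrow> 'a"
    using continuous_on_compose2[OF cont that] by simp
  have FK: "F (J i) = K i" if "i \<in> I" for i using that by (simp add: Ff f)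
  have dense2: "closure (J ` I \<times> J ` I) = UNIV"
    using dense by (simp add: closure_Times)
  have lin: "F (x + r *\<^sub>R y) = F x + r *\<^sub>R F y" for x y r
  proof -
    have "closed {p. F (fst p + r *\<^sub>R snd p) = F (fst p) + r *\<^sub>R F (snd p)}"
      by (intro closed_Collect_eq continuous_intros cont')
    moreover have "J ` I \<times> J ` I \<subseteq> {p. F (fst p + r *\<^sub>R snd p) = F (fst p) + r *\<^sub>R F (snd p)}"
    proof clarsimp
      fix i j assume ij: "i \<in> I" "j \<in> I"
      obtain k where "k \<in> I" "J k = J i + r *\<^sub>R J j" "K k = K i + r *\<^sub>R K j"
        using comb[OF ij] by blast
      with ij show "F (J i + r *\<^sub>R J j) = F (J i) + r *\<^sub>R F (J j)" by (metis FK)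
    qed
    ultimately have "UNIV \<subseteq> {p. F (fst p + r *\<^sub>R snd p) = F (fst p) + r *\<^sub>R F (snd p)}"
      unfolding dense2[symmetric] by - (rule closure_minimal)
    then have "(x, y) \<in> {p. F (fst p + r *\<^sub>R snd p) = F (fst p) + r *\<^sub>R F (snd p)}" by blast
    then show ?thesis by simp
  qed
  have bnd: "norm (F x) \<le> norm x * \<bar>C\<bar>" for x
  proof -
    have "closed {x. norm (F x) \<le> norm x * \<bar>C\<bar>}"
      by (intro closed_Collect_le continuous_intros cont')
    moreover have "J ` I \<subseteq> {x. norm (F x) \<le> norm x * \<bar>C\<bar>}"
    proof clarsimp
      fix i assume i: "i \<in> I"
      have "C * norm (J i) \<le> norm (J i) * \<bar>C\<bar>" by (simp add: mult.commute mult_right_mono)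
      with bound[OF i] show "norm (F (J i)) \<le> norm (J i) * \<bar>C\<bar>" using FK[OF i] by simp
    qed
    ultimately have "UNIV \<subseteq> {x. norm (F x) \<le> norm x * \<bar>C\<bar>}"
      unfolding dense[symmetric] by - (rule closure_minimal)
    then show ?thesis by blast
  qed
  have F0: "F 0 = 0" using bnd[of 0] by simp
  have "bounded_linear F"
  proof (rule bounded_linear_intro)
    show "F (x + y) = F x + F y" for x y using lin[of x 1 y] by simp
    show "F (r *\<^sub>R x) = r *\<^sub>R F x" for r x using lin[of 0 r x] F0 by simp
  qed (rule bnd)
  then show thesis using that FK by blast
qed

lemma cinner_add_left: "cinner (x + y) z = cinner x z + cinner (y :: 'h::chilbert_space) z"
  by (metis cinner_commute cinner_add_right complex_cnj_add)

lemma cinner_scaleC_left: "cinner (c *\<^sub>C x) y = cnj c * cinner (x :: 'h::chilbert_space) y"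
  by (metis cinner_commute cinner_scaleC_right complex_cnj_mult)

lemma norm_sq_cinner: "complex_of_real ((norm x)\<^sup>2) = cinner x (x :: 'h::chilbert_space)"
  using cinner_ge_zero[of x] by (simp add: norm_eq_sqrt_cinner complex_nonneg_Reals_iff complex_eq_iff)

lemma norm_scaleC_hilbert: "norm (c *\<^sub>C x) = cmod c * norm (x :: 'h::chilbert_space)"
proof -
  have "complex_of_real ((norm (c *\<^sub>C x))\<^sup>2) = complex_of_real ((cmod c * norm x)\<^sup>2)"
  proof -
    have "complex_of_real ((norm (c *\<^sub>C x))\<^sup>2) = (c * cnj c) * complex_of_real ((norm x)\<^sup>2)"
      by (simp add: norm_sq_cinner cinner_scaleC_left cinner_scaleC_right del: of_real_power)
    also have "c * cnj c = complex_of_real ((cmod c)\<^sup>2)" by (rule complex_norm_square[symmetric])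
    finally show ?thesis by (simp add: power_mult_distrib)
  qed
  then have "(norm (c *\<^sub>C x))\<^sup>2 = (cmod c * norm x)\<^sup>2" by (simp only: of_real_eq_iff)
  then show ?thesis by simp
qed

lemma bounded_linear_scaleC: "bounded_linear (\<lambda>x. c *\<^sub>C (x :: 'h::chilbert_space))"
proof (rule bounded_linear_intro)
  show "c *\<^sub>C (r *\<^sub>R x) = r *\<^sub>R (c *\<^sub>C x)" for r and x :: 'h
    by (simp add: scaleR_conv_scaleC scaleC_scaleC mult.commute)
  show "norm (c *\<^sub>C x) \<le> norm x * cmod c" for x :: 'h
    by (simp add: norm_scaleC_hilbert mult.commute)
qed (rule scaleC_add_right)

text \<open>Polarization.\<close>

lemma isometry_preserves_cinner:
  fixes V :: "'h::chilbert_space \<Rightarrow> 'k::chilbert_space"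
  assumes lin: "bounded_clinear V" and iso: "\<And>x. norm (V x) = norm x"
  shows "cinner (V x) (V y) = cinner x y"
proof -
  have add: "V (x + y) = V x + V y" for x y
    using lin by (simp add: bounded_clinear_def bounded_linear_def linear_add)
  have scale: "V (c *\<^sub>C x) = c *\<^sub>C V x" for c x
    using lin by (simp add: bounded_clinear_def)
  have Re: "Re (cinner (V x) (V y)) = Re (cinner x y)" for x y
  proof -
    have exp: "(norm (a + b))\<^sup>2 = (norm a)\<^sup>2 + 2 * Re (cinner a b) + (norm b)\<^sup>2"
      for a b :: "'l::chilbert_space"
    proof -
      have "Re (cinner b a) = Re (cinner a b)" by (subst cinner_commute) simp
      moreover have "cinner (a + b) (a + b) = cinner a a + cinner a b + cinner b a + cinner b b"
        by (simp add: cinner_add_left cinner_add_right)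
      moreover have sq: "(norm v)\<^sup>2 = Re (cinner v v)" for v :: 'l
        using norm_sq_cinner[of v] by (metis Re_complex_of_real)
      ultimately show ?thesis unfolding sq by simp
    qed
    show ?thesis
      using exp[of "V x" "V y"] exp[of x y] iso[of "x + y"] iso[of x] iso[of y] by (simp add: add)
  qed
  have "Re (cinner (V x) (V (\<i> *\<^sub>C y))) = Re (cinner x (\<i> *\<^sub>C y))" by (rule Re)
  then have "Im (cinner (V x) (V y)) = Im (cinner x y)"
    by (simp add: scale cinner_scaleC_right)
  with Re[of x y] show ?thesis by (simp add: complex_eq_iff)
qed

lemma star_rep_unitary:
  assumes rep: "star_rep \<pi>" and u: "adj u * u = 1" "u * adj u = 1"
  shows "unitary_map (\<pi> u)"
  unfolding unitary_map_def
proof (intro conjI allI)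
  show "bounded_clinear (\<pi> u)" using rep by (simp add: star_rep_def)
  show "cinner (\<pi> u x) (\<pi> u y) = cinner x y" for x y
  proof -
    have "cinner (\<pi> u x) (\<pi> u y) = cinner (\<pi> (adj u) (\<pi> u x)) y"
      using rep by (simp add: star_rep_def)
    also have "\<pi> (adj u) (\<pi> u x) = x" using rep u by (metis star_rep_def)
    finally show ?thesis .
  qed
  show "surj (\<pi> u)"
    by (rule surjI[where f = "\<pi> (adj u)"]) (use rep u in \<open>metis star_rep_def\<close>)
qed

lemma star_rep_linear:
  assumes "star_rep \<pi>"
  shows "\<pi> (a + r *\<^sub>R b) x = \<pi> a x + r *\<^sub>R \<pi> b x"
  using assms by (simp add: star_rep_def scaleR_conv_scaleC)

lemma gns_rep_norm:
  assumes "gns_rep \<omega> \<pi> \<Omega>"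
  shows "complex_of_real ((norm (\<pi> a \<Omega>))\<^sup>2) = \<omega> (adj a * a)"
proof -
  have rep: "star_rep \<pi>" using assms by (simp add: gns_rep_def)
  have "cinner (\<pi> a \<Omega>) (\<pi> a \<Omega>) = cinner \<Omega> (\<pi> (adj a) (\<pi> a \<Omega>))"
    using rep adj_adj[of a] by (metis star_rep_def)
  then show ?thesis
    using assms rep by (simp add: norm_sq_cinner gns_rep_def star_rep_def del: of_real_power)
qed

text \<open>\<open>norm (\<pi> a \<Omega>)\<close> depends only on \<open>\<omega>\<close> and \<open>a\<close>, so matching the orbits of the two cyclic vectors is
  isometric.\<close>

lemma gns_intertwiner:
  fixes \<pi>1 :: "'a::cstar_algebra \<Rightarrow> 'h::chilbert_space \<Rightarrow> 'h"
    and \<pi>2 :: "'a \<Rightarrow> 'k::chilbert_space \<Rightarrow> 'k"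
  assumes g1: "gns_rep \<omega> \<pi>1 \<Omega>1" and g2: "gns_rep \<omega> \<pi>2 \<Omega>2"
  obtains W :: "'h \<Rightarrow> 'k" where "bounded_linear W" "\<And>a. W (\<pi>1 a \<Omega>1) = \<pi>2 a \<Omega>2"
proof (rule bounded_linear_extension_of_graph[of UNIV "\<lambda>a. \<pi>1 a \<Omega>1" "\<lambda>a. \<pi>2 a \<Omega>2" 1])
  have r: "star_rep \<pi>1" "star_rep \<pi>2" using g1 g2 by (auto simp: gns_rep_def)
  show "\<exists>k\<in>UNIV. \<pi>1 k \<Omega>1 = \<pi>1 i \<Omega>1 + r *\<^sub>R \<pi>1 j \<Omega>1 \<and> \<pi>2 k \<Omega>2 = \<pi>2 i \<Omega>2 + r *\<^sub>R \<pi>2 j \<Omega>2"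
    for i j r
    using star_rep_linear[OF \<open>star_rep \<pi>1\<close>] star_rep_linear[OF \<open>star_rep \<pi>2\<close>] by blast
  show "norm (\<pi>2 i \<Omega>2) \<le> 1 * norm (\<pi>1 i \<Omega>1)" for i
  proof -
    have "complex_of_real ((norm (\<pi>2 i \<Omega>2))\<^sup>2) = complex_of_real ((norm (\<pi>1 i \<Omega>1))\<^sup>2)"
      using gns_rep_norm[OF g1, of i] gns_rep_norm[OF g2, of i] by simp
    then have "(norm (\<pi>2 i \<Omega>2))\<^sup>2 = (norm (\<pi>1 i \<Omega>1))\<^sup>2" by (simp only: of_real_eq_iff)
    then show ?thesis by simp
  qed
  show "closure ((\<lambda>a. \<pi>1 a \<Omega>1) ` UNIV) = UNIV" using g1 by (simp add: gns_rep_def)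
qed (use that in auto)

lemma continuous_eq_on_dense:
  fixes f k :: "'a::topological_space \<Rightarrow> 'b::t2_space"
  assumes "continuous_on UNIV f" "continuous_on UNIV k" "closure D = UNIV" "\<And>x. x \<in> D \<Longrightarrow> f x = k x"
  shows "f x = k x"
proof -
  have "closure D \<subseteq> {x. f x = k x}"
    using assms by (intro closure_minimal closed_Collect_eq) auto
  then show ?thesis using assms(3) by auto
qed

text \<open>The intertwiners in both directions are mutually inverse, since they are so on the dense orbits;
  all other properties of \<open>W\<close> also pass from the orbit to its closure.\<close>

lemma gns_unique:
  fixes \<pi>1 :: "'a::cstar_algebra \<Rightarrow> 'h::chilbert_space \<Rightarrow> 'h"
    and \<pi>2 :: "'a \<Rightarrow> 'k::chilbert_space \<Rightarrow> 'k"
  assumes g1: "gns_rep \<omega> \<pi>1 \<Omega>1" and g2: "gns_rep \<omega> \<pi>2 \<Omega>2"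
  shows "\<exists>W :: 'h \<Rightarrow> 'k. unitary_map W \<and> W \<Omega>1 = \<Omega>2 \<and> (\<forall>a x. W (\<pi>1 a x) = \<pi>2 a (W x))"
proof -
  have r1: "star_rep \<pi>1" and r2: "star_rep \<pi>2" using g1 g2 by (auto simp: gns_rep_def)
  have d1: "closure (range (\<lambda>a. \<pi>1 a \<Omega>1)) = UNIV" and d2: "closure (range (\<lambda>a. \<pi>2 a \<Omega>2)) = UNIV"
    using g1 g2 by (auto simp: gns_rep_def)
  obtain W :: "'h \<Rightarrow> 'k" where W: "bounded_linear W" "\<And>a. W (\<pi>1 a \<Omega>1) = \<pi>2 a \<Omega>2"
    using gns_intertwiner[OF g1 g2] by blast
  obtain W' :: "'k \<Rightarrow> 'h" where W': "bounded_linear W'" "\<And>a. W' (\<pi>2 a \<Omega>2) = \<pi>1 a \<Omega>1"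
    using gns_intertwiner[OF g2 g1] by blast
  have cW: "continuous_on UNIV (\<lambda>x. W (p x))" if "bounded_linear p" for p :: "'b::real_normed_vector \<Rightarrow> 'h"
    using bounded_linear_compose[OF W(1) that] by (rule linear_continuous_on)
  have cW0: "continuous_on UNIV W" by (rule linear_continuous_on[OF W(1)])
  have bl: "bounded_linear (\<pi>1 a)" "bounded_linear (\<pi>2 a)" for a
    using r1 r2 by (auto simp: star_rep_def bounded_clinear_def)
  have surj: "W (W' y) = y" for y
    by (rule continuous_eq_on_dense[OF cW[OF W'(1)] continuous_on_id d2]) (auto simp: W W')
  have inter: "W (\<pi>1 a x) = \<pi>2 a (W x)" for a x
  proof (rule continuous_eq_on_dense[OF cW[OF bl(1)] _ d1])
    show "continuous_on UNIV (\<lambda>x. \<pi>2 a (W x))"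
      using bounded_linear_compose[OF bl(2) W(1)] by (rule linear_continuous_on)
    fix x assume "x \<in> range (\<lambda>a. \<pi>1 a \<Omega>1)"
    then obtain b where "x = \<pi>1 b \<Omega>1" by auto
    then show "W (\<pi>1 a x) = \<pi>2 a (W x)"
      using W(2)[of "a * b"] W(2)[of b] r1 r2 by (simp add: star_rep_def)
  qed
  have scale: "W (c *\<^sub>C x) = c *\<^sub>C W x" for c x
  proof (rule continuous_eq_on_dense[OF cW[OF bounded_linear_scaleC] _ d1])
    show "continuous_on UNIV (\<lambda>x. c *\<^sub>C W x)"
      using bounded_linear_compose[OF bounded_linear_scaleC W(1)] by (rule linear_continuous_on)
    fix x assume "x \<in> range (\<lambda>a. \<pi>1 a \<Omega>1)"
    then obtain b where "x = \<pi>1 b \<Omega>1" by auto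
    then show "W (c *\<^sub>C x) = c *\<^sub>C W x"
      using W(2)[of "c *\<^sub>C b"] W(2)[of b] r1 r2 by (simp add: star_rep_def)
  qed
  have iso: "norm (W x) = norm x" for x
  proof (rule continuous_eq_on_dense[OF continuous_on_norm[OF cW0] continuous_on_norm[OF continuous_on_id] d1])
    fix x assume "x \<in> range (\<lambda>a. \<pi>1 a \<Omega>1)"
    then obtain b where b: "x = \<pi>1 b \<Omega>1" by auto
    have "complex_of_real ((norm (W x))\<^sup>2) = complex_of_real ((norm x)\<^sup>2)"
      unfolding b W(2) gns_rep_norm[OF g1] gns_rep_norm[OF g2] ..
    then have "(norm (W x))\<^sup>2 = (norm x)\<^sup>2" by (simp only: of_real_eq_iff)
    then show "norm (W x) = norm x" by simp
  qed
  have cl: "bounded_clinear W" using W(1) scale by (simp add: bounded_clinear_def)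
  have "unitary_map W"
    unfolding unitary_map_def
    using cl isometry_preserves_cinner[OF cl iso] surjI[of W W', OF surj] by blast
  moreover have "W \<Omega>1 = \<Omega>2"
    using W(2)[of 1] r1 r2 by (simp add: star_rep_def)
  ultimately show ?thesis using inter by blast
qed


section \<open>The free *-algebra\<close>

definition good_letter :: "'x measure \<Rightarrow> 'x letter \<Rightarrow> bool" where
  "good_letter M l \<longleftrightarrow> (\<forall>f. l = Fn f \<longrightarrow> f \<in> Linf M)"

definition word_star :: "'x letter list \<Rightarrow> 'x letter list" where
  "word_star w = rev (map letter_star w)"

text \<open>Both evaluation in a C*-algebra and the action of a noncommutative polynomial on a vector are sums
  over the support of \<open>a\<close>, with \<open>Q c w\<close> the contribution of the monomial \<open>c w\<close>; sharing the sum lets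
  the bookkeeping for products and adjoints be done once.\<close>

definition word_sum :: "(complex \<Rightarrow> 'x letter list \<Rightarrow> 'b::ab_group_add) \<Rightarrow> 'x ncpoly \<Rightarrow> 'b" where
  "word_sum Q a = (\<Sum>w | a w \<noteq> 0. Q (a w) w)"

lemma free_alg_finite: "a \<in> free_alg M \<Longrightarrow> finite {w. a w \<noteq> 0}"
  and free_alg_good: "a \<in> free_alg M \<Longrightarrow> a w \<noteq> 0 \<Longrightarrow> l \<in> set w \<Longrightarrow> good_letter M l"
  by (auto simp: free_alg_def good_letter_def)

lemma free_algI:
  assumes "finite {w. a w \<noteq> 0}" "\<And>w l. a w \<noteq> 0 \<Longrightarrow> l \<in> set w \<Longrightarrow> good_letter M l"
  shows "a \<in> free_alg M"
  using assms by (auto simp: free_alg_def good_letter_def)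

lemma free_alg_add:
  assumes "a \<in> free_alg M" "b \<in> free_alg M"
  shows "(\<lambda>w. a w + b w) \<in> free_alg M"
proof (rule free_algI)
  have "{w. a w + b w \<noteq> 0} \<subseteq> {w. a w \<noteq> 0} \<union> {w. b w \<noteq> 0}" by auto
  then show "finite {w. a w + b w \<noteq> 0}"
    by (rule finite_subset) (use assms in \<open>auto simp: free_alg_finite\<close>)
  fix w l assume "a w + b w \<noteq> 0" "l \<in> set w"
  moreover from this have "a w \<noteq> 0 \<or> b w \<noteq> 0" by auto
  ultimately show "good_letter M l" using assms by (auto dest: free_alg_good)
qed

lemma free_alg_scale:
  assumes "a \<in> free_alg M"
  shows "(\<lambda>w. c * a w) \<in> free_alg M"
proof (rule free_algI)
  have "{w. c * a w \<noteq> 0} \<subseteq> {w. a w \<noteq> 0}" by auto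
  then show "finite {w. c * a w \<noteq> 0}"
    by (rule finite_subset) (use assms in \<open>auto simp: free_alg_finite\<close>)
qed (use assms in \<open>auto dest: free_alg_good\<close>)

lemma free_alg_word:
  assumes "\<And>l. l \<in> set w \<Longrightarrow> good_letter M l"
  shows "nc_word w \<in> free_alg M"
  using assms by (intro free_algI) (auto simp: nc_word_def split: if_splits)

lemma nc_mult_support:
  "{w. nc_mult a b w \<noteq> 0} \<subseteq> (\<lambda>(v, w). v @ w) ` ({v. a v \<noteq> 0} \<times> {w. b w \<noteq> 0})"
proof clarify
  fix w assume "nc_mult a b w \<noteq> 0"
  then obtain i where "a (take i w) * b (drop i w) \<noteq> 0"
    unfolding nc_mult_def by (meson sum.not_neutral_contains_not_neutral)
  then show "w \<in> (\<lambda>(v, w). v @ w) ` ({v. a v \<noteq> 0} \<times> {w. b w \<noteq> 0})"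
    by (intro image_eqI[where x = "(take i w, drop i w)"]) auto
qed

lemma free_alg_mult:
  assumes "a \<in> free_alg M" "b \<in> free_alg M"
  shows "nc_mult a b \<in> free_alg M"
proof (rule free_algI)
  show "finite {w. nc_mult a b w \<noteq> 0}"
    by (rule finite_subset[OF nc_mult_support]) (use assms in \<open>auto simp: free_alg_finite\<close>)
  fix w l assume "nc_mult a b w \<noteq> 0" "l \<in> set w"
  moreover from this(1) have "w \<in> (\<lambda>(v, w). v @ w) ` ({v. a v \<noteq> 0} \<times> {w. b w \<noteq> 0})"
    using nc_mult_support[of a b] by auto
  ultimately show "good_letter M l" using assms by (auto dest: free_alg_good)
qed

lemma letter_star_star [simp]: "letter_star (letter_star l) = l"
  by (cases l) simp_all

lemma word_star_star [simp]: "word_star (word_star w) = w"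
  by (simp add: word_star_def rev_map o_def)

lemma Linf_cnj: "f \<in> Linf M \<Longrightarrow> (\<lambda>x. cnj (f x)) \<in> Linf M"
  by (auto simp: Linf_def intro: measurable_compose[OF _ borel_measurable_continuous_onI] continuous_intros)

lemma good_letter_star [simp]: "good_letter M l \<Longrightarrow> good_letter M (letter_star l)"
  by (cases l) (auto simp: good_letter_def Linf_cnj)

lemma nc_star_apply: "nc_star a w = cnj (a (word_star w))"
  by (simp add: nc_star_def word_star_def)

lemma nc_star_star [simp]: "nc_star (nc_star a) = a"
  by (rule ext) (simp add: nc_star_apply)

lemma nc_star_support: "{w. nc_star a w \<noteq> 0} = word_star ` {w. a w \<noteq> 0}"
proof (intro equalityI subsetI)
  fix w assume "w \<in> {w. nc_star a w \<noteq> 0}"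
  then show "w \<in> word_star ` {w. a w \<noteq> 0}"
    by (intro image_eqI[where x = "word_star w"]) (auto simp: nc_star_apply)
qed (auto simp: nc_star_apply)

lemma free_alg_star:
  assumes "a \<in> free_alg M"
  shows "nc_star a \<in> free_alg M"
proof (rule free_algI)
  show "finite {w. nc_star a w \<noteq> 0}"
    unfolding nc_star_support using assms by (simp add: free_alg_finite)
  fix w l assume w: "nc_star a w \<noteq> 0" "l \<in> set w"
  then have "good_letter M (letter_star l)"
    using assms by (intro free_alg_good[of a M "word_star w"]) (auto simp: nc_star_apply word_star_def)
  then show "good_letter M l" using good_letter_star by fastforce
qed

context
  fixes Q :: "complex \<Rightarrow> 'x letter list \<Rightarrow> 'b::ab_group_add"
  assumes additive: "Q (c + d) w = Q c w + Q d w"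
begin

lemma additive_zero: "Q 0 w = 0"
  using additive[of 0 0 w] by simp

lemma additive_sum: "Q (\<Sum>i\<in>A. f i) w = (\<Sum>i\<in>A. Q (f i) w)"
  by (induction A rule: infinite_finite_induct) (simp_all add: additive_zero additive)

lemma word_sum_superset:
  assumes "finite A" "{w. a w \<noteq> 0} \<subseteq> A"
  shows "word_sum Q a = (\<Sum>w\<in>A. Q (a w) w)"
  unfolding word_sum_def using assms by (intro sum.mono_neutral_left) (auto simp: additive_zero)

lemma word_sum_add:
  assumes "finite {w. a w \<noteq> 0}" "finite {w. b w \<noteq> 0}"
  shows "word_sum Q (\<lambda>w. a w + b w) = word_sum Q a + word_sum Q b"
proof -
  let ?A = "{w. a w \<noteq> 0} \<union> {w. b w \<noteq> 0}"
  have "word_sum Q (\<lambda>w. a w + b w) = (\<Sum>w\<in>?A. Q (a w + b w) w)"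
    using assms by (intro word_sum_superset) auto
  also have "\<dots> = (\<Sum>w\<in>?A. Q (a w) w) + (\<Sum>w\<in>?A. Q (b w) w)"
    by (simp add: additive sum.distrib)
  also have "(\<Sum>w\<in>?A. Q (a w) w) = word_sum Q a"
    using assms by (intro word_sum_superset[symmetric]) auto
  also have "(\<Sum>w\<in>?A. Q (b w) w) = word_sum Q b"
    using assms by (intro word_sum_superset[symmetric]) auto
  finally show ?thesis .
qed

lemma word_sum_scale:
  assumes "finite {w. a w \<noteq> 0}"
  shows "word_sum Q (\<lambda>w. c * a w) = (\<Sum>w | a w \<noteq> 0. Q (c * a w) w)"
  using assms by (intro word_sum_superset) auto

lemma word_sum_word: "word_sum Q (nc_word w) = Q 1 w"
  using word_sum_superset[of "{w}" "nc_word w"] by (auto simp: nc_word_def)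

lemma word_sum_star: "word_sum Q (nc_star a) = (\<Sum>w | a w \<noteq> 0. Q (cnj (a w)) (word_star w))"
proof -
  have inj: "inj_on word_star {w. a w \<noteq> 0}" by (metis inj_onI word_star_star)
  show ?thesis
    unfolding word_sum_def nc_star_support sum.reindex[OF inj] by (simp add: nc_star_apply)
qed

text \<open>The coefficient of a word \<open>w\<close> in a product collects all ways to cut \<open>w\<close> into two words; summing
  over all \<open>w\<close> makes cut words and pairs of words the same index set.\<close>

lemma word_sum_mult:
  assumes "finite {w. a w \<noteq> 0}" "finite {w. b w \<noteq> 0}"
  shows "word_sum Q (nc_mult a b) = (\<Sum>v | a v \<noteq> 0. \<Sum>w | b w \<noteq> 0. Q (a v * b w) (v @ w))"
proof -
  let ?A = "{v. a v \<noteq> 0}" and ?B = "{w. b w \<noteq> 0}"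
  define C where "C = (\<lambda>(v, w). v @ w) ` (?A \<times> ?B)"
  have fin: "finite C" using assms by (simp add: C_def)
  define S where "S = Sigma C (\<lambda>w. {..length w})"
  define S' where "S' = {p \<in> S. a (take (snd p) (fst p)) * b (drop (snd p) (fst p)) = 0}"
  have finS: "finite S" using fin by (simp add: S_def)
  have "word_sum Q (nc_mult a b) = (\<Sum>w\<in>C. Q (nc_mult a b w) w)"
    using fin nc_mult_support[of a b] by (intro word_sum_superset) (auto simp: C_def)
  also have "\<dots> = (\<Sum>w\<in>C. \<Sum>i\<le>length w. Q (a (take i w) * b (drop i w)) w)"
    by (simp add: nc_mult_def additive_sum)
  also have "\<dots> = (\<Sum>(w, i)\<in>S. Q (a (take i w) * b (drop i w)) w)"
    using fin by (simp add: S_def sum.Sigma)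
  also have "\<dots> = (\<Sum>(v, w)\<in>?A \<times> ?B. Q (a v * b w) (v @ w))"
  proof (rule sum.reindex_bij_witness_not_neutral[where S' = S' and T' = "{}"
        and j = "\<lambda>(w, i). (take i w, drop i w)" and i = "\<lambda>(v, w). (v @ w, length v)"])
    show "finite S'" using finS by (simp add: S'_def)
    show "\<And>p. p \<in> S' \<Longrightarrow> (case p of (w, i) \<Rightarrow> Q (a (take i w) * b (drop i w)) w) = 0"
      by (auto simp: S'_def additive_zero)
    show "\<And>p. p \<in> S - S' \<Longrightarrow> (case (case p of (w, i) \<Rightarrow> (take i w, drop i w)) of (v, w) \<Rightarrow> (v @ w, length v)) = p"
      by (auto simp: S_def)
    show "\<And>p. p \<in> S - S' \<Longrightarrow> (case p of (w, i) \<Rightarrow> (take i w, drop i w)) \<in> ?A \<times> ?B - {}"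
      by (auto simp: S'_def)
    show "\<And>p. p \<in> ?A \<times> ?B - {} \<Longrightarrow> (case p of (v, w) \<Rightarrow> (v @ w, length v)) \<in> S - S'"
    proof -
      fix p assume "p \<in> ?A \<times> ?B - {}"
      then obtain v w where p: "p = (v, w)" "a v \<noteq> 0" "b w \<noteq> 0" by auto
      then have "v @ w \<in> C" by (auto simp: C_def)
      with p show "(case p of (v, w) \<Rightarrow> (v @ w, length v)) \<in> S - S'"
        by (simp add: S_def S'_def)
    qed
  qed auto
  also have "\<dots> = (\<Sum>v\<in>?A. \<Sum>w\<in>?B. Q (a v * b w) (v @ w))"
    by (simp add: sum.cartesian_product)
  finally show ?thesis .
qed

end

lemma nc_eval_word_sum:
  "nc_eval \<iota> u a = word_sum (\<lambda>c w. c *\<^sub>C prod_list (map (letter_val \<iota> u) w)) a"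
  by (simp add: nc_eval_def word_sum_def)

lemma nc_eval_add:
  assumes "a \<in> free_alg M" "b \<in> free_alg M"
  shows "nc_eval \<iota> u (\<lambda>w. a w + b w) = nc_eval \<iota> u a + nc_eval \<iota> u b"
  unfolding nc_eval_word_sum using assms
  by (intro word_sum_add) (auto simp: scaleC_add_left free_alg_finite)

lemma nc_eval_scale:
  assumes "a \<in> free_alg M"
  shows "nc_eval \<iota> u (\<lambda>w. c * a w) = c *\<^sub>C nc_eval \<iota> u a"
  unfolding nc_eval_word_sum
  by (subst word_sum_scale)
    (use assms in \<open>auto simp: scaleC_add_left free_alg_finite word_sum_def scaleC_sum_right scaleC_scaleC\<close>)

lemma nc_eval_word: "nc_eval \<iota> u (nc_word w) = prod_list (map (letter_val \<iota> u) w)"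
  unfolding nc_eval_word_sum by (subst word_sum_word) (auto simp: scaleC_add_left)

lemma nc_eval_mult:
  assumes "a \<in> free_alg M" "b \<in> free_alg M"
  shows "nc_eval \<iota> u (nc_mult a b) = nc_eval \<iota> u a * nc_eval \<iota> u b"
  unfolding nc_eval_word_sum
  by (subst word_sum_mult)
    (use assms in \<open>auto simp: scaleC_add_left free_alg_finite word_sum_def sum_product
      mult_scaleC_left mult_scaleC_right scaleC_scaleC mult.commute\<close>)

lemma letter_val_star:
  assumes "covariant_pair M T \<iota> u" "good_letter M l"
  shows "letter_val \<iota> u (letter_star l) = adj (letter_val \<iota> u l)"
proof (cases l)
  case (Fn f)
  then have "f \<in> Linf M" using assms by (simp add: good_letter_def)
  then have "\<iota> (\<lambda>x. cnj (f x)) = adj (\<iota> f)" using assms unfolding covariant_pair_def by blast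
  with Fn show ?thesis by simp
qed (simp_all add: adj_adj)

lemma nc_eval_star:
  assumes cov: "covariant_pair M T \<iota> u" and a: "a \<in> free_alg M"
  shows "nc_eval \<iota> u (nc_star a) = adj (nc_eval \<iota> u a)"
proof -
  have word: "prod_list (map (letter_val \<iota> u) (word_star w)) = adj (prod_list (map (letter_val \<iota> u) w))"
    if "\<And>l. l \<in> set w \<Longrightarrow> good_letter M l" for w
    using that by (induction w) (auto simp: word_star_def adj_mult letter_val_star[OF cov])
  show ?thesis
    unfolding nc_eval_word_sum
    by (subst word_sum_star)
      (use a in \<open>auto simp: scaleC_add_left word_sum_def adj_sum adj_scaleC word free_alg_good intro!: sum.cong\<close>)
qed


section \<open>C*-seminorms from representations\<close>

text \<open>A *-representation of the free *-algebra by bounded operators on a space \<open>V\<close> of complex functions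
  with a semi-inner product \<open>B\<close>, given on letters. The operator norm on such a space is already a
  C*-seminorm, so neither a quotient by null vectors nor a completion has to be formed.\<close>

locale letter_representation =
  fixes M :: "'x measure" and V :: "('i \<Rightarrow> complex) set"
    and B :: "('i \<Rightarrow> complex) \<Rightarrow> ('i \<Rightarrow> complex) \<Rightarrow> complex"
    and act :: "'x letter \<Rightarrow> ('i \<Rightarrow> complex) \<Rightarrow> 'i \<Rightarrow> complex"
  assumes V_zero: "(\<lambda>i. 0) \<in> V"
    and V_add: "F \<in> V \<Longrightarrow> G \<in> V \<Longrightarrow> (\<lambda>i. F i + G i) \<in> V"
    and V_scale: "F \<in> V \<Longrightarrow> (\<lambda>i. c * F i) \<in> V"
    and B_add: "F \<in> V \<Longrightarrow> G \<in> V \<Longrightarrow> H \<in> V \<Longrightarrow> B F (\<lambda>i. G i + H i) = B F G + B F H"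
    and B_scale: "F \<in> V \<Longrightarrow> G \<in> V \<Longrightarrow> B F (\<lambda>i. c * G i) = c * B F G"
    and B_herm: "F \<in> V \<Longrightarrow> G \<in> V \<Longrightarrow> B G F = cnj (B F G)"
    and B_pos: "F \<in> V \<Longrightarrow> B F F \<in> \<real>\<^sub>\<ge>\<^sub>0"
    and act_V: "good_letter M l \<Longrightarrow> F \<in> V \<Longrightarrow> act l F \<in> V"
    and act_add: "F \<in> V \<Longrightarrow> G \<in> V \<Longrightarrow> act l (\<lambda>i. F i + G i) = (\<lambda>i. act l F i + act l G i)"
    and act_scale: "F \<in> V \<Longrightarrow> act l (\<lambda>i. c * F i) = (\<lambda>i. c * act l F i)"
    and act_star: "good_letter M l \<Longrightarrow> F \<in> V \<Longrightarrow> G \<in> V \<Longrightarrow> B (act (letter_star l) F) G = B F (act l G)"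
    and act_bounded: "good_letter M l \<Longrightarrow> \<exists>C. \<forall>F\<in>V. Re (B (act l F) (act l F)) \<le> C * Re (B F F)"
begin

definition vnorm :: "('i \<Rightarrow> complex) \<Rightarrow> real" where
  "vnorm F = sqrt (Re (B F F))"

definition rep :: "'x ncpoly \<Rightarrow> ('i \<Rightarrow> complex) \<Rightarrow> 'i \<Rightarrow> complex" where
  "rep a F = (\<lambda>i. word_sum (\<lambda>c w. c * foldr act w F i) a)"

definition opnorm :: "'x ncpoly \<Rightarrow> real" where
  "opnorm a = Inf {C. 0 \<le> C \<and> (\<forall>F\<in>V. vnorm (rep a F) \<le> C * vnorm F)}"

lemma B_add_left: "F \<in> V \<Longrightarrow> G \<in> V \<Longrightarrow> H \<in> V \<Longrightarrow> B (\<lambda>i. G i + H i) F = B G F + B H F"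
  using B_herm[of F "\<lambda>i. G i + H i"] B_add[of F G H] B_herm[of F G] B_herm[of F H] by (simp add: V_add)

lemma B_scale_left: "F \<in> V \<Longrightarrow> G \<in> V \<Longrightarrow> B (\<lambda>i. c * G i) F = cnj c * B G F"
  using B_herm[of F "\<lambda>i. c * G i"] B_scale[of F G c] B_herm[of F G] by (simp add: V_scale)

lemma B_zero: "F \<in> V \<Longrightarrow> B F (\<lambda>i. 0) = 0"
  using B_scale[of F F 0] by simp

lemma vnorm_sq: "F \<in> V \<Longrightarrow> (vnorm F)\<^sup>2 = Re (B F F)"
  and vnorm_nonneg: "F \<in> V \<Longrightarrow> 0 \<le> vnorm F"
  using B_pos[of F] by (auto simp: vnorm_def complex_nonneg_Reals_iff)

lemma B_quadratic:
  assumes "F \<in> V" "G \<in> V"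
  shows "Re (B (\<lambda>i. F i + t * G i) (\<lambda>i. F i + t * G i)) =
    Re (B F F) + 2 * Re (t * B F G) + (cmod t)\<^sup>2 * Re (B G G)"
proof -
  have "B (\<lambda>i. F i + t * G i) (\<lambda>i. F i + t * G i)
      = B F F + t * B F G + cnj t * cnj (B F G) + (cnj t * t) * B G G"
    using assms B_herm[of F G]
    by (simp add: B_add B_add_left B_scale B_scale_left V_add V_scale algebra_simps)
  moreover have "cnj t * t = complex_of_real ((cmod t)\<^sup>2)"
    using complex_norm_square[of t] by (simp add: mult.commute)
  ultimately show ?thesis by simp
qed

lemma B_Cauchy_Schwarz:
  assumes FG: "F \<in> V" "G \<in> V"
  shows "cmod (B F G) \<le> vnorm F * vnorm G"
proof -
  have "(cmod (B F G))\<^sup>2 \<le> Re (B F F) * Re (B G G)"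
  proof (rule Cauchy_Schwarz_of_quadratic)
    fix t
    have "(\<lambda>i. F i + t * G i) \<in> V" using FG by (intro V_add V_scale)
    from B_pos[OF this] show "0 \<le> Re (B F F) + 2 * Re (t * B F G) + (cmod t)\<^sup>2 * Re (B G G)"
      unfolding B_quadratic[OF FG, symmetric] by (simp add: complex_nonneg_Reals_iff)
  qed
  also have "\<dots> = (vnorm F * vnorm G)\<^sup>2"
    using FG by (simp add: power_mult_distrib vnorm_sq)
  finally show ?thesis
    by (rule power2_le_imp_le) (use FG in \<open>simp add: vnorm_nonneg\<close>)
qed

lemma vnorm_triangle:
  assumes FG: "F \<in> V" "G \<in> V"
  shows "vnorm (\<lambda>i. F i + G i) \<le> vnorm F + vnorm G"
proof -
  have "(vnorm (\<lambda>i. F i + G i))\<^sup>2 = (vnorm F)\<^sup>2 + 2 * Re (B F G) + (vnorm G)\<^sup>2"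
    using B_quadratic[OF FG, of 1] FG by (simp add: vnorm_sq V_add)
  also have "\<dots> \<le> (vnorm F)\<^sup>2 + 2 * (vnorm F * vnorm G) + (vnorm G)\<^sup>2"
    using B_Cauchy_Schwarz[OF FG] complex_Re_le_cmod[of "B F G"] by simp
  also have "\<dots> = (vnorm F + vnorm G)\<^sup>2" by (simp add: power2_sum)
  finally show ?thesis
    by (rule power2_le_imp_le) (use FG in \<open>simp add: vnorm_nonneg\<close>)
qed

lemma vnorm_scale:
  assumes F: "F \<in> V"
  shows "vnorm (\<lambda>i. c * F i) = cmod c * vnorm F"
proof -
  have "B (\<lambda>i. c * F i) (\<lambda>i. c * F i) = (cnj c * c) * B F F"
    using F by (simp add: B_scale B_scale_left V_scale)
  also have "cnj c * c = complex_of_real ((cmod c)\<^sup>2)"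
    using complex_norm_square[of c] by (simp add: mult.commute)
  finally show ?thesis
    by (simp add: vnorm_def real_sqrt_mult)
qed

lemma V_sum: "(\<And>w. w \<in> A \<Longrightarrow> G w \<in> V) \<Longrightarrow> (\<lambda>i. \<Sum>w\<in>A. c w * G w i) \<in> V"
  by (induction A rule: infinite_finite_induct) (auto simp: V_zero V_add V_scale)

lemma B_sum:
  "F \<in> V \<Longrightarrow> (\<And>w. w \<in> A \<Longrightarrow> G w \<in> V) \<Longrightarrow> B F (\<lambda>i. \<Sum>w\<in>A. c w * G w i) = (\<Sum>w\<in>A. c w * B F (G w))"
  by (induction A rule: infinite_finite_induct) (auto simp: B_zero B_add V_sum V_scale B_scale)

lemma foldr_act_V: "(\<And>l. l \<in> set w \<Longrightarrow> good_letter M l) \<Longrightarrow> F \<in> V \<Longrightarrow> foldr act w F \<in> V"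
  by (induction w) (auto intro: act_V)

lemma act_zero: "act l (\<lambda>i. 0) = (\<lambda>i. 0)"
  using act_scale[OF V_zero, of l 0] by simp

lemma foldr_act_sum:
  assumes w: "\<And>l. l \<in> set w \<Longrightarrow> good_letter M l" and A: "\<And>v. v \<in> A \<Longrightarrow> G v \<in> V"
  shows "foldr act w (\<lambda>i. \<Sum>v\<in>A. c v * G v i) = (\<lambda>i. \<Sum>v\<in>A. c v * foldr act w (G v) i)"
  using w
proof (induction w)
  case (Cons l w)
  have "act l (\<lambda>i. \<Sum>v\<in>A. c v * foldr act w (G v) i) = (\<lambda>i. \<Sum>v\<in>A. c v * act l (foldr act w (G v)) i)"
    using A
    by (induction A rule: infinite_finite_induct)
      (use Cons.prems in \<open>auto simp: act_zero act_add act_scale V_sum V_scale foldr_act_V\<close>)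
  then show ?case using Cons by simp
qed simp

lemma rep_apply: "rep a F i = (\<Sum>w | a w \<noteq> 0. a w * foldr act w F i)"
  by (simp add: rep_def word_sum_def)

lemma rep_V: "a \<in> free_alg M \<Longrightarrow> F \<in> V \<Longrightarrow> rep a F \<in> V"
  unfolding rep_apply[abs_def] by (intro V_sum foldr_act_V) (auto dest: free_alg_good)

lemma rep_add:
  assumes "a \<in> free_alg M" "b \<in> free_alg M"
  shows "rep (\<lambda>w. a w + b w) F = (\<lambda>i. rep a F i + rep b F i)"
  unfolding rep_def using assms
  by (intro ext word_sum_add) (auto simp: free_alg_finite algebra_simps)

lemma rep_scale:
  assumes "a \<in> free_alg M"
  shows "rep (\<lambda>w. c * a w) F = (\<lambda>i. c * rep a F i)"
  unfolding rep_def
  by (subst word_sum_scale)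
    (use assms in \<open>auto simp: free_alg_finite algebra_simps word_sum_def sum_distrib_left\<close>)

lemma rep_word: "rep (nc_word w) F = foldr act w F"
  unfolding rep_def by (subst word_sum_word) (auto simp: algebra_simps)

lemma rep_mult:
  assumes a: "a \<in> free_alg M" and b: "b \<in> free_alg M" and F: "F \<in> V"
  shows "rep (nc_mult a b) F = rep a (rep b F)"
proof
  fix i
  have "rep (nc_mult a b) F i
      = (\<Sum>v | a v \<noteq> 0. \<Sum>w | b w \<noteq> 0. a v * b w * foldr act (v @ w) F i)"
    unfolding rep_def by (subst word_sum_mult) (use a b in \<open>auto simp: free_alg_finite algebra_simps\<close>)
  also have "\<dots> = (\<Sum>v | a v \<noteq> 0. a v * foldr act v (rep b F) i)"
  proof (rule sum.cong)
    fix v assume "v \<in> {v. a v \<noteq> 0}"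
    then have "foldr act v (rep b F) = (\<lambda>i. \<Sum>w | b w \<noteq> 0. b w * foldr act v (foldr act w F) i)"
      unfolding rep_apply[abs_def] using a b F
      by (intro foldr_act_sum foldr_act_V) (auto dest: free_alg_good)
    then show "(\<Sum>w | b w \<noteq> 0. a v * b w * foldr act (v @ w) F i) = a v * foldr act v (rep b F) i"
      by (simp add: sum_distrib_left mult.assoc)
  qed simp
  finally show "rep (nc_mult a b) F i = rep a (rep b F) i" by (simp add: rep_apply)
qed

lemma foldr_act_star:
  assumes "\<And>l. l \<in> set w \<Longrightarrow> good_letter M l" "F \<in> V" "G \<in> V"
  shows "B (foldr act (word_star w) F) G = B F (foldr act w G)"
  using assms
proof (induction w arbitrary: F)
  case (Cons l w)
  have "B (foldr act (word_star (l # w)) F) G = B (foldr act (word_star w) (act (letter_star l) F)) G"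
    by (simp add: word_star_def)
  also have "\<dots> = B (act (letter_star l) F) (foldr act w G)"
    using Cons by (intro Cons.IH) (auto intro: act_V)
  also have "\<dots> = B F (act l (foldr act w G))"
    using Cons by (intro act_star foldr_act_V) auto
  finally show ?case by simp
qed (simp add: word_star_def)

lemma rep_star:
  assumes a: "a \<in> free_alg M" and FG: "F \<in> V" "G \<in> V"
  shows "B (rep (nc_star a) F) G = B F (rep a G)"
proof -
  have star: "foldr act (word_star w) F \<in> V" if "a w \<noteq> 0" for w
    using that a FG by (intro foldr_act_V) (auto simp: word_star_def dest: free_alg_good)
  have "rep (nc_star a) F = (\<lambda>i. \<Sum>w | a w \<noteq> 0. cnj (a w) * foldr act (word_star w) F i)"
    unfolding rep_def by (subst word_sum_star) (auto simp: algebra_simps)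
  moreover have "B G (\<lambda>i. \<Sum>w | a w \<noteq> 0. cnj (a w) * foldr act (word_star w) F i)
      = (\<Sum>w | a w \<noteq> 0. cnj (a w) * B G (foldr act (word_star w) F))"
    by (rule B_sum) (use FG star in auto)
  ultimately have "B G (rep (nc_star a) F) = (\<Sum>w | a w \<noteq> 0. cnj (a w) * B G (foldr act (word_star w) F))"
    by simp
  also have "\<dots> = (\<Sum>w | a w \<noteq> 0. cnj (a w * B F (foldr act w G)))"
  proof (intro sum.cong refl)
    fix w assume "w \<in> {w. a w \<noteq> 0}"
    then have w: "a w \<noteq> 0" by simp
    have "B (foldr act (word_star w) F) G = B F (foldr act w G)"
      by (rule foldr_act_star) (use free_alg_good[OF a w] FG in auto)
    then show "cnj (a w) * B G (foldr act (word_star w) F) = cnj (a w * B F (foldr act w G))"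
      using B_herm[OF star[OF w] FG(2)] by simp
  qed
  also have "\<dots> = cnj (B F (rep a G))"
    unfolding rep_apply[abs_def] using a FG
    by (subst B_sum) (auto intro: foldr_act_V dest: free_alg_good)
  finally show ?thesis
    using B_herm[of G "rep (nc_star a) F"] a FG by (simp add: rep_V free_alg_star)
qed

lemma vnorm_rep_sq:
  assumes "a \<in> free_alg M" "F \<in> V"
  shows "(vnorm (rep a F))\<^sup>2 = Re (B F (rep (nc_mult (nc_star a) a) F))"
  using assms rep_star[of "nc_star a" F "rep a F"]
  by (simp add: vnorm_sq rep_V rep_mult free_alg_star)

lemma foldr_act_bounded:
  assumes "\<And>l. l \<in> set w \<Longrightarrow> good_letter M l"
  shows "\<exists>C\<ge>0. \<forall>F\<in>V. vnorm (foldr act w F) \<le> C * vnorm F"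
  using assms
proof (induction w)
  case Nil
  then show ?case by (intro exI[of _ 1]) auto
next
  case (Cons l w)
  obtain C where C: "C \<ge> 0" "\<And>F. F \<in> V \<Longrightarrow> vnorm (foldr act w F) \<le> C * vnorm F"
    using Cons by auto
  obtain D where D: "\<And>F. F \<in> V \<Longrightarrow> Re (B (act l F) (act l F)) \<le> D * Re (B F F)"
    using act_bounded[of l] Cons.prems by auto
  have "vnorm (foldr act (l # w) F) \<le> sqrt \<bar>D\<bar> * C * vnorm F" if F: "F \<in> V" for F
  proof -
    have W: "foldr act w F \<in> V" using F Cons.prems by (intro foldr_act_V) auto
    let ?W = "foldr act w F"
    have "Re (B (act l ?W) (act l ?W)) \<le> \<bar>D\<bar> * Re (B ?W ?W)"
      using D[OF W] B_pos[OF W] mult_right_mono[of D "\<bar>D\<bar>" "Re (B ?W ?W)", OF abs_ge_self]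
      by (simp add: complex_nonneg_Reals_iff)
    then have "vnorm (foldr act (l # w) F) \<le> sqrt \<bar>D\<bar> * vnorm ?W"
      by (simp add: vnorm_def flip: real_sqrt_mult)
    also have "\<dots> \<le> sqrt \<bar>D\<bar> * (C * vnorm F)"
      using C(2)[OF F] by (intro mult_left_mono) auto
    finally show ?thesis by (simp add: mult.assoc)
  qed
  with C(1) show ?case by (intro exI[of _ "sqrt \<bar>D\<bar> * C"]) auto
qed

lemma rep_bounded:
  assumes a: "a \<in> free_alg M"
  shows "\<exists>C\<ge>0. \<forall>F\<in>V. vnorm (rep a F) \<le> C * vnorm F"
proof -
  have "\<exists>C. \<forall>w. a w \<noteq> 0 \<longrightarrow> 0 \<le> C w \<and> (\<forall>F\<in>V. vnorm (foldr act w F) \<le> C w * vnorm F)"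
    using foldr_act_bounded free_alg_good[OF a] by (intro choice) blast
  then obtain C where C: "\<And>w. a w \<noteq> 0 \<Longrightarrow> 0 \<le> C w"
      "\<And>w F. a w \<noteq> 0 \<Longrightarrow> F \<in> V \<Longrightarrow> vnorm (foldr act w F) \<le> C w * vnorm F"
    by blast
  have "vnorm (rep a F) \<le> (\<Sum>w | a w \<noteq> 0. cmod (a w) * C w) * vnorm F" if F: "F \<in> V" for F
  proof -
    have V: "foldr act w F \<in> V" if "a w \<noteq> 0" for w
      using that F a by (intro foldr_act_V) (auto dest: free_alg_good)
    have "vnorm (\<lambda>i. \<Sum>w\<in>A. a w * foldr act w F i) \<le> (\<Sum>w\<in>A. cmod (a w) * C w) * vnorm F"
      if "A \<subseteq> {w. a w \<noteq> 0}" for A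
      using that
    proof (induction A rule: infinite_finite_induct)
      case (insert w A)
      have "vnorm (\<lambda>i. a w * foldr act w F i + (\<Sum>w\<in>A. a w * foldr act w F i))
          \<le> vnorm (\<lambda>i. a w * foldr act w F i) + vnorm (\<lambda>i. \<Sum>w\<in>A. a w * foldr act w F i)"
        using insert V by (intro vnorm_triangle V_scale V_sum) auto
      also have "\<dots> \<le> cmod (a w) * (C w * vnorm F) + (\<Sum>w\<in>A. cmod (a w) * C w) * vnorm F"
        using insert V C(2)[OF _ F] by (intro add_mono) (auto simp: vnorm_scale intro: mult_left_mono)
      finally show ?case using insert by (simp add: algebra_simps)
    qed (use B_zero[OF V_zero] in \<open>auto simp: vnorm_def\<close>)
    from this[of "{w. a w \<noteq> 0}"] show ?thesis unfolding rep_apply[abs_def] by simp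
  qed
  moreover have "0 \<le> (\<Sum>w | a w \<noteq> 0. cmod (a w) * C w)"
    using C(1) by (intro sum_nonneg) auto
  ultimately show ?thesis by blast
qed

lemma opnorm_least:
  assumes "0 \<le> C" "\<And>F. F \<in> V \<Longrightarrow> vnorm (rep a F) \<le> C * vnorm F"
  shows "opnorm a \<le> C"
  unfolding opnorm_def using assms by (intro cInf_lower bdd_belowI[of _ 0]) auto

lemma opnorm_nonneg: "a \<in> free_alg M \<Longrightarrow> 0 \<le> opnorm a"
  unfolding opnorm_def using rep_bounded by (intro cInf_greatest) auto

lemma vnorm_rep_le:
  assumes a: "a \<in> free_alg M" and F: "F \<in> V"
  shows "vnorm (rep a F) \<le> opnorm a * vnorm F"
proof -
  let ?S = "{C. 0 \<le> C \<and> (\<forall>F\<in>V. vnorm (rep a F) \<le> C * vnorm F)}"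
  obtain C where C: "C \<in> ?S" using rep_bounded[OF a] by auto
  show ?thesis
  proof (cases "vnorm F = 0")
    case True
    have "vnorm (rep a F) \<le> C * vnorm F" using C F by blast
    with True show ?thesis by simp
  next
    case False
    then have pos: "vnorm F > 0" using vnorm_nonneg[OF F] by simp
    have "vnorm (rep a F) / vnorm F \<le> Inf ?S"
    proof (rule cInf_greatest)
      show "?S \<noteq> {}" using C by blast
      show "vnorm (rep a F) / vnorm F \<le> D" if "D \<in> ?S" for D
        using that F pos by (auto simp: field_simps)
    qed
    then show ?thesis using pos by (simp add: opnorm_def field_simps)
  qed
qed

lemma opnorm_eq_zero:
  assumes "\<And>F. F \<in> V \<Longrightarrow> vnorm (rep a F) = 0" "a \<in> free_alg M"
  shows "opnorm a = 0"
  using opnorm_least[of 0 a] opnorm_nonneg[of a] assms by auto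

lemma opnorm_triangle:
  assumes ab: "a \<in> free_alg M" "b \<in> free_alg M"
  shows "opnorm (\<lambda>w. a w + b w) \<le> opnorm a + opnorm b"
proof (rule opnorm_least)
  fix F assume F: "F \<in> V"
  have "vnorm (rep (\<lambda>w. a w + b w) F) \<le> vnorm (rep a F) + vnorm (rep b F)"
    unfolding rep_add[OF ab] using ab F by (intro vnorm_triangle rep_V)
  also have "\<dots> \<le> opnorm a * vnorm F + opnorm b * vnorm F"
    using ab F by (intro add_mono vnorm_rep_le)
  finally show "vnorm (rep (\<lambda>w. a w + b w) F) \<le> (opnorm a + opnorm b) * vnorm F"
    by (simp add: algebra_simps)
qed (use ab in \<open>simp add: opnorm_nonneg\<close>)

lemma opnorm_scale_le:
  assumes a: "a \<in> free_alg M"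
  shows "opnorm (\<lambda>w. c * a w) \<le> cmod c * opnorm a"
proof (rule opnorm_least)
  fix F assume F: "F \<in> V"
  have "vnorm (rep (\<lambda>w. c * a w) F) = cmod c * vnorm (rep a F)"
    unfolding rep_scale[OF a] using a F by (simp add: vnorm_scale rep_V)
  also have "\<dots> \<le> cmod c * (opnorm a * vnorm F)"
    using a F by (intro mult_left_mono vnorm_rep_le) auto
  finally show "vnorm (rep (\<lambda>w. c * a w) F) \<le> cmod c * opnorm a * vnorm F"
    by (simp add: mult.assoc)
qed (use a in \<open>simp add: opnorm_nonneg\<close>)

lemma opnorm_scale:
  assumes a: "a \<in> free_alg M"
  shows "opnorm (\<lambda>w. c * a w) = cmod c * opnorm a"
proof (cases "c = 0")
  case True
  then show ?thesis
    using opnorm_scale_le[OF a, of 0] opnorm_nonneg[OF free_alg_scale[OF a, of 0]] by simp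
next
  case False
  have "opnorm a \<le> cmod (inverse c) * opnorm (\<lambda>w. c * a w)"
    using opnorm_scale_le[OF free_alg_scale[OF a, of c], of "inverse c"] False
    by (simp add: mult.assoc[symmetric])
  then have "cmod c * opnorm a \<le> opnorm (\<lambda>w. c * a w)"
    using False by (simp add: norm_inverse norm_divide field_simps)
  with opnorm_scale_le[OF a, of c] show ?thesis by simp
qed

lemma opnorm_mult:
  assumes ab: "a \<in> free_alg M" "b \<in> free_alg M"
  shows "opnorm (nc_mult a b) \<le> opnorm a * opnorm b"
proof (rule opnorm_least)
  fix F assume F: "F \<in> V"
  have "vnorm (rep (nc_mult a b) F) \<le> opnorm a * vnorm (rep b F)"
    unfolding rep_mult[OF ab F] using ab F by (intro vnorm_rep_le rep_V)
  also have "\<dots> \<le> opnorm a * (opnorm b * vnorm F)"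
    using ab F by (intro mult_left_mono vnorm_rep_le opnorm_nonneg)
  finally show "vnorm (rep (nc_mult a b) F) \<le> opnorm a * opnorm b * vnorm F"
    by (simp add: mult.assoc)
qed (use ab in \<open>simp add: opnorm_nonneg\<close>)

text \<open>The nontrivial half of the C*-identity: \<open>\<parallel>a F\<parallel>\<^sup>2 = \<langle>F, a\<^sup>* a F\<rangle> \<le> \<parallel>a\<^sup>* a\<parallel> \<parallel>F\<parallel>\<^sup>2\<close>.\<close>

lemma opnorm_sq_le:
  assumes a: "a \<in> free_alg M"
  shows "(opnorm a)\<^sup>2 \<le> opnorm (nc_mult (nc_star a) a)"
proof -
  let ?s = "nc_mult (nc_star a) a"
  have s: "?s \<in> free_alg M" using a by (intro free_alg_mult free_alg_star)
  have "opnorm a \<le> sqrt (opnorm ?s)"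
  proof (rule opnorm_least)
    fix F assume F: "F \<in> V"
    have "(vnorm (rep a F))\<^sup>2 \<le> cmod (B F (rep ?s F))"
      unfolding vnorm_rep_sq[OF a F] by (rule complex_Re_le_cmod)
    also have "\<dots> \<le> vnorm F * vnorm (rep ?s F)"
      using F s by (intro B_Cauchy_Schwarz rep_V)
    also have "\<dots> \<le> vnorm F * (opnorm ?s * vnorm F)"
      using F s by (intro mult_left_mono vnorm_rep_le vnorm_nonneg)
    also have "\<dots> = (sqrt (opnorm ?s) * vnorm F)\<^sup>2"
      using opnorm_nonneg[OF s] by (simp add: power_mult_distrib power2_eq_square[of "vnorm F"])
    finally show "vnorm (rep a F) \<le> sqrt (opnorm ?s) * vnorm F"
      by (rule power2_le_imp_le) (use F opnorm_nonneg[OF s] vnorm_nonneg in auto)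
  qed (use opnorm_nonneg[OF s] in simp)
  then have "(opnorm a)\<^sup>2 \<le> (sqrt (opnorm ?s))\<^sup>2"
    by (intro power_mono opnorm_nonneg a)
  then show ?thesis using opnorm_nonneg[OF s] by simp
qed

lemma opnorm_star_le:
  assumes a: "a \<in> free_alg M"
  shows "opnorm a \<le> opnorm (nc_star a)"
proof (cases "opnorm a = 0")
  case False
  have "opnorm a * opnorm a \<le> opnorm (nc_star a) * opnorm a"
    using opnorm_sq_le[OF a] opnorm_mult[OF free_alg_star[OF a] a] by (simp add: power2_eq_square)
  then show ?thesis using False opnorm_nonneg[OF a] by simp
qed (use a in \<open>simp add: opnorm_nonneg free_alg_star\<close>)

lemma cstar_seminorm_opnorm: "cstar_seminorm M opnorm"
  unfolding cstar_seminorm_def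
proof (intro conjI ballI allI)
  fix a assume a: "a \<in> free_alg M"
  have "opnorm (nc_mult (nc_star a) a) \<le> opnorm (nc_star a) * opnorm a"
    by (intro opnorm_mult free_alg_star a)
  also have "\<dots> \<le> opnorm a * opnorm a"
    using opnorm_star_le[OF free_alg_star[OF a]] opnorm_nonneg[OF a] by (intro mult_right_mono) auto
  finally show "opnorm (nc_mult (nc_star a) a) = (opnorm a)\<^sup>2"
    using opnorm_sq_le[OF a] by (simp add: power2_eq_square)
qed (simp_all add: opnorm_triangle opnorm_scale opnorm_mult)

end


section \<open>The branched system\<close>

lemma Linf_measurable: "f \<in> Linf M \<Longrightarrow> f \<in> borel_measurable M"
  by (simp add: Linf_def)

lemma Linf_bounded:
  assumes "f \<in> Linf M"
  obtains C where "0 \<le> C" "AE x in M. cmod (f x) \<le> C"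
proof -
  obtain C where C: "AE x in M. cmod (f x) \<le> C" using assms by (auto simp: Linf_def)
  have "AE x in M. cmod (f x) \<le> \<bar>C\<bar>" using C by eventually_elim simp
  then show thesis using that[of "\<bar>C\<bar>"] by simp
qed

lemma LinfI: "f \<in> borel_measurable M \<Longrightarrow> (AE x in M. cmod (f x) \<le> C) \<Longrightarrow> f \<in> Linf M"
  by (auto simp: Linf_def)

lemma Linf_const: "(\<lambda>x. c) \<in> Linf M"
  by (rule LinfI[of _ _ "cmod c"]) auto

lemma Linf_add:
  assumes "f \<in> Linf M" "k \<in> Linf M"
  shows "(\<lambda>x. f x + k x) \<in> Linf M"
proof -
  obtain C D where "AE x in M. cmod (f x) \<le> C" "AE x in M. cmod (k x) \<le> D"
    using assms by (auto simp: Linf_def)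
  then have "AE x in M. cmod (f x + k x) \<le> C + D"
    by eventually_elim (auto intro: norm_triangle_le)
  then show ?thesis by (rule LinfI[rotated]) (intro borel_measurable_add Linf_measurable assms)
qed

lemma Linf_mult:
  assumes "f \<in> Linf M" "k \<in> Linf M"
  shows "(\<lambda>x. f x * k x) \<in> Linf M"
proof -
  obtain C D where "0 \<le> C" "AE x in M. cmod (f x) \<le> C" "AE x in M. cmod (k x) \<le> D"
    using assms by (metis Linf_bounded)
  then have "AE x in M. cmod (f x * k x) \<le> C * D"
    by (auto elim!: eventually_elim2 simp: norm_mult intro!: mult_mono)
  then show ?thesis by (rule LinfI[rotated]) (intro borel_measurable_times Linf_measurable assms)
qed

lemma Linf_indicator: "E \<in> sets M \<Longrightarrow> (\<lambda>x. indicator E x) \<in> Linf M"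
  by (rule LinfI[of _ _ 1]) (auto simp: indicator_def)

lemma integrable_Linf_mult:
  assumes f: "f \<in> Linf M" and k: "integrable M k"
  shows "integrable M (\<lambda>x. f x * k x)"
proof -
  obtain C where C: "0 \<le> C" "AE x in M. cmod (f x) \<le> C" using Linf_bounded[OF f] .
  show ?thesis
  proof (rule Bochner_Integration.integrable_bound)
    show "integrable M (\<lambda>x. complex_of_real C * k x)" using k by simp
    show "(\<lambda>x. f x * k x) \<in> borel_measurable M" 
      by (intro borel_measurable_times Linf_measurable f borel_measurable_integrable k)
    show "AE x in M. norm (f x * k x) \<le> norm (complex_of_real C * k x)"
      using C(2) by eventually_elim (use C(1) in \<open>auto simp: norm_mult intro: mult_right_mono\<close>)
  qed
qed

text \<open>Needed because \<open>transfer_op\<close> agrees with a measurable function only almost everywhere.\<close>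

lemma borel_measurable_completion_AE:
  assumes f: "f \<in> borel_measurable (completion M)" and ae: "AE x in completion M. f x = k x"
  shows "k \<in> borel_measurable (completion M)"
proof (rule borel_measurableI)
  fix S :: "'b set" assume "open S"
  then have "f -` S \<inter> space M \<in> sets (completion M)"
    using measurable_sets[OF f, of S] by simp
  moreover have "AE x in completion M. x \<in> f -` S \<inter> space M \<longleftrightarrow> x \<in> k -` S \<inter> space M"
    using ae by eventually_elim auto
  ultimately show "k -` S \<inter> space (completion M) \<in> sets (completion M)"
    by (intro completion.in_sets_AE[of "f -` S \<inter> space M" "k -` S \<inter> space (completion M)" M]) auto
qed

text \<open>Bounded functions separate integrable ones: test against \<open>cnj k / \<bar>k\<bar>\<close>.\<close>

lemma AE_zero_of_orthogonal_Linf: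
  fixes k :: "'x \<Rightarrow> complex"
  assumes k: "integrable M k" and orth: "\<And>f. f \<in> Linf M \<Longrightarrow> (LINT x|M. f x * k x) = 0"
  shows "AE x in M. k x = 0"
proof -
  define f where "f x = cnj (k x) / complex_of_real (cmod (k x))" for x
  have "(\<lambda>x. cnj (k x)) \<in> borel_measurable M"
    using k by (auto intro: measurable_compose[OF _ borel_measurable_continuous_onI] continuous_intros)
  then have "f \<in> Linf M"
    using k by (intro LinfI[of _ _ 1]) (auto simp: f_def[abs_def] norm_divide)
  moreover have "f x * k x = complex_of_real (cmod (k x))" for x
    using complex_norm_square[of "k x"]
    by (cases "k x = 0") (auto simp: f_def power2_eq_square field_simps)
  ultimately have "(LINT x|M. complex_of_real (cmod (k x))) = 0"
    using orth[of f] by simp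
  then have "(LINT x|M. cmod (k x)) = 0" by simp
  then have "AE x in M. cmod (k x) = 0"
    using k by (subst (asm) integral_nonneg_eq_0_iff_AE) auto
  then show ?thesis by eventually_elim simp
qed

text \<open>The integral over the set where a real function is positive vanishes only if that set is null; this
  applies to \<open>- Re k\<close> and \<open>\<plusminus> Im k\<close>.\<close>

lemma AE_nonneg_of_integrals:
  fixes k :: "'x \<Rightarrow> complex"
  assumes k: "integrable M k"
    and nonneg: "\<And>E. E \<in> sets M \<Longrightarrow> (LINT x|M. indicator E x * k x) \<in> \<real>\<^sub>\<ge>\<^sub>0"
  shows "AE x in M. k x \<in> \<real>\<^sub>\<ge>\<^sub>0"
proof -
  have [measurable]: "k \<in> borel_measurable M" using k by simp
  have int: "integrable M (\<lambda>x. indicator E x * k x)" if "E \<in> sets M" for E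
    by (rule integrable_Linf_mult[OF Linf_indicator[OF that] k])
  have ReIm: "Re (indicator E x * k x) = indicator E x * Re (k x)"
    "Im (indicator E x * k x) = indicator E x * Im (k x)" for E x
    by (auto simp: indicator_def)
  have R: "0 \<le> (LINT x|M. indicator E x * Re (k x))" if "E \<in> sets M" for E
    using nonneg[OF that] integral_Re[OF int[OF that]] unfolding ReIm
    by (simp add: complex_nonneg_Reals_iff)
  have I: "(LINT x|M. indicator E x * Im (k x)) = 0" if "E \<in> sets M" for E
    using nonneg[OF that] integral_Im[OF int[OF that]] unfolding ReIm
    by (simp add: complex_nonneg_Reals_iff)
  have intR: "integrable M (\<lambda>x. indicator E x * Re (k x))" "integrable M (\<lambda>x. indicator E x * Im (k x))"
    if "E \<in> sets M" for E
    using integrable_Re[OF int[OF that]] integrable_Im[OF int[OF that]] unfolding ReIm by auto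
  have pos: "AE x in M. q x \<le> 0"
    if q: "q \<in> borel_measurable M" and int: "integrable M (\<lambda>x. indicator {x\<in>space M. 0 < q x} x * q x)"
      and le: "(LINT x|M. indicator {x\<in>space M. 0 < q x} x * q x) \<le> 0" for q :: "'x \<Rightarrow> real"
  proof -
    have nn: "AE x in M. 0 \<le> indicator {x\<in>space M. 0 < q x} x * q x" by (auto simp: indicator_def)
    then have "0 \<le> (LINT x|M. indicator {x\<in>space M. 0 < q x} x * q x)"
      by (rule integral_nonneg_AE)
    with le have "(LINT x|M. indicator {x\<in>space M. 0 < q x} x * q x) = 0" by simp
    then have "AE x in M. indicator {x\<in>space M. 0 < q x} x * q x = 0"
      using integral_nonneg_eq_0_iff_AE[OF int nn] by simp
    then show ?thesis
      by (rule AE_mp) (auto simp: indicator_def not_less intro!: AE_I2)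
  qed
  have "AE x in M. - Re (k x) \<le> 0"
    using R[of "{x\<in>space M. 0 < - Re (k x)}"] intR(1)[of "{x\<in>space M. 0 < - Re (k x)}"]
    by (intro pos) auto
  moreover have "AE x in M. - Im (k x) \<le> 0"
    using I[of "{x\<in>space M. 0 < - Im (k x)}"] intR(2)[of "{x\<in>space M. 0 < - Im (k x)}"]
    by (intro pos) auto
  moreover have "AE x in M. Im (k x) \<le> 0"
    using I[of "{x\<in>space M. 0 < Im (k x)}"] intR(2)[of "{x\<in>space M. 0 < Im (k x)}"]
    by (intro pos) auto
  ultimately show ?thesis
    by eventually_elim (auto simp: complex_nonneg_Reals_iff)
qed

locale branched =
  fixes M :: "'x measure" and T :: "'x \<Rightarrow> 'x" and N :: nat and \<sigma> :: "nat \<Rightarrow> 'x \<Rightarrow> 'x" and g :: "'x \<Rightarrow> real"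
  assumes N2: "N \<ge> 2"
    and sys: "branched_system M T N \<sigma>"
    and g_meas [measurable]: "g \<in> borel_measurable M"
    and g_bounds: "x \<in> space M \<Longrightarrow> 0 \<le> g x \<and> g x \<le> 1"
begin

sublocale prob_space M
  using sys by (simp add: branched_system_def)

lemma T_meas [measurable]: "T \<in> measurable M M"
  and fibre_card: "AE x in M. card {y \<in> space M. T y = x} = N"
  and T_preserves: "E \<in> sets M \<Longrightarrow> measure M (T -` E \<inter> space M) = measure M E"
  and \<sigma>_meas: "i \<in> {1..N} \<Longrightarrow> \<sigma> i \<in> measurable M M"
  and T_\<sigma>: "i \<in> {1..N} \<Longrightarrow> AE x in M. T (\<sigma> i x) = x"
  and \<sigma>_disjoint: "i \<in> {1..N} \<Longrightarrow> j \<in> {1..N} \<Longrightarrow> i \<noteq> j \<Longrightarrow>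
        \<sigma> i ` space M \<inter> \<sigma> j ` space M \<in> null_sets (completion M)"
  and \<sigma>_measure: "E \<in> sets M \<Longrightarrow> measure M E = (\<Sum>i=1..N. measure M (\<sigma> i -` E \<inter> space M)) / real N"
  using sys unfolding branched_system_def by blast+

lemma T_pow_meas [measurable]: "T ^^ n \<in> measurable M M"
  by (induction n) (auto intro: measurable_comp)

lemma distr_T_pow: "distr M M (T ^^ n) = M"
proof (induction n)
  case 0
  then show ?case by (simp add: id_def distr_id)
next
  case (Suc n)
  have T: "distr M M T = M"
    by (rule measure_eqI) (auto simp: emeasure_distr emeasure_eq_measure T_preserves)
  have "distr M M (T \<circ> T ^^ n) = distr (distr M M (T ^^ n)) M T"
    by (rule distr_distr[symmetric]) auto
  then show ?case by (simp only: funpow.simps Suc T)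
qed

lemma AE_T_pow:
  assumes "AE x in M. P x"
  shows "AE x in M. P ((T ^^ n) x)"
  by (rule AE_distrD[of "T ^^ n" M M P, unfolded distr_T_pow]) (use assms in auto)

lemma Linf_T_pow:
  assumes f: "f \<in> Linf M"
  shows "(\<lambda>x. f ((T ^^ n) x)) \<in> Linf M"
proof -
  obtain C where "AE x in M. cmod (f x) \<le> C" using f by (auto simp: Linf_def)
  then show ?thesis
    using Linf_measurable[OF f] by (intro LinfI[OF _ AE_T_pow]) (auto intro: measurable_compose)
qed

lemma Linf_T: "f \<in> Linf M \<Longrightarrow> (\<lambda>x. f (T x)) \<in> Linf M"
  using Linf_T_pow[of f 1] by simp

lemma \<sigma>_null:
  assumes i: "i \<in> {1..N}" and E: "E \<in> null_sets M"
  shows "\<sigma> i -` E \<inter> space M \<in> null_sets M"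
proof -
  have sets: "E \<in> sets M" using E by auto
  have "(\<Sum>i=1..N. measure M (\<sigma> i -` E \<inter> space M)) = 0"
    using \<sigma>_measure[OF sets] E N2 by (simp add: null_sets_def measure_def)
  then have "measure M (\<sigma> i -` E \<inter> space M) = 0"
    using i by (subst (asm) sum_nonneg_eq_0_iff) auto
  then show ?thesis
    using measurable_sets[OF \<sigma>_meas[OF i] sets] by (simp add: null_sets_def emeasure_eq_measure)
qed

lemma AE_\<sigma>:
  assumes i: "i \<in> {1..N}" and P: "AE x in M. P x"
  shows "AE x in M. P (\<sigma> i x)"
proof -
  obtain E where E: "E \<in> null_sets M" "{x\<in>space M. \<not> P x} \<subseteq> E"
    using P by (auto simp: eventually_ae_filter)
  show ?thesis
    using \<sigma>_null[OF i E(1)]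
    by (rule AE_I') (use E(2) measurable_space[OF \<sigma>_meas[OF i]] in auto)
qed

text \<open>The branches \<open>\<sigma> i\<close> pick distinct points of almost every fibre, because their ranges overlap in
  a null set; as the fibre has \<open>N\<close> points, the branches exhaust it.\<close>

lemma fibre_eq_branches:
  "AE x in M. inj_on (\<lambda>i. \<sigma> i x) {1..N} \<and> {y \<in> space M. T y = x} = (\<lambda>i. \<sigma> i x) ` {1..N}"
proof -
  have dist: "AE x in M. \<sigma> i x \<noteq> \<sigma> j x" if ij: "i \<in> {1..N}" "j \<in> {1..N}" "i \<noteq> j" for i j
  proof -
    obtain Z where Z: "Z \<in> null_sets M" "\<sigma> i ` space M \<inter> \<sigma> j ` space M \<subseteq> Z"
      using \<sigma>_disjoint[OF ij] by (auto simp: null_sets_completion_iff2)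
    have "AE x in M. \<sigma> i x \<notin> Z"
      using AE_\<sigma>[OF ij(1) AE_not_in[OF Z(1)]] .
    then show ?thesis
      using AE_space by eventually_elim (use Z(2) in force)
  qed
  have "AE x in M. \<forall>i\<in>{1..N}. \<forall>j\<in>{1..N}. i \<noteq> j \<longrightarrow> \<sigma> i x \<noteq> \<sigma> j x"
    using dist by (intro AE_finite_allI) (auto intro!: AE_finite_allI)
  moreover have "AE x in M. \<forall>i\<in>{1..N}. T (\<sigma> i x) = x"
    using T_\<sigma> by (intro AE_finite_allI) auto
  ultimately show ?thesis
    using fibre_card AE_space
  proof eventually_elim
    case (elim x)
    have inj: "inj_on (\<lambda>i. \<sigma> i x) {1..N}" using elim(1) by (auto simp: inj_on_def)
    have "(\<lambda>i. \<sigma> i x) ` {1..N} \<subseteq> {y \<in> space M. T y = x}"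
      using elim(2,4) measurable_space[OF \<sigma>_meas] by auto
    moreover have "finite {y \<in> space M. T y = x}"
      using elim(3) N2 by (intro card_ge_0_finite) auto
    ultimately have "(\<lambda>i. \<sigma> i x) ` {1..N} = {y \<in> space M. T y = x}"
      using elim(3) by (intro card_subset_eq) (auto simp only: card_image[OF inj] card_atLeastAtMost diff_Suc_1 Suc_eq_plus1[symmetric])
    with inj show ?case by simp
  qed
qed

lemma transfer_op_branches:
  "AE x in M. transfer_op M T g k x = (\<Sum>i=1..N. complex_of_real (g (\<sigma> i x)) * k (\<sigma> i x))"
  using fibre_eq_branches by eventually_elim (simp add: transfer_op_def sum.reindex)

text \<open>The invariance \<open>\<mu> = (1/N) \<Sum>\<^sub>i \<mu> \<circ> \<sigma>\<^sub>i\<^sup>-\<^sup>1\<close>, lifted from sets to functions. The nonnegative version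
  comes first because it provides the integrability of \<open>f \<circ> \<sigma>\<^sub>i\<close>.\<close>

lemma nn_integral_branches:
  assumes "f \<in> borel_measurable M"
  shows "of_nat N * (\<integral>\<^sup>+x. f x \<partial>M) = (\<Sum>i=1..N. \<integral>\<^sup>+x. f (\<sigma> i x) \<partial>M)"
  using assms
proof (induction f rule: borel_measurable_induct)
  case (cong f k)
  then have "(\<integral>\<^sup>+x. k x \<partial>M) = (\<integral>\<^sup>+x. f x \<partial>M)" by (intro nn_integral_cong) auto
  moreover have "(\<integral>\<^sup>+x. k (\<sigma> i x) \<partial>M) = (\<integral>\<^sup>+x. f (\<sigma> i x) \<partial>M)" if "i \<in> {1..N}" for i
    using cong measurable_space[OF \<sigma>_meas[OF that]] by (intro nn_integral_cong) auto
  ultimately show ?case using cong by simp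
next
  case (set A)
  have "(\<integral>\<^sup>+x. indicator A (\<sigma> i x) \<partial>M) = ennreal (measure M (\<sigma> i -` A \<inter> space M))" if "i \<in> {1..N}" for i
  proof -
    have "(\<integral>\<^sup>+x. indicator A (\<sigma> i x) \<partial>M) = (\<integral>\<^sup>+x. indicator (\<sigma> i -` A \<inter> space M) x \<partial>M)"
      by (intro nn_integral_cong) (auto simp: indicator_def)
    then show ?thesis
      using measurable_sets[OF \<sigma>_meas[OF that] set] by (simp add: emeasure_eq_measure)
  qed
  then have "(\<Sum>i=1..N. \<integral>\<^sup>+x. indicator A (\<sigma> i x) \<partial>M) = ennreal (\<Sum>i=1..N. measure M (\<sigma> i -` A \<inter> space M))"
    by (simp add: sum_ennreal)
  also have "(\<Sum>i=1..N. measure M (\<sigma> i -` A \<inter> space M)) = real N * measure M A"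
    using \<sigma>_measure[OF set] N2 by (simp add: field_simps)
  finally show ?case
    using set by (simp add: emeasure_eq_measure ennreal_mult ennreal_of_nat_eq_real_of_nat)
next
  case (mult f c)
  have m: "(\<lambda>x. f (\<sigma> i x)) \<in> borel_measurable M" if "i \<in> {1..N}" for i
    using measurable_compose[OF \<sigma>_meas[OF that] mult(2)] .
  have "of_nat N * (\<integral>\<^sup>+x. c * f x \<partial>M) = c * (of_nat N * (\<integral>\<^sup>+x. f x \<partial>M))"
    using mult by (simp add: nn_integral_cmult mult_ac)
  then show ?case using mult m by (simp add: nn_integral_cmult sum_distrib_left)
next
  case (add f k)
  have "(\<lambda>x. f (\<sigma> i x)) \<in> borel_measurable M" "(\<lambda>x. k (\<sigma> i x)) \<in> borel_measurable M" if "i \<in> {1..N}" for i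
    using measurable_compose[OF \<sigma>_meas[OF that]] add by auto
  then show ?case using add by (simp add: nn_integral_add sum.distrib distrib_left)
next
  case (seq U)
  have m: "(\<lambda>x. U n (\<sigma> i x)) \<in> borel_measurable M" if "i \<in> {1..N}" for i n
    using measurable_compose[OF \<sigma>_meas[OF that]] seq by auto
  have "of_nat N * (\<integral>\<^sup>+x. (SUP n. U n x) \<partial>M) = (SUP n. of_nat N * (\<integral>\<^sup>+x. U n x \<partial>M))"
    using seq by (simp add: nn_integral_monotone_convergence_SUP SUP_mult_left_ennreal)
  also have "\<dots> = (SUP n. \<Sum>i=1..N. \<integral>\<^sup>+x. U n (\<sigma> i x) \<partial>M)"
    using seq by simp
  also have "\<dots> = (\<Sum>i=1..N. SUP n. \<integral>\<^sup>+x. U n (\<sigma> i x) \<partial>M)"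
    using seq(3) by (intro ennreal_SUP_sum) (auto simp: incseq_def le_fun_def intro!: nn_integral_mono)
  also have "\<dots> = (\<Sum>i=1..N. \<integral>\<^sup>+x. (SUP n. U n (\<sigma> i x)) \<partial>M)"
    using seq(3) m by (intro sum.cong nn_integral_monotone_convergence_SUP[symmetric])
      (auto simp: incseq_def le_fun_def)
  finally show ?case by (simp add: image_comp)
qed

lemma integrable_branch:
  fixes f :: "'x \<Rightarrow> complex"
  assumes f: "integrable M f" and i: "i \<in> {1..N}"
  shows "integrable M (\<lambda>x. f (\<sigma> i x))"
proof (rule integrableI_bounded)
  show "(\<lambda>x. f (\<sigma> i x)) \<in> borel_measurable M"
    by (rule measurable_compose[OF \<sigma>_meas[OF i] borel_measurable_integrable[OF f]])
  have "(\<integral>\<^sup>+x. norm (f (\<sigma> i x)) \<partial>M) \<le> (\<Sum>i=1..N. \<integral>\<^sup>+x. norm (f (\<sigma> i x)) \<partial>M)"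
    using i by (intro member_le_sum) auto
  also have "\<dots> = of_nat N * (\<integral>\<^sup>+x. norm (f x) \<partial>M)"
    using f by (subst nn_integral_branches) auto
  also have "\<dots> < \<infinity>"
    using f by (simp add: integrable_iff_bounded ennreal_mult_less_top of_nat_less_top)
  finally show "(\<integral>\<^sup>+x. norm (f (\<sigma> i x)) \<partial>M) < \<infinity>" .
qed

lemma integral_branches:
  fixes f :: "'x \<Rightarrow> complex"
  assumes "integrable M f"
  shows "of_nat N * (LINT x|M. f x) = (\<Sum>i=1..N. LINT x|M. f (\<sigma> i x))"
  using assms
proof (induction f rule: integrable_induct)
  case (base A c)
  have "(LINT x|M. indicator A (\<sigma> i x) *\<^sub>R c) = measure M (\<sigma> i -` A \<inter> space M) *\<^sub>R c" if "i \<in> {1..N}" for i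
  proof -
    have "(LINT x|M. indicator A (\<sigma> i x) *\<^sub>R c) = (LINT x|M. indicator (\<sigma> i -` A \<inter> space M) x *\<^sub>R c)"
      by (intro Bochner_Integration.integral_cong) (auto simp: indicator_def)
    then show ?thesis
      using has_bochner_integral_integral_eq[OF has_bochner_integral_indicator[OF
            measurable_sets[OF \<sigma>_meas[OF that] base(1)]], of c]
      by (simp add: emeasure_eq_measure)
  qed
  then have "(\<Sum>i=1..N. LINT x|M. indicator A (\<sigma> i x) *\<^sub>R c) = (\<Sum>i=1..N. measure M (\<sigma> i -` A \<inter> space M)) *\<^sub>R c"
    by (simp add: scaleR_sum_left)
  also have "(\<Sum>i=1..N. measure M (\<sigma> i -` A \<inter> space M)) = real N * measure M A"
    using \<sigma>_measure[OF base(1)] N2 by (simp add: field_simps)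
  finally show ?case using base(1) by (simp add: scaleR_conv_of_real)
next
  case (add f k)
  then show ?case by (simp add: integrable_branch distrib_left sum.distrib)
next
  case (lim f s)
  have "(\<lambda>n. of_nat N * (LINT x|M. s n x)) \<longlonglongrightarrow> of_nat N * (LINT x|M. f x)"
    using lim.hyps
    by (intro tendsto_mult tendsto_const integral_dominated_convergence[where w = "\<lambda>x. 2 * norm (f x)"]) auto
  moreover have "(\<lambda>n. \<Sum>i=1..N. LINT x|M. s n (\<sigma> i x)) \<longlonglongrightarrow> (\<Sum>i=1..N. LINT x|M. f (\<sigma> i x))"
  proof (rule tendsto_sum)
    fix i assume i: "i \<in> {1..N}"
    show "(\<lambda>n. LINT x|M. s n (\<sigma> i x)) \<longlonglongrightarrow> (LINT x|M. f (\<sigma> i x))"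
    proof (rule integral_dominated_convergence[where w = "\<lambda>x. 2 * norm (f (\<sigma> i x))"])
      show "integrable M (\<lambda>x. 2 * norm (f (\<sigma> i x)))"
        using integrable_branch[OF lim.hyps(4) i] by simp
      show "(\<lambda>x. f (\<sigma> i x)) \<in> borel_measurable M" "\<And>n. (\<lambda>x. s n (\<sigma> i x)) \<in> borel_measurable M"
        using integrable_branch[OF _ i] lim.hyps(1,4) by auto
    qed (use lim.hyps(2,3) measurable_space[OF \<sigma>_meas[OF i]] in auto)
  qed
  ultimately show ?case
    using lim.IH by (simp add: LIMSEQ_unique)
qed

text \<open>A version of \<open>R k\<close> that is integrable with respect to \<open>M\<close> itself, not only to its completion.\<close>

definition branch_sum :: "('x \<Rightarrow> complex) \<Rightarrow> 'x \<Rightarrow> complex" where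
  "branch_sum k x = (\<Sum>i=1..N. complex_of_real (g (\<sigma> i x)) * k (\<sigma> i x))"

lemma Linf_g: "(\<lambda>x. complex_of_real (g x)) \<in> Linf M"
  using g_bounds by (intro LinfI[of _ _ 1]) auto

lemma integrable_branch_sum:
  assumes k: "integrable M k"
  shows "integrable M (branch_sum k)"
  unfolding branch_sum_def[abs_def]
  using integrable_branch[OF integrable_Linf_mult[OF Linf_g k]] by (intro Bochner_Integration.integrable_sum) auto

text \<open>Duality: \<open>R\<close> is adjoint to \<open>f \<mapsto> N g (f \<circ> T)\<close>, since \<open>T \<circ> \<sigma>\<^sub>i\<close> is the identity.\<close>

lemma integral_branch_sum:
  assumes f: "f \<in> Linf M" and k: "integrable M k"
  shows "(LINT x|M. f x * branch_sum k x) = of_nat N * (LINT x|M. f (T x) * (complex_of_real (g x) * k x))"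
proof -
  let ?k = "\<lambda>x. f (T x) * (complex_of_real (g x) * k x)"
  have gk: "integrable M (\<lambda>x. complex_of_real (g x) * k x)"
    by (rule integrable_Linf_mult[OF Linf_g k])
  have int: "integrable M ?k"
    by (rule integrable_Linf_mult[OF Linf_T[OF f] gk])
  have "of_nat N * (LINT x|M. ?k x) = (\<Sum>i=1..N. LINT x|M. ?k (\<sigma> i x))"
    by (rule integral_branches[OF int])
  also have "\<dots> = (\<Sum>i=1..N. LINT x|M. f x * (complex_of_real (g (\<sigma> i x)) * k (\<sigma> i x)))"
  proof (intro sum.cong refl integral_cong_AE)
    fix i assume i: "i \<in> {1..N}"
    show "(\<lambda>x. ?k (\<sigma> i x)) \<in> borel_measurable M"
      using integrable_branch[OF int i] by simp
    show "(\<lambda>x. f x * (complex_of_real (g (\<sigma> i x)) * k (\<sigma> i x))) \<in> borel_measurable M"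
      by (rule borel_measurable_times[OF Linf_measurable[OF f]
            borel_measurable_integrable[OF integrable_branch[OF gk i]]])
    show "AE x in M. ?k (\<sigma> i x) = f x * (complex_of_real (g (\<sigma> i x)) * k (\<sigma> i x))"
      using T_\<sigma>[OF i] by eventually_elim simp
  qed
  also have "\<dots> = (LINT x|M. (\<Sum>i=1..N. f x * (complex_of_real (g (\<sigma> i x)) * k (\<sigma> i x))))"
    using integrable_branch[OF gk] by (intro Bochner_Integration.integral_sum[symmetric] integrable_Linf_mult[OF f]) auto
  finally show ?thesis by (simp add: branch_sum_def sum_distrib_left)
qed

lemma transfer_op_AE: "AE x in M. transfer_op M T g k x = branch_sum k x"
  using transfer_op_branches by (simp add: branch_sum_def)

lemma integral_transfer_op:
  assumes f: "f \<in> Linf M" and k: "integrable M k"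
  shows "(LINT x|completion M. f x * transfer_op M T g k x)
    = of_nat N * (LINT x|M. f (T x) * (complex_of_real (g x) * k x))"
proof -
  have ae: "AE x in completion M. f x * branch_sum k x = f x * transfer_op M T g k x"
    using AE_completion[OF transfer_op_AE[of k]] by eventually_elim simp
  have m: "(\<lambda>x. f x * branch_sum k x) \<in> borel_measurable M"
    using integrable_branch_sum[OF k] Linf_measurable[OF f] by auto
  have m': "(\<lambda>x. f x * transfer_op M T g k x) \<in> borel_measurable (completion M)"
    by (rule borel_measurable_completion_AE[OF measurable_completion[OF m] ae])
  have "(LINT x|completion M. f x * transfer_op M T g k x) = (LINT x|completion M. f x * branch_sum k x)"
    using ae m m' by (intro integral_cong_AE) (auto elim: eventually_mono intro: measurable_completion)
  also have "\<dots> = (LINT x|M. f x * branch_sum k x)"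
    using m by (rule integral_completion)
  finally show ?thesis using integral_branch_sum[OF f k] by simp
qed

end


section \<open>Harmonic functions and the functionals they represent\<close>

lemma cocycle_0 [simp]: "cocycle T k 0 x = 1"
  by (simp add: cocycle_def)

lemma cocycle_Suc: "cocycle T k (Suc n) x = k x * cocycle T k n (T x)"
  unfolding cocycle_def prod.lessThan_Suc_shift by (simp add: funpow_swap1)

lemma cocycle_Suc_last: "cocycle T k (Suc n) x = cocycle T k n x * k ((T ^^ n) x)"
  by (simp add: cocycle_def)

context branched
begin

definition lowpass :: "'x \<Rightarrow> complex" where
  "lowpass x = complex_of_real (sqrt (real N * g x))"

text \<open>The function \<open>m\<^sup>(\<^sup>n\<^sup>)\<close> with \<open>U\<^sup>n \<Omega> = m\<^sup>(\<^sup>n\<^sup>) \<Omega>\<close> in the GNS space, for the low-pass filter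
  \<open>m = sqrt (N g)\<close>.\<close>

definition filter_pow :: "nat \<Rightarrow> 'x \<Rightarrow> complex" where
  "filter_pow n x = complex_of_real (cocycle T (\<lambda>y. sqrt (real N * g y)) n x)"

lemma filter_pow_0 [simp]: "filter_pow 0 x = 1"
  by (simp add: filter_pow_def)

lemma filter_pow_1 [simp]: "filter_pow (Suc 0) x = lowpass x"
  by (simp add: filter_pow_def cocycle_def lowpass_def)

lemma cnj_lowpass [simp]: "cnj (lowpass x) = lowpass x"
  by (simp add: lowpass_def)

lemma filter_pow_Suc: "filter_pow (Suc n) x = lowpass x * filter_pow n (T x)"
  by (simp add: filter_pow_def cocycle_Suc lowpass_def)

lemma filter_pow_Suc_last: "filter_pow (Suc n) x = filter_pow n x * lowpass ((T ^^ n) x)"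
  by (simp add: filter_pow_def cocycle_Suc_last lowpass_def)

lemma cnj_filter_pow [simp]: "cnj (filter_pow n x) = filter_pow n x"
  by (simp add: filter_pow_def)

lemma lowpass_sq: "x \<in> space M \<Longrightarrow> lowpass x * lowpass x = of_nat N * complex_of_real (g x)"
proof -
  assume "x \<in> space M"
  then have "sqrt (real N * g x) * sqrt (real N * g x) = real N * g x"
    using g_bounds[of x] by simp
  then show ?thesis
    unfolding lowpass_def by (metis of_real_mult of_real_of_nat_eq)
qed

lemma filter_pow_eq:
  "filter_pow n x = complex_of_real (real N powr (real n / 2)) * complex_of_real (sqrt (cocycle T g n x))"
proof -
  have "cocycle T (\<lambda>y. sqrt (real N * g y)) n x = sqrt (real N) ^ n * sqrt (cocycle T g n x)"
    by (induction n) (simp_all add: cocycle_Suc_last real_sqrt_mult)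
  moreover have "sqrt (real N) ^ n = real N powr (real n / 2)"
    using N2 by (simp add: powr_half_sqrt[symmetric] powr_powr flip: powr_realpow)
  ultimately show ?thesis by (simp add: filter_pow_def)
qed

lemma Linf_lowpass: "lowpass \<in> Linf M"
proof (rule LinfI)
  show "lowpass \<in> borel_measurable M" unfolding lowpass_def[abs_def] by measurable
  have "sqrt (real N * g x) \<le> sqrt (real N)" if "x \<in> space M" for x
    using g_bounds[OF that] by (simp add: mult_left_le)
  then show "AE x in M. cmod (lowpass x) \<le> sqrt (real N)"
    using g_bounds by (intro AE_I2) (simp add: lowpass_def)
qed

lemma Linf_filter_pow: "filter_pow n \<in> Linf M"
proof (induction n)
  case (Suc n)
  have "(\<lambda>x. lowpass x * filter_pow n (T x)) \<in> Linf M"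
    by (rule Linf_mult[OF Linf_lowpass Linf_T[OF Suc]])
  then show ?case unfolding filter_pow_Suc[abs_def, symmetric] .
qed (simp add: filter_pow_def[abs_def] Linf_const)

lemma harmonic_iff_branch_sum:
  "h \<in> harmonic M T g \<longleftrightarrow> integrable M h \<and> (AE x in M. h x \<in> \<real>\<^sub>\<ge>\<^sub>0) \<and> (AE x in M. branch_sum h x = h x)"
proof -
  have "(AE x in M. transfer_op M T g h x = h x) \<longleftrightarrow> (AE x in M. branch_sum h x = h x)"
    using transfer_op_AE[of h] by (auto elim: eventually_elim2)
  then show ?thesis by (simp add: harmonic_def)
qed

lemma harmonic_integrable: "h \<in> harmonic M T g \<Longrightarrow> integrable M h"
  by (simp add: harmonic_def)

text \<open>The isometry property: applied to \<open>f = cnj \<xi> \<eta>\<close>, it says that \<open>\<xi> \<mapsto> m (\<xi> \<circ> T)\<close> preserves the inner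
  product of \<open>L\<^sup>2(h d\<mu>)\<close>.\<close>

lemma integral_harmonic:
  assumes h: "h \<in> harmonic M T g" and f: "f \<in> Linf M"
  shows "(LINT x|M. f (T x) * (lowpass x * lowpass x) * h x) = (LINT x|M. f x * h x)"
proof -
  have int: "integrable M h" using h by (rule harmonic_integrable)
  have "(LINT x|M. f (T x) * (lowpass x * lowpass x) * h x)
      = (LINT x|M. of_nat N * (f (T x) * (complex_of_real (g x) * h x)))"
    by (intro Bochner_Integration.integral_cong) (auto simp only: lowpass_sq mult_ac)
  also have "\<dots> = (LINT x|M. f x * branch_sum h x)"
    by (simp add: integral_branch_sum[OF f int])
  also have "\<dots> = (LINT x|M. f x * h x)"
  proof (rule integral_cong_AE)
    show "(\<lambda>x. f x * branch_sum h x) \<in> borel_measurable M" "(\<lambda>x. f x * h x) \<in> borel_measurable M"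
      by (intro borel_measurable_integrable integrable_Linf_mult[OF f] integrable_branch_sum int)+
    have "AE x in M. branch_sum h x = h x" using h by (simp add: harmonic_iff_branch_sum)
    then show "AE x in M. f x * branch_sum h x = f x * h x" by eventually_elim simp
  qed
  finally show ?thesis .
qed

end

locale branched_algebra = branched M T N \<sigma> g
  for M :: "'x measure" and T N \<sigma> g +
  fixes \<iota> :: "('x \<Rightarrow> complex) \<Rightarrow> 'a::cstar_algebra" and u :: 'a
  assumes alg: "is_covariance_algebra M T \<iota> u"
begin

lemma cov: "covariant_pair M T \<iota> u"
  using alg unfolding is_covariance_algebra_def by blast

lemma \<iota>_mult: "f \<in> Linf M \<Longrightarrow> k \<in> Linf M \<Longrightarrow> \<iota> (\<lambda>x. f x * k x) = \<iota> f * \<iota> k"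
  and \<iota>_one: "\<iota> (\<lambda>x. 1) = 1"
  and \<iota>_cnj: "f \<in> Linf M \<Longrightarrow> \<iota> (\<lambda>x. cnj (f x)) = adj (\<iota> f)"
  and u_unitary: "adj u * u = 1" "u * adj u = 1"
  and u_cov: "f \<in> Linf M \<Longrightarrow> u * \<iota> f * adj u = \<iota> (f \<circ> T)"
  using cov unfolding covariant_pair_def by blast+

lemma u_comm: 
  assumes f: "f \<in> Linf M"
  shows "u * \<iota> f = \<iota> (\<lambda>x. f (T x)) * u"
proof -
  have "\<iota> (f \<circ> T) * u = u * \<iota> f * (adj u * u)"
    by (simp only: u_cov[OF f, symmetric] mult.assoc)
  then show ?thesis by (simp add: u_unitary o_def)
qed

lemma u_pow_comm:
  assumes f: "f \<in> Linf M"
  shows "u ^ n * \<iota> f = \<iota> (\<lambda>x. f ((T ^^ n) x)) * u ^ n"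
proof (induction n)
  case (Suc n)
  have "u ^ Suc n * \<iota> f = u * \<iota> (\<lambda>x. f ((T ^^ n) x)) * u ^ n"
    by (simp add: mult.assoc Suc)
  also have "\<dots> = \<iota> (\<lambda>x. f ((T ^^ n) (T x))) * u * u ^ n"
    by (simp add: u_comm[OF Linf_T_pow[OF f]])
  finally show ?case by (simp add: mult.assoc funpow_swap1)
qed simp

lemma adj_filter: "adj (\<iota> (filter_pow n)) = \<iota> (filter_pow n)"
  using \<iota>_cnj[OF Linf_filter_pow[of n]] unfolding cnj_filter_pow by (rule sym)

lemma adj_lowpass: "adj (\<iota> lowpass) = \<iota> lowpass"
  using \<iota>_cnj[OF Linf_lowpass] unfolding cnj_lowpass by (rule sym)

text \<open>By duality the integral of \<open>R (f h)\<close> becomes one of \<open>f h\<close>, and all powers of \<open>N\<close> and \<open>g\<close> are absorbed in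
  powers of \<open>m\<close>. In this form the second formula is visibly the inner product of \<open>m \<Omega>\<close> and
  \<open>f m\<^sup>(\<^sup>n\<^sup>) \<Omega>\<close>.\<close>

lemma represents_iff:
  assumes h: "integrable M h"
  shows "represents M T N g \<iota> u h \<omega> \<longleftrightarrow>
    (\<forall>f\<in>Linf M. \<forall>n. \<omega> (\<iota> f * u ^ n) = (LINT x|M. f x * filter_pow n x * h x)) \<and>
    (\<forall>f\<in>Linf M. \<forall>n. \<omega> (adj u * \<iota> f * u ^ Suc n)
        = (LINT x|M. lowpass x * f x * filter_pow (Suc n) x * h x))"
proof -
  have 1: "complex_of_real (real N powr (real n / 2)) *
        (LINT x|M. f x * complex_of_real (sqrt (cocycle T g n x)) * h x)
      = (LINT x|M. f x * filter_pow n x * h x)" for f n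
    by (simp add: filter_pow_eq mult_ac flip: integral_mult_right_zero)
  have 2: "complex_of_real (real N powr ((real (Suc n) - 1) / 2)) *
        (LINT x|completion M. complex_of_real (sqrt (cocycle T g (Suc n - 1) x)) *
           transfer_op M T g (\<lambda>y. f y * h y) x)
      = (LINT x|M. lowpass x * f x * filter_pow (Suc n) x * h x)" if f: "f \<in> Linf M" for f n
  proof -
    have "complex_of_real (real N powr ((real (Suc n) - 1) / 2)) *
        (LINT x|completion M. complex_of_real (sqrt (cocycle T g (Suc n - 1) x)) *
           transfer_op M T g (\<lambda>y. f y * h y) x)
      = (LINT x|completion M. filter_pow n x * transfer_op M T g (\<lambda>y. f y * h y) x)"
      by (simp add: filter_pow_eq mult_ac flip: integral_mult_right_zero)
    also have "\<dots> = (LINT x|M. of_nat N * (filter_pow n (T x) * (complex_of_real (g x) * (f x * h x))))"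
      by (simp add: integral_transfer_op[OF Linf_filter_pow integrable_Linf_mult[OF f h]])
    also have "\<dots> = (LINT x|M. lowpass x * f x * filter_pow (Suc n) x * h x)"
    proof (rule Bochner_Integration.integral_cong)
      fix x assume x: "x \<in> space M"
      have "lowpass x * f x * filter_pow (Suc n) x * h x
          = (lowpass x * lowpass x) * (filter_pow n (T x) * (f x * h x))"
        by (simp only: filter_pow_Suc mult_ac)
      then show "of_nat N * (filter_pow n (T x) * (complex_of_real (g x) * (f x * h x)))
          = lowpass x * f x * filter_pow (Suc n) x * h x"
        by (simp only: lowpass_sq[OF x] mult_ac)
    qed simp
    finally show ?thesis .
  qed
  have all: "(\<forall>n\<ge>1. P n) \<longleftrightarrow> (\<forall>n. P (Suc n))" for P :: "nat \<Rightarrow> bool"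
    by (metis Suc_le_D One_nat_def Suc_le_mono le0)
  show ?thesis
    unfolding represents_def all 1 using 2 by simp
qed

lemma represents_cong_AE:
  assumes h: "integrable M h" "integrable M h'" and ae: "AE x in M. h x = h' x"
    and rep: "represents M T N g \<iota> u h \<omega>"
  shows "represents M T N g \<iota> u h' \<omega>"
proof -
  have "(LINT x|M. f x * h x) = (LINT x|M. f x * h' x)" if "f \<in> Linf M" for f
    using integrable_Linf_mult[OF that h(1)] integrable_Linf_mult[OF that h(2)] ae
    by (intro integral_cong_AE) (auto elim: eventually_mono)
  then have "(LINT x|M. f x * filter_pow n x * h x) = (LINT x|M. f x * filter_pow n x * h' x)"
    "(LINT x|M. lowpass x * f x * filter_pow n x * h x) = (LINT x|M. lowpass x * f x * filter_pow n x * h' x)"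
    if "f \<in> Linf M" for f n
    using that by (blast intro: Linf_mult Linf_filter_pow Linf_lowpass)+
  then show ?thesis
    using rep unfolding represents_iff[OF h(1)] represents_iff[OF h(2)] by simp
qed

lemma represents_unique_function:
  assumes h: "integrable M h" "integrable M h'"
    and rep: "represents M T N g \<iota> u h \<omega>" "represents M T N g \<iota> u h' \<omega>"
  shows "AE x in M. h x = h' x"
proof -
  have "AE x in M. h x - h' x = 0"
  proof (rule AE_zero_of_orthogonal_Linf)
    show "integrable M (\<lambda>x. h x - h' x)" using h by simp
    fix f assume f: "f \<in> Linf M"
    have "(LINT x|M. f x * h x) = \<omega> (\<iota> f * u ^ 0)" "(LINT x|M. f x * h' x) = \<omega> (\<iota> f * u ^ 0)"
      using rep f unfolding represents_iff[OF h(1)] represents_iff[OF h(2)] by (metis (no_types, lifting) Bochner_Integration.integral_cong filter_pow_0 mult.right_neutral)+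
    then show "(LINT x|M. f x * (h x - h' x)) = 0"
      using integrable_Linf_mult[OF f h(1)] integrable_Linf_mult[OF f h(2)] by (simp add: right_diff_distrib)
  qed
  then show ?thesis by eventually_elim simp
qed

text \<open>Positivity on \<open>\<bar>f\<bar>\<^sup>2\<close> gives \<open>h \<ge> 0\<close>; the relation \<open>U\<^sup>-\<^sup>1 (f \<circ> T) U = f\<close>, evaluated with both formulas,
  gives \<open>\<integral> f R h = \<integral> f h\<close>.\<close>

lemma represents_imp_harmonic:
  assumes pos: "positive_functional \<omega>" and h: "integrable M h" and rep: "represents M T N g \<iota> u h \<omega>"
  shows "h \<in> harmonic M T g"
proof -
  have r0: "\<omega> (\<iota> f) = (LINT x|M. f x * h x)" if "f \<in> Linf M" for f
    using rep[unfolded represents_iff[OF h], THEN conjunct1, rule_format, OF that, of 0] by simp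
  have r1: "\<omega> (adj u * \<iota> f * u) = (LINT x|M. lowpass x * f x * lowpass x * h x)" if "f \<in> Linf M" for f
    using rep[unfolded represents_iff[OF h], THEN conjunct2, rule_format, OF that, of 0] by simp
  have "AE x in M. h x \<in> \<real>\<^sub>\<ge>\<^sub>0"
  proof (rule AE_nonneg_of_integrals[OF h])
    fix E assume E: "E \<in> sets M"
    let ?e = "\<lambda>x. indicator E x :: complex"
    have e: "?e \<in> Linf M" by (rule Linf_indicator[OF E])
    have "(\<lambda>x. cnj (?e x) * ?e x) = ?e" by (auto simp: indicator_def)
    then have "adj (\<iota> ?e) * \<iota> ?e = \<iota> ?e"
      using \<iota>_mult[OF Linf_cnj[OF e] e] \<iota>_cnj[OF e] by simp
    then show "(LINT x|M. ?e x * h x) \<in> \<real>\<^sub>\<ge>\<^sub>0"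
      using pf_square[OF pos, of "\<iota> ?e"] r0[OF e] by simp
  qed
  moreover have "AE x in M. branch_sum h x - h x = 0"
  proof (rule AE_zero_of_orthogonal_Linf)
    show "integrable M (\<lambda>x. branch_sum h x - h x)" using h integrable_branch_sum[OF h] by simp
    fix f assume f: "f \<in> Linf M"
    have "adj u * \<iota> (\<lambda>x. f (T x)) * u = adj u * (u * \<iota> f)"
      by (simp add: u_comm[OF f] mult.assoc)
    also have "\<dots> = \<iota> f" by (simp add: u_unitary flip: mult.assoc)
    finally have "(LINT x|M. f x * h x)
        = (LINT x|M. lowpass x * f (T x) * lowpass x * h x)"
      using r0[OF f] r1[OF Linf_T[OF f]] by simp
    also have "\<dots> = (LINT x|M. of_nat N * (f (T x) * (complex_of_real (g x) * h x)))"
    proof (rule Bochner_Integration.integral_cong)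
      fix x assume x: "x \<in> space M"
      have "lowpass x * f (T x) * lowpass x * h x = (lowpass x * lowpass x) * (f (T x) * h x)"
        by (simp only: mult_ac)
      then show "lowpass x * f (T x) * lowpass x * h x = of_nat N * (f (T x) * (complex_of_real (g x) * h x))"
        by (simp only: lowpass_sq[OF x] mult_ac)
    qed simp
    also have "\<dots> = (LINT x|M. f x * branch_sum h x)"
      by (simp add: integral_branch_sum[OF f h])
    finally show "(LINT x|M. f x * (branch_sum h x - h x)) = 0"
      using integrable_Linf_mult[OF f h] integrable_Linf_mult[OF f integrable_branch_sum[OF h]]
      by (simp add: right_diff_distrib)
  qed
  then have "AE x in M. branch_sum h x = h x" by eventually_elim simp
  ultimately show ?thesis using h by (simp add: harmonic_iff_branch_sum)
qed

context
  fixes h \<omega>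
  assumes pos: "positive_functional \<omega>" and h: "h \<in> harmonic M T g" and rep: "represents M T N g \<iota> u h \<omega>"
begin

lemma value_pos_power: "f \<in> Linf M \<Longrightarrow> \<omega> (\<iota> f * u ^ n) = (LINT x|M. f x * filter_pow n x * h x)"
  using rep unfolding represents_iff[OF harmonic_integrable[OF h]] by blast

lemma value_function: "f \<in> Linf M \<Longrightarrow> \<omega> (\<iota> f) = (LINT x|M. f x * h x)"
  using value_pos_power[of f 0] by simp

text \<open>The refinement equation \<open>U \<Omega> = m \<Omega>\<close>: all four terms of \<open>\<omega> ((U - m)\<^sup>* (U - m))\<close> equal \<open>\<integral> h\<close>
  up to sign, by \<open>R h = h\<close>.\<close>

lemma refinement: "\<omega> (adj (u - \<iota> lowpass) * (u - \<iota> lowpass)) = 0"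
proof -
  let ?m = "lowpass"
  have one: "\<omega> 1 = (LINT x|M. h x)" using value_function[OF Linf_const, of 1] \<iota>_one by simp
  have sq: "(LINT x|M. ?m x * ?m x * h x) = (LINT x|M. h x)"
    using integral_harmonic[OF h Linf_const, of 1] by simp
  have mm: "\<omega> (\<iota> ?m * \<iota> ?m) = (LINT x|M. h x)"
    using value_function[OF Linf_mult[OF Linf_lowpass Linf_lowpass]] sq
    by (simp add: \<iota>_mult[OF Linf_lowpass Linf_lowpass])
  have mu: "\<omega> (\<iota> ?m * u) = (LINT x|M. h x)"
    using value_pos_power[OF Linf_lowpass, of 1] sq by simp
  have "cnj (\<omega> 1) = \<omega> 1" using pf_adj[OF pos, of 1] by simp
  then have um: "\<omega> (adj u * \<iota> ?m) = (LINT x|M. h x)"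
    using pf_adj[OF pos, of "\<iota> ?m * u"] mu one by (simp add: adj_mult adj_lowpass)
  have "adj (u - \<iota> ?m) * (u - \<iota> ?m) = 1 - adj u * \<iota> ?m - \<iota> ?m * u + \<iota> ?m * \<iota> ?m"
    by (simp add: adj_diff adj_lowpass algebra_simps u_unitary)
  then show ?thesis
    by (simp add: pf_add[OF pos] pf_diff[OF pos] one mm mu um)
qed

text \<open>The refinement equation iterated, using \<open>U\<^sup>n m = (m \<circ> T\<^sup>n) U\<^sup>n\<close>.\<close>

lemma value_right_power: "\<omega> (b * u ^ n) = \<omega> (b * \<iota> (filter_pow n))"
proof (induction n arbitrary: b)
  case 0
  have "\<iota> (filter_pow 0) = 1" using \<iota>_one by (simp add: filter_pow_def[abs_def])
  then show ?case by (simp only: power_0)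
next
  case (Suc n)
  have swap: "\<omega> (c * u) = \<omega> (c * \<iota> lowpass)" for c
    using pf_left_kernel[OF pos refinement, of c] by (simp add: right_diff_distrib pf_diff[OF pos])
  let ?f = "\<lambda>x. lowpass ((T ^^ n) x)"
  have f: "?f \<in> Linf M" by (rule Linf_T_pow[OF Linf_lowpass])
  have "\<omega> (b * u ^ Suc n) = \<omega> (b * u ^ n * u)" by (simp add: mult.assoc power_commutes)
  also have "\<dots> = \<omega> (b * (u ^ n * \<iota> lowpass))" using swap[of "b * u ^ n"] by (simp only: mult.assoc)
  also have "\<dots> = \<omega> (b * \<iota> ?f * u ^ n)"
    by (simp only: u_pow_comm[OF Linf_lowpass] mult.assoc)
  also have "\<dots> = \<omega> (b * \<iota> ?f * \<iota> (filter_pow n))" by (rule Suc)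
  also have "\<iota> ?f * \<iota> (filter_pow n) = \<iota> (filter_pow (Suc n))"
    using \<iota>_mult[OF f Linf_filter_pow[of n]] by (simp add: filter_pow_Suc_last[abs_def] mult.commute)
  then have "\<omega> (b * \<iota> ?f * \<iota> (filter_pow n)) = \<omega> (b * \<iota> (filter_pow (Suc n)))"
    by (simp only: mult.assoc)
  finally show ?case .
qed

lemma value_monomial:
  assumes f: "f \<in> Linf M"
  shows "\<omega> (adj u ^ n * \<iota> f * u ^ k) = (LINT x|M. filter_pow n x * (f x * filter_pow k x) * h x)"
proof -
  let ?c = "\<iota> f * \<iota> (filter_pow k)"
  have fk: "(\<lambda>x. f x * filter_pow k x) \<in> Linf M" by (rule Linf_mult[OF f Linf_filter_pow])
  have adj_pow: "adj (v ^ n) = adj v ^ n" for v :: 'a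
    by (induction n) (simp_all add: adj_mult power_commutes)
  have "\<omega> (adj u ^ n * \<iota> f * u ^ k) = \<omega> (adj u ^ n * \<iota> f * \<iota> (filter_pow k))"
    by (rule value_right_power)
  also have "\<dots> = \<omega> (adj (adj ?c * u ^ n))"
    by (simp add: adj_mult adj_adj adj_pow mult.assoc)
  also have "\<dots> = cnj (\<omega> (adj ?c * \<iota> (filter_pow n)))"
    by (simp only: pf_adj[OF pos] value_right_power)
  also have "\<dots> = \<omega> (\<iota> (filter_pow n) * ?c)"
    by (simp only: pf_adj[OF pos, symmetric] adj_mult adj_adj adj_filter)
  also have "\<iota> (filter_pow n) * ?c = \<iota> (\<lambda>x. filter_pow n x * (f x * filter_pow k x))"
    by (simp only: \<iota>_mult[OF f Linf_filter_pow] \<iota>_mult[OF Linf_filter_pow fk])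
  finally show ?thesis
    by (simp add: value_function Linf_mult[OF Linf_filter_pow fk])
qed

end

text \<open>\<open>value_monomial\<close> fixes both functionals on a set with dense span, and both are continuous.\<close>

lemma represents_unique_functional:
  assumes 1: "positive_functional \<omega>1" "represents M T N g \<iota> u h \<omega>1"
    and 2: "positive_functional \<omega>2" "represents M T N g \<iota> u h \<omega>2"
    and h: "h \<in> harmonic M T g"
  shows "\<omega>1 = \<omega>2"
proof
  fix a
  let ?D = "{adj u ^ n * \<iota> f * u ^ k | n f k. f \<in> Linf M}"
  have bl: "bounded_linear \<omega>1" "bounded_linear \<omega>2"
    using 1 2 by (auto intro: bounded_linear_pf)
  have dense: "closure (span ?D) = UNIV"
    using alg unfolding is_covariance_algebra_def by blast
  show "\<omega>1 a = \<omega>2 a"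
  proof (rule continuous_eq_on_dense[OF linear_continuous_on[OF bl(1)] linear_continuous_on[OF bl(2)] dense])
    fix x assume "x \<in> span ?D"
    then show "\<omega>1 x = \<omega>2 x"
    proof (rule linear_eq_on_span[rotated 3])
      show "linear \<omega>1" "linear \<omega>2" using bl by (auto simp: bounded_linear.linear)
      show "\<omega>1 y = \<omega>2 y" if "y \<in> ?D" for y
        using that value_monomial[OF 1(1) h 1(2)] value_monomial[OF 2(1) h 2(2)] by auto
    qed
  qed
qed

end


section \<open>The functional of a harmonic function\<close>

locale harmonic_system = branched_algebra M T N \<sigma> g \<iota> u
  for M :: "'x measure" and T N \<sigma> g and \<iota> :: "('x \<Rightarrow> complex) \<Rightarrow> 'a::cstar_algebra" and u +
  fixes h :: "'x \<Rightarrow> complex"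
  assumes h: "h \<in> harmonic M T g"
begin

definition ip :: "('x \<Rightarrow> complex) \<Rightarrow> ('x \<Rightarrow> complex) \<Rightarrow> complex" where
  "ip \<xi> \<eta> = (LINT x|M. cnj (\<xi> x) * \<eta> x * h x)"

lemma ip_integrable:
  assumes "\<xi> \<in> Linf M" "\<eta> \<in> Linf M"
  shows "integrable M (\<lambda>x. cnj (\<xi> x) * \<eta> x * h x)"
  by (intro integrable_Linf_mult Linf_mult Linf_cnj assms harmonic_integrable h)

lemma ip_shift:
  assumes "\<xi> \<in> Linf M" "\<eta> \<in> Linf M"
  shows "ip (\<lambda>x. lowpass x * \<xi> (T x)) (\<lambda>x. lowpass x * \<eta> (T x)) = ip \<xi> \<eta>"
  using integral_harmonic[OF h Linf_mult[OF Linf_cnj[OF assms(1)] assms(2)]]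
  by (simp add: ip_def mult_ac)

lemma ip_herm: "\<xi> \<in> Linf M \<Longrightarrow> \<eta> \<in> Linf M \<Longrightarrow> ip \<eta> \<xi> = cnj (ip \<xi> \<eta>)"
proof -
  assume "\<xi> \<in> Linf M" "\<eta> \<in> Linf M"
  have "cnj (ip \<xi> \<eta>) = (LINT x|M. cnj (cnj (\<xi> x) * \<eta> x * h x))"
    by (simp add: ip_def integral_cnj del: complex_cnj_mult)
  also have "\<dots> = ip \<eta> \<xi>"
    unfolding ip_def
  proof (rule integral_cong_AE)
    show "(\<lambda>x. cnj (cnj (\<xi> x) * \<eta> x * h x)) \<in> borel_measurable M"
      using borel_measurable_integrable[OF ip_integrable[OF \<open>\<xi> \<in> Linf M\<close> \<open>\<eta> \<in> Linf M\<close>]]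
      by (rule measurable_compose[OF _ borel_measurable_continuous_onI]) (intro continuous_intros)
    show "(\<lambda>x. cnj (\<eta> x) * \<xi> x * h x) \<in> borel_measurable M"
      by (rule borel_measurable_integrable[OF ip_integrable[OF \<open>\<eta> \<in> Linf M\<close> \<open>\<xi> \<in> Linf M\<close>]])
    have "AE x in M. h x \<in> \<real>\<^sub>\<ge>\<^sub>0" using h by (simp add: harmonic_def)
    then show "AE x in M. cnj (cnj (\<xi> x) * \<eta> x * h x) = cnj (\<eta> x) * \<xi> x * h x"
      by eventually_elim (auto elim!: nonneg_Reals_cases)
  qed
  finally show ?thesis ..
qed

lemma Re_ip:
  assumes "\<xi> \<in> Linf M"
  shows "ip \<xi> \<xi> = complex_of_real (LINT x|M. (cmod (\<xi> x))\<^sup>2 * Re (h x))"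
    and "integrable M (\<lambda>x. (cmod (\<xi> x))\<^sup>2 * Re (h x))"
proof -
  have eq: "AE x in M. cnj (\<xi> x) * \<xi> x * h x = complex_of_real ((cmod (\<xi> x))\<^sup>2 * Re (h x))"
  proof -
    have "AE x in M. h x \<in> \<real>\<^sub>\<ge>\<^sub>0" using h by (simp add: harmonic_def)
    then show ?thesis
      by eventually_elim
        (auto elim!: nonneg_Reals_cases simp: complex_norm_square[unfolded of_real_power[symmetric]] mult.commute simp del: of_real_power)
  qed
  have [measurable]: "\<xi> \<in> borel_measurable M" "h \<in> borel_measurable M"
    using assms harmonic_integrable[OF h] by (auto intro: Linf_measurable)
  have m: "(\<lambda>x. complex_of_real ((cmod (\<xi> x))\<^sup>2 * Re (h x))) \<in> borel_measurable M" by measurable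
  have m': "(\<lambda>x. cnj (\<xi> x) * \<xi> x * h x) \<in> borel_measurable M"
    by (rule borel_measurable_integrable[OF ip_integrable[OF assms assms]])
  have "integrable M (\<lambda>x. complex_of_real ((cmod (\<xi> x))\<^sup>2 * Re (h x)))"
    using integrable_cong_AE[OF m' m eq] ip_integrable[OF assms assms] by blast
  then show "integrable M (\<lambda>x. (cmod (\<xi> x))\<^sup>2 * Re (h x))"
    using integrable_Re by fastforce
  have "ip \<xi> \<xi> = (LINT x|M. complex_of_real ((cmod (\<xi> x))\<^sup>2 * Re (h x)))"
    unfolding ip_def by (rule integral_cong_AE[OF m' m eq])
  then show "ip \<xi> \<xi> = complex_of_real (LINT x|M. (cmod (\<xi> x))\<^sup>2 * Re (h x))"
    by (simp only: integral_complex_of_real)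
qed

lemma Re_h_nonneg: "AE x in M. 0 \<le> Re (h x)"
proof -
  have "AE x in M. h x \<in> \<real>\<^sub>\<ge>\<^sub>0" using h by (simp add: harmonic_def)
  then show ?thesis by eventually_elim (simp add: complex_nonneg_Reals_iff)
qed

lemma ip_nonneg: "\<xi> \<in> Linf M \<Longrightarrow> ip \<xi> \<xi> \<in> \<real>\<^sub>\<ge>\<^sub>0"
proof -
  assume "\<xi> \<in> Linf M"
  have "0 \<le> (LINT x|M. (cmod (\<xi> x))\<^sup>2 * Re (h x))"
    using Re_h_nonneg by (intro integral_nonneg_AE) (auto elim: eventually_mono)
  then show ?thesis using Re_ip(1)[OF \<open>\<xi> \<in> Linf M\<close>] by simp
qed

text \<open>\<open>F (L, x)\<close> describes the vector at level \<open>L\<close>: the vector \<open>U\<^sup>-\<^sup>n \<xi> \<Omega>\<close> equals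
  \<open>U\<^sup>-\<^sup>L (U\<^sup>L\<^sup>-\<^sup>n \<xi> \<Omega>)\<close> for \<open>L \<ge> n\<close>, and passing from one level to the next is the isometry
  \<open>\<xi> \<mapsto> m (\<xi> \<circ> T)\<close> of \<open>L\<^sup>2(h d\<mu>)\<close>. Only the levels from some \<open>K\<close> on carry meaning.\<close>

definition coherent :: "nat \<Rightarrow> (nat \<times> 'x \<Rightarrow> complex) \<Rightarrow> bool" where
  "coherent K F \<longleftrightarrow> (\<forall>L. (\<lambda>x. F (L, x)) \<in> Linf M) \<and>
     (\<forall>L\<ge>K. \<forall>x. F (Suc L, x) = lowpass x * F (L, T x))"

definition V :: "(nat \<times> 'x \<Rightarrow> complex) set" where
  "V = {F. \<exists>K. coherent K F}"

text \<open>The inner product at level \<open>L\<close> is eventually constant in \<open>L\<close> on coherent families, because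
  the passage to the next level is isometric.\<close>

definition B :: "(nat \<times> 'x \<Rightarrow> complex) \<Rightarrow> (nat \<times> 'x \<Rightarrow> complex) \<Rightarrow> complex" where
  "B F G = lim (\<lambda>L. ip (\<lambda>x. F (L, x)) (\<lambda>x. G (L, x)))"

text \<open>On \<open>U\<^sup>-\<^sup>L \<xi> \<Omega>\<close>: \<open>f U\<^sup>-\<^sup>L = U\<^sup>-\<^sup>L (f \<circ> T\<^sup>L)\<close>, while \<open>U\<close> and \<open>U\<^sup>-\<^sup>1\<close> only relabel the levels. At level
  \<open>0\<close>, where \<open>L - 1 = L\<close>, the value of \<open>act GUi F\<close> carries no meaning.\<close>

fun act :: "'x letter \<Rightarrow> (nat \<times> 'x \<Rightarrow> complex) \<Rightarrow> nat \<times> 'x \<Rightarrow> complex" where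
  "act (Fn f) F = (\<lambda>(L, x). f ((T ^^ L) x) * F (L, x))"
| "act GU F = (\<lambda>(L, x). F (Suc L, x))"
| "act GUi F = (\<lambda>(L, x). F (L - 1, x))"

lemma coherent_Linf: "coherent K F \<Longrightarrow> (\<lambda>x. F (L, x)) \<in> Linf M"
  and coherent_Suc: "coherent K F \<Longrightarrow> K \<le> L \<Longrightarrow> F (Suc L, x) = lowpass x * F (L, T x)"
  and coherent_mono: "coherent K F \<Longrightarrow> K \<le> K' \<Longrightarrow> coherent K' F"
  unfolding coherent_def using order_trans by metis+

lemma coherent_V: "coherent K F \<Longrightarrow> F \<in> V"
  by (auto simp: V_def)

lemma common_level:
  assumes "F \<in> V" "G \<in> V"
  obtains K where "coherent K F" "coherent K G"
proof -
  obtain K K' where "coherent K F" "coherent K' G" using assms by (auto simp: V_def)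
  then show thesis using that[of "max K K'"] by (simp add: coherent_mono)
qed

lemma B_level:
  assumes F: "coherent K F" and G: "coherent K G"
  shows "B F G = ip (\<lambda>x. F (K, x)) (\<lambda>x. G (K, x))"
proof -
  have "ip (\<lambda>x. F (L, x)) (\<lambda>x. G (L, x)) = ip (\<lambda>x. F (K, x)) (\<lambda>x. G (K, x))" if "L \<ge> K" for L
    using that
  proof (induction L rule: dec_induct)
    case (step L)
    have "ip (\<lambda>x. F (Suc L, x)) (\<lambda>x. G (Suc L, x)) = ip (\<lambda>x. F (L, x)) (\<lambda>x. G (L, x))"
      using step ip_shift[OF coherent_Linf[OF F] coherent_Linf[OF G]]
      by (simp add: coherent_Suc[OF F] coherent_Suc[OF G])
    with step show ?case by simp
  qed simp
  then have "eventually (\<lambda>L. ip (\<lambda>x. F (L, x)) (\<lambda>x. G (L, x)) = ip (\<lambda>x. F (K, x)) (\<lambda>x. G (K, x))) sequentially"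
    unfolding eventually_at_top_linorder by blast
  then show ?thesis
    unfolding B_def by (intro limI tendsto_eventually)
qed

lemma coherent_add: "coherent K F \<Longrightarrow> coherent K G \<Longrightarrow> coherent K (\<lambda>i. F i + G i)"
  by (auto simp: coherent_def Linf_add distrib_left)

lemma coherent_scale: "coherent K F \<Longrightarrow> coherent K (\<lambda>i. c * F i)"
  by (auto simp: coherent_def Linf_mult[OF Linf_const])

lemma coherent_Fn:
  assumes f: "f \<in> Linf M" and F: "coherent K F"
  shows "coherent K (act (Fn f) F)"
  unfolding coherent_def
proof (intro conjI allI impI)
  show "(\<lambda>x. act (Fn f) F (L, x)) \<in> Linf M" for L
    using Linf_mult[OF Linf_T_pow[OF f, of L] coherent_Linf[OF F, of L]] by simp
  show "act (Fn f) F (Suc L, x) = lowpass x * act (Fn f) F (L, T x)" if "K \<le> L" for L x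
    using coherent_Suc[OF F that] by (simp add: funpow_swap1)
qed

lemma coherent_GU: "coherent K F \<Longrightarrow> coherent K (act GU F)"
  by (auto simp: coherent_def)

lemma coherent_GUi:
  assumes F: "coherent K F"
  shows "coherent (Suc K) (act GUi F)"
  unfolding coherent_def
proof (intro conjI allI impI)
  show "(\<lambda>x. act GUi F (L, x)) \<in> Linf M" for L
    using coherent_Linf[OF F, of "L - 1"] by simp
  show "act GUi F (Suc L, x) = lowpass x * act GUi F (L, T x)" if "Suc K \<le> L" for L x
    using coherent_Suc[OF F, of "L - 1" x] that by (cases L) auto
qed

lemma B_act_Fn:
  assumes f: "f \<in> Linf M"
  shows "\<exists>C. \<forall>F\<in>V. Re (B (act (Fn f) F) (act (Fn f) F)) \<le> C * Re (B F F)"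
proof -
  obtain C where C: "0 \<le> C" "AE x in M. cmod (f x) \<le> C" using Linf_bounded[OF f] .
  have "Re (B (act (Fn f) F) (act (Fn f) F)) \<le> C\<^sup>2 * Re (B F F)" if "F \<in> V" for F
  proof -
    obtain K where F: "coherent K F" using \<open>F \<in> V\<close> by (auto simp: V_def)
    have fF: "coherent K (act (Fn f) F)" by (rule coherent_Fn[OF f F])
    have "Re (B (act (Fn f) F) (act (Fn f) F))
        = (LINT x|M. (cmod (act (Fn f) F (K, x)))\<^sup>2 * Re (h x))"
      unfolding B_level[OF fF fF] Re_ip(1)[OF coherent_Linf[OF fF]] by (rule Re_complex_of_real)
    also have "\<dots> \<le> (LINT x|M. C\<^sup>2 * ((cmod (F (K, x)))\<^sup>2 * Re (h x)))"
    proof (rule integral_mono_AE)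
      show "integrable M (\<lambda>x. (cmod (act (Fn f) F (K, x)))\<^sup>2 * Re (h x))"
        by (rule Re_ip(2)[OF coherent_Linf[OF fF]])
      show "integrable M (\<lambda>x. C\<^sup>2 * ((cmod (F (K, x)))\<^sup>2 * Re (h x)))"
        using Re_ip(2)[OF coherent_Linf[OF F]] by simp
      show "AE x in M. (cmod (act (Fn f) F (K, x)))\<^sup>2 * Re (h x) \<le> C\<^sup>2 * ((cmod (F (K, x)))\<^sup>2 * Re (h x))"
        using AE_T_pow[OF C(2), of K] Re_h_nonneg
      proof eventually_elim
        case (elim x)
        have "(cmod (f ((T ^^ K) x)))\<^sup>2 \<le> C\<^sup>2" using elim by (intro power_mono) auto
        then have "(cmod (f ((T ^^ K) x)))\<^sup>2 * ((cmod (F (K, x)))\<^sup>2 * Re (h x)) \<le> C\<^sup>2 * ((cmod (F (K, x)))\<^sup>2 * Re (h x))"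
          using elim by (intro mult_right_mono) auto
        then show ?case by (simp add: norm_mult power_mult_distrib mult.assoc)
      qed
    qed
    also have "\<dots> = C\<^sup>2 * Re (B F F)"
      unfolding B_level[OF F F] Re_ip(1)[OF coherent_Linf[OF F]] by simp
    finally show ?thesis .
  qed
  then show ?thesis by blast
qed

text \<open>At level \<open>K + 1\<close> of the left side and level \<open>K\<close> of the right side the same two functions are paired.\<close>

lemma B_GU_GUi:
  assumes F: "F \<in> V" and G: "G \<in> V"
  shows "B (act GUi F) G = B F (act GU G)"
proof -
  obtain K where K: "coherent K F" "coherent K G" using common_level[OF F G] .
  have "B (act GUi F) G = ip (\<lambda>x. F (K, x)) (\<lambda>x. G (Suc K, x))"
    using B_level[OF coherent_GUi[OF K(1)] coherent_mono[OF K(2), of "Suc K"]] by simp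
  also have "\<dots> = B F (act GU G)"
    using B_level[OF K(1) coherent_GU[OF K(2)]] by simp
  finally show ?thesis .
qed

lemma B_hermitian:
  assumes F: "F \<in> V" and G: "G \<in> V"
  shows "B G F = cnj (B F G)"
proof -
  obtain K where K: "coherent K F" "coherent K G" using common_level[OF F G] .
  show ?thesis
    unfolding B_level[OF K] B_level[OF K(2,1)] by (rule ip_herm[OF coherent_Linf[OF K(1)] coherent_Linf[OF K(2)]])
qed

lemma act_closed:
  assumes l: "good_letter M l" and F: "F \<in> V"
  shows "act l F \<in> V"
proof -
  obtain K where "coherent K F" using F by (auto simp: V_def)
  then show ?thesis
    using l by (cases l) (auto simp: good_letter_def simp del: act.simps intro: coherent_V coherent_Fn coherent_GU coherent_GUi)
qed

lemma act_GU_isometric: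
  assumes F: "F \<in> V"
  shows "B (act GU F) (act GU F) = B F F" "B (act GUi F) (act GUi F) = B F F"
proof -
  obtain K where K: "coherent K F" using F by (auto simp: V_def)
  have K': "coherent (Suc K) F" using K by (simp add: coherent_mono)
  show "B (act GU F) (act GU F) = B F F"
    using B_level[OF coherent_GU[OF K] coherent_GU[OF K]] B_level[OF K' K'] by simp
  show "B (act GUi F) (act GUi F) = B F F"
    using B_level[OF coherent_GUi[OF K] coherent_GUi[OF K]] B_level[OF K K] by simp
qed

sublocale letter_representation M V B act
proof
  show "(\<lambda>i. 0) \<in> V"
    by (rule coherent_V[of 0]) (simp add: coherent_def Linf_const)
  fix F G H :: "nat \<times> 'x \<Rightarrow> complex" and c :: complex and l :: "'x letter"
  show "(\<lambda>i. F i + G i) \<in> V" if FG: "F \<in> V" "G \<in> V"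
    using common_level[OF FG] by (metis coherent_V coherent_add)
  show "(\<lambda>i. c * F i) \<in> V" if "F \<in> V"
    using that coherent_scale by (auto simp: V_def)
  show "B F (\<lambda>i. G i + H i) = B F G + B F H" if FGH: "F \<in> V" "G \<in> V" "H \<in> V"
  proof -
    obtain K where K: "coherent K F" "coherent K G" using common_level[OF FGH(1,2)] .
    obtain K' where K': "coherent K' H" using FGH by (auto simp: V_def)
    define L where "L = max K K'"
    have L: "coherent L F" "coherent L G" "coherent L H"
      using K K' by (auto simp: L_def intro: coherent_mono)
    show ?thesis
      unfolding B_level[OF L(1,2)] B_level[OF L(1,3)] B_level[OF L(1) coherent_add[OF L(2,3)]] ip_def
      using ip_integrable[OF coherent_Linf[OF L(1)] coherent_Linf[OF L(2)]]
        ip_integrable[OF coherent_Linf[OF L(1)] coherent_Linf[OF L(3)]]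
      by (simp add: distrib_left distrib_right)
  qed
  show "B F (\<lambda>i. c * G i) = c * B F G" if FG: "F \<in> V" "G \<in> V"
  proof -
    obtain K where K: "coherent K F" "coherent K G" using common_level[OF FG] .
    show ?thesis
      unfolding B_level[OF K] B_level[OF K(1) coherent_scale[OF K(2)]] ip_def
      by (simp add: mult_ac flip: integral_mult_right_zero)
  qed
  show "B G F = cnj (B F G)" if "F \<in> V" "G \<in> V"
    using that by (rule B_hermitian)
  show "B F F \<in> \<real>\<^sub>\<ge>\<^sub>0" if "F \<in> V"
  proof -
    obtain K where K: "coherent K F" using \<open>F \<in> V\<close> by (auto simp: V_def)
    show ?thesis unfolding B_level[OF K K] by (rule ip_nonneg[OF coherent_Linf[OF K]])
  qed
  show "act l F \<in> V" if "good_letter M l" "F \<in> V"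
    using that by (rule act_closed)
  show "act l (\<lambda>i. F i + G i) = (\<lambda>i. act l F i + act l G i)" if "F \<in> V" "G \<in> V"
    by (cases l) (auto simp: distrib_left)
  show "act l (\<lambda>i. c * F i) = (\<lambda>i. c * act l F i)" if "F \<in> V"
    by (cases l) auto
  show "B (act (letter_star l) F) G = B F (act l G)" if lFG: "good_letter M l" "F \<in> V" "G \<in> V"
  proof (cases l)
    case (Fn f)
    then have f: "f \<in> Linf M" using lFG by (simp add: good_letter_def)
    obtain K where K: "coherent K F" "coherent K G" using common_level[OF lFG(2,3)] .
    show ?thesis
      unfolding Fn letter_star.simps
        B_level[OF coherent_Fn[OF Linf_cnj[OF f] K(1)] K(2)] B_level[OF K(1) coherent_Fn[OF f K(2)]]
      by (simp add: ip_def mult_ac)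
  next
    case GU
    then show ?thesis using B_GU_GUi lFG by simp
  next
    case GUi
    have "B (act GU F) G = cnj (B G (act GU F))"
      by (rule B_hermitian[OF lFG(3) act_closed[OF _ lFG(2)]]) (simp add: good_letter_def)
    also have "\<dots> = cnj (B (act GUi G) F)" by (simp only: B_GU_GUi[OF lFG(3,2)])
    also have "\<dots> = B F (act GUi G)"
      by (rule B_hermitian[OF act_closed[OF _ lFG(3)] lFG(2), symmetric]) (simp add: good_letter_def)
    finally show ?thesis using GUi by simp
  qed
  show "\<exists>C. \<forall>F\<in>V. Re (B (act l F) (act l F)) \<le> C * Re (B F F)" if "good_letter M l"
  proof (cases l)
    case (Fn f)
    then have "f \<in> Linf M" using that by (simp add: good_letter_def)
    then show ?thesis
      unfolding Fn by (rule B_act_Fn)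
  next
    case GU
    show ?thesis unfolding GU using act_GU_isometric(1) by (intro exI[of _ 1]) (simp del: act.simps)
  next
    case GUi
    show ?thesis unfolding GUi using act_GU_isometric(2) by (intro exI[of _ 1]) (simp del: act.simps)
  qed
qed

lemma vnorm_zero_eventually:
  assumes F: "F \<in> V" and ev: "\<And>L. L \<ge> K \<Longrightarrow> AE x in M. F (L, x) = 0"
  shows "vnorm F = 0"
proof -
  obtain K' where "coherent K' F" using F by (auto simp: V_def)
  then have L: "coherent (max K K') F" by (rule coherent_mono) simp
  let ?L = "max K K'"
  have ae: "AE x in M. (cmod (F (?L, x)))\<^sup>2 * Re (h x) = 0"
    using ev[of ?L] by (auto elim: eventually_mono)
  have "B F F = complex_of_real (LINT x|M. (cmod (F (?L, x)))\<^sup>2 * Re (h x))"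
    unfolding B_level[OF L L] by (rule Re_ip(1)[OF coherent_Linf[OF L]])
  also have "(LINT x|M. (cmod (F (?L, x)))\<^sup>2 * Re (h x)) = 0"
    using ae by (rule integral_eq_zero_AE)
  finally show ?thesis by (simp add: vnorm_def)
qed

lemma good_words:
  "f \<in> Linf M \<Longrightarrow> nc_word [Fn f] \<in> free_alg M"
  "f \<in> Linf M \<Longrightarrow> k \<in> Linf M \<Longrightarrow> nc_word [Fn f, Fn k] \<in> free_alg M"
  "nc_word [] \<in> free_alg M" "nc_word [GUi, GU] \<in> free_alg M" "nc_word [GU, GUi] \<in> free_alg M"
  "f \<in> Linf M \<Longrightarrow> nc_word [GU, Fn f, GUi] \<in> free_alg M"
  by (auto intro!: free_alg_word simp: good_letter_def)

text \<open>Level \<open>0\<close> is excluded for the relation \<open>U\<^sup>-\<^sup>1 U = 1\<close>, as \<open>act GUi\<close> reads level \<open>L - 1\<close>.\<close>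

lemma rep_respects_relations:
  assumes "nc_relation M T a b"
  shows "a \<in> free_alg M \<and> b \<in> free_alg M \<and>
    (\<forall>F. \<forall>L\<ge>1. AE x in M. rep a F (L, x) = rep b F (L, x))"
  using assms
proof cases
  case (AE_eq f k)
  have "AE x in M. rep (nc_word [Fn f]) F (L, x) = rep (nc_word [Fn k]) F (L, x)" for F L
    using AE_T_pow[OF AE_eq(5), of L] by eventually_elim (simp add: rep_word)
  with AE_eq show ?thesis by (simp add: good_words)
next
  case (add f k)
  then show ?thesis
    by (auto simp: good_words rep_word rep_add free_alg_add Linf_add distrib_right)
next
  case (scale f c)
  then show ?thesis
    by (auto simp: good_words rep_word rep_scale free_alg_scale Linf_mult[OF Linf_const])
next
  case (mult f k)
  then show ?thesis
    by (auto simp: good_words rep_word Linf_mult)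
next
  case one
  then show ?thesis by (auto simp: good_words rep_word Linf_const)
next
  case unitary_left
  then show ?thesis by (auto simp: good_words rep_word)
next
  case unitary_right
  then show ?thesis by (auto simp: good_words rep_word)
next
  case (covariance f)
  then show ?thesis
    using Linf_T[of f] by (auto simp: good_words rep_word o_def)
qed

lemma opnorm_relation:
  assumes "nc_relation M T a b"
  shows "opnorm (\<lambda>w. a w - b w) = 0"
proof -
  have a: "a \<in> free_alg M" and b: "b \<in> free_alg M"
    and eq: "\<And>F L. L \<ge> 1 \<Longrightarrow> AE x in M. rep a F (L, x) = rep b F (L, x)"
    using rep_respects_relations[OF assms] by auto
  have diff: "(\<lambda>w. a w - b w) = (\<lambda>w. a w + (- 1) * b w)" by simp
  have free: "(\<lambda>w. a w - b w) \<in> free_alg M"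
    unfolding diff by (intro free_alg_add free_alg_scale a b)
  show ?thesis
  proof (rule opnorm_eq_zero[OF _ free])
    fix F assume F: "F \<in> V"
    have "rep (\<lambda>w. a w - b w) F = (\<lambda>i. rep a F i + (- 1) * rep b F i)"
      by (simp only: diff rep_add[OF a free_alg_scale[OF b]] rep_scale[OF b])
    then show "vnorm (rep (\<lambda>w. a w - b w) F) = 0"
      using eq by (intro vnorm_zero_eventually[OF rep_V[OF free F], of 1]) (auto elim: eventually_mono)
  qed
qed

text \<open>The universal property of \<open>\<AA>(X,T)\<close>, applied to the dilation.\<close>

lemma opnorm_le: "a \<in> free_alg M \<Longrightarrow> opnorm a \<le> norm (nc_eval \<iota> u a)"
  using alg cstar_seminorm_opnorm opnorm_relation unfolding is_covariance_algebra_def by blast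

text \<open>The vector \<open>\<Omega>\<close>: at level \<open>L\<close> it is \<open>U\<^sup>-\<^sup>L m\<^sup>(\<^sup>L\<^sup>) \<Omega>\<close>, by the refinement equation.\<close>

definition cyclic :: "nat \<times> 'x \<Rightarrow> complex" where
  "cyclic = (\<lambda>(L, x). filter_pow L x)"

lemma coherent_cyclic: "coherent 0 cyclic"
  by (simp add: coherent_def cyclic_def filter_pow_Suc Linf_filter_pow)

lemma cyclic_V: "cyclic \<in> V"
  by (rule coherent_V[OF coherent_cyclic])

lemma vector_state_bound:
  assumes a: "a \<in> free_alg M"
  shows "cmod (B cyclic (rep a cyclic)) \<le> (vnorm cyclic)\<^sup>2 * norm (nc_eval \<iota> u a)"
proof -
  have "cmod (B cyclic (rep a cyclic)) \<le> vnorm cyclic * vnorm (rep a cyclic)"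
    by (intro B_Cauchy_Schwarz cyclic_V rep_V a)
  also have "\<dots> \<le> vnorm cyclic * (norm (nc_eval \<iota> u a) * vnorm cyclic)"
    using vnorm_rep_le[OF a cyclic_V] mult_right_mono[OF opnorm_le[OF a] vnorm_nonneg[OF cyclic_V]]
    by (intro mult_left_mono vnorm_nonneg cyclic_V) linarith
  finally show ?thesis by (simp add: power2_eq_square mult_ac)
qed

lemma foldr_GU: "foldr act (replicate n GU) F = (\<lambda>(L, x). F (L + n, x))"
  by (induction n) auto

lemma nc_eval_dense: "closure (nc_eval \<iota> u ` free_alg M) = UNIV"
proof -
  let ?D = "{adj u ^ n * \<iota> f * u ^ k | n f k. f \<in> Linf M}"
  have "subspace (nc_eval \<iota> u ` free_alg M)"
  proof (rule subspaceI)
    have "nc_eval \<iota> u (\<lambda>w. 0 * nc_word [] w) = 0"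
      by (subst nc_eval_scale) (auto intro: good_words)
    then show "0 \<in> nc_eval \<iota> u ` free_alg M"
      using free_alg_scale[OF good_words(3), of 0] by (metis (no_types, lifting) imageI)
    fix x y assume "x \<in> nc_eval \<iota> u ` free_alg M" "y \<in> nc_eval \<iota> u ` free_alg M"
    then obtain a b where ab: "a \<in> free_alg M" "b \<in> free_alg M" "x = nc_eval \<iota> u a" "y = nc_eval \<iota> u b"
      by auto
    then show "x + y \<in> nc_eval \<iota> u ` free_alg M"
      using nc_eval_add[OF ab(1,2), of \<iota> u] free_alg_add[OF ab(1,2)] by (metis imageI)
    show "r *\<^sub>R x \<in> nc_eval \<iota> u ` free_alg M" for r
      using nc_eval_scale[OF ab(1), of \<iota> u "complex_of_real r"] free_alg_scale[OF ab(1), of "complex_of_real r"]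
      by (metis imageI ab(3) scaleR_conv_scaleC)
  qed
  moreover have "?D \<subseteq> nc_eval \<iota> u ` free_alg M"
  proof clarify
    fix n f k assume f: "f \<in> Linf M"
    let ?w = "replicate n GUi @ Fn f # replicate k GU"
    have "nc_word ?w \<in> free_alg M"
      using f by (intro free_alg_word) (auto simp: good_letter_def)
    moreover have "adj u ^ n * \<iota> f * u ^ k = nc_eval \<iota> u (nc_word ?w)"
      by (simp add: nc_eval_word prod_list_replicate mult.assoc)
    ultimately show "adj u ^ n * \<iota> f * u ^ k \<in> nc_eval \<iota> u ` free_alg M" by blast
  qed
  ultimately have "span ?D \<subseteq> nc_eval \<iota> u ` free_alg M" by (rule span_minimal[rotated])
  then have "closure (span ?D) \<subseteq> closure (nc_eval \<iota> u ` free_alg M)" by (rule closure_mono)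
  moreover have "closure (span ?D) = UNIV"
    using alg unfolding is_covariance_algebra_def by blast
  ultimately show ?thesis by auto
qed

text \<open>The vector state \<open>a \<mapsto> \<langle>\<Omega>, a \<Omega>\<rangle>\<close> is dominated by the norm of the evaluation of \<open>a\<close>, so it descends
  to the image of the free *-algebra and extends to its closure. The two formulas are read off at
  levels \<open>0\<close> and \<open>1\<close>, where \<open>\<Omega>\<close> is \<open>1\<close> and \<open>m\<close>.\<close>

lemma functional_exists: "\<exists>\<omega>. positive_functional \<omega> \<and> represents M T N g \<iota> u h \<omega>"
proof -
  define \<phi> where "\<phi> a = B cyclic (rep a cyclic)" for a
  have \<phi>_add: "\<phi> (\<lambda>w. a w + b w) = \<phi> a + \<phi> b" if "a \<in> free_alg M" "b \<in> free_alg M" for a b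
    using that by (simp add: \<phi>_def rep_add B_add cyclic_V rep_V)
  have \<phi>_scale: "\<phi> (\<lambda>w. c * a w) = c * \<phi> a" if "a \<in> free_alg M" for a c
    using that by (simp add: \<phi>_def rep_scale B_scale cyclic_V rep_V)
  obtain \<omega> where \<omega>: "bounded_linear \<omega>" "\<And>a. a \<in> free_alg M \<Longrightarrow> \<omega> (nc_eval \<iota> u a) = \<phi> a"
  proof (rule bounded_linear_extension_of_graph[of "free_alg M" "nc_eval \<iota> u" \<phi> "(vnorm cyclic)\<^sup>2"])
    fix a b r assume ab: "a \<in> free_alg M" "b \<in> free_alg M"
    let ?c = "\<lambda>w. a w + complex_of_real r * b w"
    have "?c \<in> free_alg M" by (intro free_alg_add free_alg_scale ab)
    moreover have "nc_eval \<iota> u ?c = nc_eval \<iota> u a + r *\<^sub>R nc_eval \<iota> u b"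
      by (simp add: nc_eval_add[OF ab(1) free_alg_scale[OF ab(2)]] nc_eval_scale[OF ab(2)] scaleR_conv_scaleC)
    moreover have "\<phi> ?c = \<phi> a + r *\<^sub>R \<phi> b"
      by (simp add: \<phi>_add[OF ab(1) free_alg_scale[OF ab(2)]] \<phi>_scale[OF ab(2)] scaleR_conv_of_real)
    ultimately show "\<exists>c\<in>free_alg M. nc_eval \<iota> u c = nc_eval \<iota> u a + r *\<^sub>R nc_eval \<iota> u b \<and> \<phi> c = \<phi> a + r *\<^sub>R \<phi> b"
      by blast
  next
    show "norm (\<phi> a) \<le> (vnorm cyclic)\<^sup>2 * norm (nc_eval \<iota> u a)" if "a \<in> free_alg M" for a
      unfolding \<phi>_def by (rule vector_state_bound[OF that])
  qed (use nc_eval_dense that in auto)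
  have cont: "continuous_on UNIV \<omega>" by (rule linear_continuous_on[OF \<omega>(1)])
  have "positive_functional \<omega>"
    unfolding positive_functional_def
  proof (intro conjI allI)
    show "\<omega> (a + b) = \<omega> a + \<omega> b" for a b
      using \<omega>(1) by (simp add: bounded_linear.linear linear_add)
    fix a
    show "\<omega> (c *\<^sub>C a) = c * \<omega> a" for c
    proof (rule continuous_eq_on_dense[OF _ _ nc_eval_dense])
      have "bounded_linear (\<lambda>x. c *\<^sub>C (x :: 'a))"
        by (rule bounded_linear_intro[where K = "cmod c"])
          (simp_all add: scaleC_add_right scaleR_conv_scaleC scaleC_scaleC mult.commute norm_scaleC)
      from bounded_linear_compose[OF \<omega>(1) this] show "continuous_on UNIV (\<lambda>x. \<omega> (c *\<^sub>C x))"
        by (rule linear_continuous_on)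
      show "continuous_on UNIV (\<lambda>x. c * \<omega> x)" by (intro continuous_intros cont)
      fix x assume "x \<in> nc_eval \<iota> u ` free_alg M"
      then obtain b where b: "b \<in> free_alg M" "x = nc_eval \<iota> u b" by auto
      then show "\<omega> (c *\<^sub>C x) = c * \<omega> x"
        using nc_eval_scale[OF b(1), of \<iota> u c] \<omega>(2)[OF free_alg_scale[OF b(1), of c]] \<omega>(2)[OF b(1)]
        by (simp add: \<phi>_scale)
    qed
    have cont2: "continuous_on UNIV (\<lambda>a. \<omega> (adj a * a))"
      by (intro continuous_on_compose2[OF cont] continuous_intros linear_continuous_on[OF bounded_linear_adj]) auto
    have "closure (nc_eval \<iota> u ` free_alg M) \<subseteq> (\<lambda>a. \<omega> (adj a * a)) -` \<real>\<^sub>\<ge>\<^sub>0"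
    proof (rule closure_minimal)
      show "closed ((\<lambda>a. \<omega> (adj a * a)) -` \<real>\<^sub>\<ge>\<^sub>0)"
        using cont2 by (intro closed_vimage closed_nonneg_Reals_complex)
      show "nc_eval \<iota> u ` free_alg M \<subseteq> (\<lambda>a. \<omega> (adj a * a)) -` \<real>\<^sub>\<ge>\<^sub>0"
      proof clarsimp
        fix b assume b: "b \<in> free_alg M"
        have s: "nc_mult (nc_star b) b \<in> free_alg M" by (intro free_alg_mult free_alg_star b)
        have "\<omega> (adj (nc_eval \<iota> u b) * nc_eval \<iota> u b) = \<phi> (nc_mult (nc_star b) b)"
          using \<omega>(2)[OF s] by (simp add: nc_eval_mult[OF free_alg_star[OF b] b] nc_eval_star[OF cov b])
        also have "\<dots> = B (rep b cyclic) (rep b cyclic)"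
          using rep_star[OF free_alg_star[OF b] cyclic_V rep_V[OF b cyclic_V]]
          by (simp add: \<phi>_def rep_mult[OF free_alg_star[OF b] b cyclic_V])
        finally show "\<omega> (adj (nc_eval \<iota> u b) * nc_eval \<iota> u b) \<in> \<real>\<^sub>\<ge>\<^sub>0"
          using B_pos[OF rep_V[OF b cyclic_V]] by simp
      qed
    qed
    then show "\<omega> (adj a * a) \<in> \<real>\<^sub>\<ge>\<^sub>0" unfolding nc_eval_dense by blast
  qed
  moreover have "represents M T N g \<iota> u h \<omega>"
    unfolding represents_iff[OF harmonic_integrable[OF h]]
  proof (intro conjI ballI allI)
    fix f n assume f: "f \<in> Linf M"
    have shift: "coherent 0 (\<lambda>(L, x). cyclic (L + n, x))" for n
      using coherent_cyclic by (auto simp: coherent_def)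
    show "\<omega> (\<iota> f * u ^ n) = (LINT x|M. f x * filter_pow n x * h x)"
    proof -
      let ?w = "Fn f # replicate n GU"
      have w: "nc_word ?w \<in> free_alg M" using f by (intro free_alg_word) (auto simp: good_letter_def)
      have "\<omega> (\<iota> f * u ^ n) = \<phi> (nc_word ?w)"
        using \<omega>(2)[OF w] by (simp add: nc_eval_word prod_list_replicate)
      also have "\<dots> = B cyclic (act (Fn f) (\<lambda>(L, x). cyclic (L + n, x)))"
        by (simp only: \<phi>_def rep_word foldr.simps o_apply foldr_GU)
      also have "\<dots> = (LINT x|M. f x * filter_pow n x * h x)"
        unfolding B_level[OF coherent_cyclic coherent_Fn[OF f shift]]
        by (simp add: ip_def cyclic_def)
      finally show ?thesis .
    qed
    show "\<omega> (adj u * \<iota> f * u ^ Suc n) = (LINT x|M. lowpass x * f x * filter_pow (Suc n) x * h x)"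
    proof -
      let ?w = "GUi # Fn f # replicate (Suc n) GU"
      have w: "nc_word ?w \<in> free_alg M" using f by (intro free_alg_word) (auto simp: good_letter_def)
      have "\<omega> (adj u * \<iota> f * u ^ Suc n) = \<phi> (nc_word ?w)"
        using \<omega>(2)[OF w] by (simp add: nc_eval_word prod_list_replicate mult.assoc)
      also have "\<dots> = B cyclic (act GUi (act (Fn f) (\<lambda>(L, x). cyclic (L + Suc n, x))))"
        by (simp only: \<phi>_def rep_word foldr.simps o_apply foldr_GU)
      also have "\<dots> = (LINT x|M. lowpass x * f x * filter_pow (Suc n) x * h x)"
        unfolding B_level[OF coherent_mono[OF coherent_cyclic, of "Suc 0", simplified] coherent_GUi[OF coherent_Fn[OF f shift]]]
        by (simp add: ip_def cyclic_def mult_ac)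
      finally show ?thesis .
    qed
  qed
  ultimately show ?thesis by blast
qed

end

section \<open>The correspondence\<close>

theorem theorem6p7:
  fixes M :: "'x measure" and T :: "'x \<Rightarrow> 'x" and N :: nat and \<sigma> :: "nat \<Rightarrow> 'x \<Rightarrow> 'x"
    and g :: "'x \<Rightarrow> real" and \<iota> :: "('x \<Rightarrow> complex) \<Rightarrow> 'a::cstar_algebra" and u :: 'a
  assumes "N \<ge> 2"
    and "branched_system M T N \<sigma>"
    and "g \<in> borel_measurable M"
    and "\<forall>x\<in>space M. 0 \<le> g x \<and> g x \<le> 1"
    and "AE x in M. (\<Sum>i=1..N. g (\<sigma> i x)) = 1"
    and "is_covariance_algebra M T \<iota> u"
  shows
    "(\<exists>\<Phi>. bij_betw \<Phi> (harmonic M T g // L1_eq M)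
              {\<omega>. positive_functional \<omega> \<and> (\<exists>h. integrable M h \<and> represents M T N g \<iota> u h \<omega>)} \<and>
            (\<forall>h\<in>harmonic M T g. represents M T N g \<iota> u h (\<Phi> (L1_eq M `` {h}))))
     \<and>
     (\<forall>h\<in>harmonic M T g. \<forall>\<omega>. positive_functional \<omega> \<and> represents M T N g \<iota> u h \<omega> \<longrightarrow>
        (nonsingular M g \<and> ergodic M T \<longrightarrow>
           (\<forall>(\<pi> :: 'a \<Rightarrow> 'h::chilbert_space \<Rightarrow> 'h) \<Omega>.
              gns_rep \<omega> \<pi> \<Omega> \<longrightarrow> unitary_map (\<pi> u))) \<and>
        (\<forall>(\<pi>1 :: 'a \<Rightarrow> 'h \<Rightarrow> 'h) \<Omega>1 (\<pi>2 :: 'a \<Rightarrow> 'k::chilbert_space \<Rightarrow> 'k) \<Omega>2.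
           gns_rep \<omega> \<pi>1 \<Omega>1 \<and> gns_rep \<omega> \<pi>2 \<Omega>2 \<longrightarrow>
             (\<exists>W :: 'h \<Rightarrow> 'k. unitary_map W \<and> W \<Omega>1 = \<Omega>2 \<and>
                (\<forall>a x. W (\<pi>1 a x) = \<pi>2 a (W x)))))"
proof (intro conjI ballI allI impI)
  interpret branched_algebra M T N \<sigma> g \<iota> u
    by unfold_locales (use assms in auto)
  let ?R = "represents M T N g \<iota> u"
  \<comment> \<open>Well defined on classes, since \<open>represents\<close> is invariant under changing \<open>h\<close> on a null set.\<close>
  define \<Phi> where "\<Phi> C = (SOME \<omega>. positive_functional \<omega> \<and> (\<exists>h\<in>C \<inter> harmonic M T g. ?R h \<omega>))" for C
  have in_class: "h \<in> L1_eq M `` {h}" if "h \<in> harmonic M T g" for h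
    using harmonic_integrable[OF that] by (simp add: L1_eq_def)
  have exists: "\<exists>\<omega>. positive_functional \<omega> \<and> ?R h \<omega>" if "h \<in> harmonic M T g" for h
  proof -
    interpret harmonic_system M T N \<sigma> g \<iota> u h by unfold_locales (rule that)
    show ?thesis by (rule functional_exists)
  qed
  have \<Phi>: "positive_functional (\<Phi> (L1_eq M `` {h})) \<and> ?R h (\<Phi> (L1_eq M `` {h}))"
    if h: "h \<in> harmonic M T g" for h
  proof -
    let ?C = "L1_eq M `` {h}"
    have "\<exists>\<omega>. positive_functional \<omega> \<and> (\<exists>h\<in>?C \<inter> harmonic M T g. ?R h \<omega>)"
      using exists[OF h] in_class[OF h] h by blast
    then have "positive_functional (\<Phi> ?C) \<and> (\<exists>h\<in>?C \<inter> harmonic M T g. ?R h (\<Phi> ?C))"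
      unfolding \<Phi>_def by (rule someI_ex)
    then obtain k where k: "positive_functional (\<Phi> ?C)" "k \<in> ?C" "?R k (\<Phi> ?C)" by blast
    have "integrable M k" "integrable M h" "AE x in M. k x = h x"
      using k(2) by (auto simp: L1_eq_def elim: eventually_mono)
    from represents_cong_AE[OF this k(3)] k(1) show ?thesis by blast
  qed
  let ?Q = "harmonic M T g // L1_eq M"
  let ?F = "{\<omega>. positive_functional \<omega> \<and> (\<exists>h. integrable M h \<and> ?R h \<omega>)}"
  have "bij_betw \<Phi> ?Q ?F"
  proof (rule bij_betw_imageI)
    show "inj_on \<Phi> ?Q"
    proof (rule inj_onI)
      fix C D assume "C \<in> ?Q" "D \<in> ?Q" and eq: "\<Phi> C = \<Phi> D"
      then obtain h k where h: "h \<in> harmonic M T g" "C = L1_eq M `` {h}"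
        and k: "k \<in> harmonic M T g" "D = L1_eq M `` {k}" by (auto simp: quotient_def)
      have ints: "integrable M h" "integrable M k" using h k by (auto intro: harmonic_integrable)
      have "AE x in M. h x = k x"
        using represents_unique_function[OF ints] \<Phi>[OF h(1)] \<Phi>[OF k(1)] eq h(2) k(2) by metis
      with ints have "L1_eq M `` {h} = L1_eq M `` {k}"
        by (auto simp: L1_eq_def elim: eventually_elim2)
      then show "C = D" using h k by simp
    qed
    show "\<Phi> ` ?Q = ?F"
    proof (intro equalityI subsetI)
      fix \<omega> assume "\<omega> \<in> \<Phi> ` ?Q"
      then obtain h where "h \<in> harmonic M T g" "\<omega> = \<Phi> (L1_eq M `` {h})" by (auto simp: quotient_def)
      then show "\<omega> \<in> ?F" using \<Phi>[of h] harmonic_integrable[of h] by blast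
    next
      fix \<omega> assume "\<omega> \<in> ?F"
      then obtain h where \<omega>: "positive_functional \<omega>" "integrable M h" "?R h \<omega>" by blast
      have h: "h \<in> harmonic M T g" by (rule represents_imp_harmonic[OF \<omega>])
      have "\<omega> = \<Phi> (L1_eq M `` {h})"
        using represents_unique_functional[OF \<omega>(1,3) _ _ h] \<Phi>[OF h] by blast
      moreover have "L1_eq M `` {h} \<in> ?Q" using h by (rule quotientI)
      ultimately show "\<omega> \<in> \<Phi> ` ?Q" by blast
    qed
  qed
  then show "\<exists>\<Phi>. bij_betw \<Phi> ?Q ?F \<and> (\<forall>h\<in>harmonic M T g. ?R h (\<Phi> (L1_eq M `` {h})))"
    using \<Phi> by blast
  fix h \<omega>
  show "unitary_map (\<pi> u)" if "gns_rep \<omega> \<pi> \<Omega>" for \<pi> :: "'a \<Rightarrow> 'h \<Rightarrow> 'h" and \<Omega>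
    using that u_unitary by (intro star_rep_unitary) (auto simp: gns_rep_def)
  show "\<exists>W :: 'h \<Rightarrow> 'k. unitary_map W \<and> W \<Omega>1 = \<Omega>2 \<and> (\<forall>a x. W (\<pi>1 a x) = \<pi>2 a (W x))"
    if "gns_rep \<omega> \<pi>1 \<Omega>1 \<and> gns_rep \<omega> \<pi>2 \<Omega>2" for \<pi>1 \<Omega>1 \<pi>2 \<Omega>2
    using that gns_unique by blast
qed

end
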